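(* Let $\mathcal{D}=\{(s_h^k,a_h^k)\}_{(h,k)\in[H]\times[K]}$ be a given offline dataset that is compliant with the underlying tabular MDP, and assume the realizability and bounded-noise assumptions (margin $\Delta$) on the human feedback. Let $\delta\in(0,1)$ and let $\hat\pi$ be the output of LCBVI-Tabular-Offline (described in the context) on $\mathcal{D}$. Then with probability at least $1-\delta$, $$V_1^*(s_1)-V_1^{\hat\pi}(s_1)\le 2\left(H\sqrt{S\log(SAHK/\delta)}\cdot\mathbb{E}_{\pi^*}\left[\sum_{h=1}^H(N_h(s_h,a_h)+1)^{-1/2}\right]\right),$$ where $\pi^*$ is the optimal policy, $N_h(s,a)$ is the number of $k\in[K]$ with $(s_h^k,a_h^k)=(s,a)$, and the expectation is over the trajectory of $\pi^*$. Moreover the total number of queries is bounded by $\tilde O(H\cdot\dim^2(\mathcal{F})/\Delta^2)$.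
   Context: MDP: $M=(\mathcal{S},\mathcal{A},P,r,H,s_1)$ with finite $\mathcal{S},\mathcal{A}$, $S=|\mathcal{S}|$, $A=|\mathcal{A}|$, transition kernels $P_h(\cdot|s,a)$, deterministic rewards $r_h:\mathcal{S}\times\mathcal{A}\to\{0,1\}$, $h\in[H]$, fixed initial state $s_1$. $V_h^\pi(s)=\mathbb{E}[\sum_{h'=h}^Hr_{h'}(s_{h'},a_{h'})\mid s_h=s,\pi]$, $V_h^*=\max_\pi V_h^\pi$. $\tilde O$ hides polylogarithmic factors; $\Pi_{[a,b]}$ is truncation to $[a,b]$. Compliance: with $\mathbb{P}_{\mathcal{D}}$ the joint law of the data collecting process, $\mathcal{D}$ is compliant with the MDP if $\mathbb{P}_{\mathcal{D}}(s_{h+1}^k=s\mid\{(s_h^j,a_h^j)\}_{j=1}^k,\{s_{h+1}^j\}_{j=1}^{k-1})=P_h(s|s_h^k,a_h^k)$ for all $h\in[H]$, $k\in[K]$, $s\in\mathcal{S}$. Human feedback: for each $h$ there is $f_h^*:\mathcal{S}\times\mathcal{A}\to[0,1]$; a query of $z=(s,a)$ at stage $h$ returns an independent response in $\{0,1\}$ equal to $1$ with probability $f_h^*(z)$; $r_h(z)=1$ if $f_h^*(z)>1/2$, else $0$. Realizability: $f_h^*\in\mathcal{F}$ for a known class $\mathcal{F}$ of functions $\mathcal{S}\times\mathcal{A}\to[0,1]$. Bounded noise: $|f_h^*(z)-1/2|>\Delta>0$ for all $z$ and $h$. Complexity of $\mathcal{F}$: for a finite sequence $\mathcal{Z}'$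 in $\mathcal{S}\times\mathcal{A}$, $\|f\|_{\mathcal{Z}'}=(\sum_{z\in\mathcal{Z}'}f(z)^2)^{1/2}$. $z$ is $\varepsilon$-dependent on $\mathcal{Z}'$ if any $f,f'\in\mathcal{F}$ with $\|f-f'\|_{\mathcal{Z}'}\le\varepsilon$ satisfy $|f(z)-f'(z)|\le\varepsilon$, otherwise $\varepsilon$-independent; $\dim_E(\mathcal{F},\varepsilon)$ is the length of the longest sequence such that for some $\varepsilon'\ge\varepsilon$ every element is $\varepsilon'$-independent of its predecessors; $\dim_E(\mathcal{F})=\limsup_{\alpha\downarrow0}\dim_E(\mathcal{F},\alpha)/\log(1/\alpha)$. $\mathcal{C}(\mathcal{F},\varepsilon)\subseteq\mathcal{F}$ is an $\varepsilon$-cover of $\mathcal{F}$ in $\|\cdot\|_\infty$ of size at most $\mathcal{N}(\mathcal{F},\varepsilon)$; $\dim_K(\mathcal{F})=\limsup_{\alpha\downarrow0}\log\mathcal{N}(\mathcal{F},\alpha)/\log(1/\alpha)$; $\dim(\mathcal{F})=\max\{\dim_E(\mathcal{F}),\dim_K(\mathcal{F})\}$. Active Reward Learning$(\mathcal{Z},\Delta,\delta)$ at a stage $h$, for a finite pool $\mathcal{Z}$: $N=C_1\frac{(\dim^2(\mathcal{F})+\dim(\mathcal{F})\log(1/\delta))\log^2(\dim(\mathcal{F}))}{\Delta^2}$, $\beta=C_2\sqrt{\log(1/\delta)+\log N\cdot\dim(\mathcal{F})}$ ($C_1,C_2$ universal). Starting from the empty sequence $\mathcal{Z}_0$, for $k=1,\dots,N$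 let $b_k(z)=\sup\{|f(z)-f'(z)|:f,f'\in\mathcal{F},\|f-f'\|_{\mathcal{Z}_{k-1}}\le\beta\}$, $z_k\in\arg\max_{z\in\mathcal{Z}}b_k(z)$, append $z_k$ to get $\mathcal{Z}_k$. Query labels $l(z)$ for all entries of $\mathcal{Z}_N$; $\tilde f\in\arg\min_{f\in\mathcal{F}}\sum_{z\in\mathcal{Z}_N}(f(z)-l(z))^2$; $\hat f\in\mathcal{C}(\mathcal{F},\Delta/2)$ with $\|\hat f-\tilde f\|_\infty\le\Delta/2$; output $\hat r=\mathbb{1}\{\hat f>1/2\}$. LCBVI-Tabular-Offline: for each $h$, $\hat r_h=$ Active Reward Learning$(\{(s_h^k,a_h^k)\}_{k\in[K]},\Delta,\delta/(2H))$. Let $\widehat P_h(s'|s,a)$ be the empirical transition frequency from $\mathcal{D}$ (and $1/S$ if $N_h(s,a)=0$). Set $\widehat V_{H+1}=0$; for $h=H,\dots,1$: $\Gamma_h(s,a)=\beta'_{\rm tbl}(N_h(s,a)+1)^{-1/2}$ with $\beta'_{\rm tbl}=C\,H\sqrt{S\log(SAHK/\delta)}$ ($C$ a universal constant), $\widehat Q_h=\Pi_{[0,H-h+1]}[\hat r_h+\widehat P_h\widehat V_{h+1}-2\Gamma_h]$, $\hat\pi_h(s)=\arg\max_a\widehat Q_h(s,a)$, $\widehat V_h(s)=\max_a\widehat Q_h(s,a)$. Return $\hat\pi=\{\hat\pi_h\}$.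
   Formalization: C_1, C_2 and the constants hidden in the query bound depend on a regularity constant c comparing dim_E(F,α) and log N(F,α) with dim(F)log(1/α); C_1 gets an extra factor log²(1/Δ); classes with dim(F) in {0,1}, where N degenerates to 0, are excluded. *)

theory Defs
  imports "HOL-Probability.Probability"
begin

section \<open>Tabular episodic MDPs\<close>

text \<open>
  Stages are \<open>1..horizon\<close>. The state and action spaces are explicit finite carriers, so that a
  constant quantified outside an MDP cannot depend on their sizes.
\<close>

record ('s, 'a) mdp =
  states :: "'s set"
  actions :: "'a set"
  horizon :: nat
  init_state :: 's
  trans :: "nat \<Rightarrow> 's \<times> 'a \<Rightarrow> 's pmf"
  rew :: "nat \<Rightarrow> 's \<times> 'a \<Rightarrow> real"

abbreviation sa_space :: "('s, 'a) mdp \<Rightarrow> ('s \<times> 'a) set" where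
  "sa_space M \<equiv> states M \<times> actions M"

definition mdp_wf :: "('s, 'a) mdp \<Rightarrow> bool" where
  "mdp_wf M \<longleftrightarrow>
     finite (states M) \<and> finite (actions M) \<and> actions M \<noteq> {} \<and>
     1 \<le> horizon M \<and> init_state M \<in> states M \<and>
     (\<forall>h\<in>{1..horizon M}. \<forall>z\<in>sa_space M.
        set_pmf (trans M h z) \<subseteq> states M \<and> rew M h z \<in> {0, 1})"

type_synonym ('s, 'a) policy = "nat \<Rightarrow> 's \<Rightarrow> 'a pmf"

definition policies :: "('s, 'a) mdp \<Rightarrow> ('s, 'a) policy set" where
  "policies M = {\<pi>. \<forall>h\<in>{1..horizon M}. \<forall>s\<in>states M. set_pmf (\<pi> h s) \<subseteq> actions M}"

definition det_policy :: "(nat \<Rightarrow> 's \<Rightarrow> 'a) \<Rightarrow> ('s, 'a) policy" where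
  "det_policy \<pi> = (\<lambda>h s. return_pmf (\<pi> h s))"

primrec trajectory ::
  "('s, 'a) mdp \<Rightarrow> ('s, 'a) policy \<Rightarrow> nat \<Rightarrow> nat \<Rightarrow> 's \<Rightarrow> ('s \<times> 'a) list pmf" where
  "trajectory M \<pi> 0 h s = return_pmf []"
| "trajectory M \<pi> (Suc n) h s =
     bind_pmf (\<pi> h s) (\<lambda>a. bind_pmf (trans M h (s, a)) (\<lambda>s'.
       map_pmf ((#) (s, a)) (trajectory M \<pi> n (Suc h) s')))"

text \<open>
  \<open>E[g\<^sub>h(s\<^sub>h,a\<^sub>h) + \<dots> + g\<^sub>H(s\<^sub>H,a\<^sub>H) | s\<^sub>h = s, \<pi>]\<close>; entry \<open>i\<close> of the
  trajectory list belongs to stage \<open>h + i\<close>.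
\<close>
definition expected_total ::
  "('s, 'a) mdp \<Rightarrow> ('s, 'a) policy \<Rightarrow> (nat \<Rightarrow> 's \<times> 'a \<Rightarrow> real) \<Rightarrow> nat \<Rightarrow> 's \<Rightarrow> real" where
  "expected_total M \<pi> g h s =
     measure_pmf.expectation (trajectory M \<pi> (Suc (horizon M) - h) h s)
       (\<lambda>\<tau>. \<Sum>i<length \<tau>. g (h + i) (\<tau> ! i))"

definition value_fn :: "('s, 'a) mdp \<Rightarrow> ('s, 'a) policy \<Rightarrow> nat \<Rightarrow> 's \<Rightarrow> real" where
  "value_fn M \<pi> = expected_total M \<pi> (rew M)"

definition opt_value :: "('s, 'a) mdp \<Rightarrow> nat \<Rightarrow> 's \<Rightarrow> real" where
  "opt_value M h s = (SUP \<pi>\<in>policies M. value_fn M \<pi> h s)"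

definition optimal_policy :: "('s, 'a) mdp \<Rightarrow> ('s, 'a) policy \<Rightarrow> bool" where
  "optimal_policy M \<pi> \<longleftrightarrow> \<pi> \<in> policies M \<and>
     value_fn M \<pi> 1 (init_state M) = opt_value M 1 (init_state M)"


section \<open>Offline data\<close>

text \<open>
  \<open>state D h k\<close> is \<open>s\<^sub>h\<^sup>k\<close>, for \<open>h \<in> {1..H+1}\<close>, and \<open>action D h k\<close> is \<open>a\<^sub>h\<^sup>k\<close>, for \<open>h \<in> {1..H}\<close>.
  A dataset takes finitely many values, so the law of the data collecting process is a
  probability mass function.
\<close>
record ('s, 'a) dataset =
  state :: "nat \<Rightarrow> nat \<Rightarrow> 's"
  action :: "nat \<Rightarrow> nat \<Rightarrow> 'a"

definition sa :: "('s, 'a) dataset \<Rightarrow> nat \<Rightarrow> nat \<Rightarrow> 's \<times> 'a" where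
  "sa D h k = (state D h k, action D h k)"

definition dataset_in :: "('s, 'a) mdp \<Rightarrow> nat \<Rightarrow> ('s, 'a) dataset \<Rightarrow> bool" where
  "dataset_in M K D \<longleftrightarrow> (\<forall>k\<in>{1..K}.
     (\<forall>h\<in>{1..horizon M + 1}. state D h k \<in> states M) \<and>
     (\<forall>h\<in>{1..horizon M}. action D h k \<in> actions M))"

text \<open>Conditioning on the histories \<open>{(s\<^sub>h\<^sup>j,a\<^sub>h\<^sup>j)}\<^sub>j\<^sub>\<le>\<^sub>k\<close>, \<open>{s\<^sub>h\<^sub>+\<^sub>1\<^sup>j}\<^sub>j\<^sub><\<^sub>k\<close> of positive probability.\<close>
definition compliant :: "('s, 'a) mdp \<Rightarrow> nat \<Rightarrow> ('s, 'a) dataset pmf \<Rightarrow> bool" where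
  "compliant M K p \<longleftrightarrow>
     (\<forall>h\<in>{1..horizon M}. \<forall>k\<in>{1..K}. \<forall>D\<^sub>0\<in>set_pmf p. \<forall>s\<in>states M.
        \<P>(D in measure_pmf p. state D (h + 1) k = s \<bar>
            (\<forall>j\<in>{1..k}. sa D h j = sa D\<^sub>0 h j) \<and>
            (\<forall>j\<in>{1..<k}. state D (h + 1) j = state D\<^sub>0 (h + 1) j))
        = pmf (trans M h (sa D\<^sub>0 h k)) s)"

definition visits :: "nat \<Rightarrow> ('s, 'a) dataset \<Rightarrow> nat \<Rightarrow> 's \<times> 'a \<Rightarrow> nat" where
  "visits K D h z = card {k\<in>{1..K}. sa D h k = z}"

definition emp_trans ::
  "('s, 'a) mdp \<Rightarrow> nat \<Rightarrow> ('s, 'a) dataset \<Rightarrow> nat \<Rightarrow> 's \<times> 'a \<Rightarrow> 's \<Rightarrow> real" where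
  "emp_trans M K D h z s' =
     (if visits K D h z = 0 then 1 / real (card (states M))
      else real (card {k\<in>{1..K}. sa D h k = z \<and> state D (h + 1) k = s'}) / real (visits K D h z))"


section \<open>Complexity of the function class\<close>

text \<open>Throughout, \<open>X\<close> is the common domain of the functions in \<open>F\<close>.\<close>

definition seq_norm :: "('z \<Rightarrow> real) \<Rightarrow> 'z list \<Rightarrow> real" where
  "seq_norm f zs = sqrt (\<Sum>z\<leftarrow>zs. (f z)\<^sup>2)"

definition sup_norm :: "'z set \<Rightarrow> ('z \<Rightarrow> real) \<Rightarrow> real" where
  "sup_norm X f = (SUP z\<in>X. \<bar>f z\<bar>)"

definition eps_dependent :: "('z \<Rightarrow> real) set \<Rightarrow> real \<Rightarrow> 'z \<Rightarrow> 'z list \<Rightarrow> bool" where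
  "eps_dependent F \<epsilon> z zs \<longleftrightarrow>
     (\<forall>f\<in>F. \<forall>f'\<in>F. seq_norm (\<lambda>x. f x - f' x) zs \<le> \<epsilon> \<longrightarrow> \<bar>f z - f' z\<bar> \<le> \<epsilon>)"

definition eluder_dim_at :: "'z set \<Rightarrow> ('z \<Rightarrow> real) set \<Rightarrow> real \<Rightarrow> enat" where
  "eluder_dim_at X F \<epsilon> =
     (SUP zs \<in> {zs. set zs \<subseteq> X \<and>
         (\<exists>\<epsilon>'\<ge>\<epsilon>. \<forall>i<length zs. \<not> eps_dependent F \<epsilon>' (zs ! i) (take i zs))}. enat (length zs))"

definition eluder_dim :: "'z set \<Rightarrow> ('z \<Rightarrow> real) set \<Rightarrow> ereal" where
  "eluder_dim X F =
     Limsup (at_right 0) (\<lambda>\<alpha>. ereal_of_enat (eluder_dim_at X F \<alpha>) / ereal (ln (1 / \<alpha>)))"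

definition sup_cover :: "'z set \<Rightarrow> ('z \<Rightarrow> real) set \<Rightarrow> real \<Rightarrow> ('z \<Rightarrow> real) set \<Rightarrow> bool" where
  "sup_cover X F \<epsilon> G \<longleftrightarrow>
     finite G \<and> G \<subseteq> F \<and> (\<forall>f\<in>F. \<exists>g\<in>G. sup_norm X (\<lambda>z. f z - g z) \<le> \<epsilon>)"

definition covering_number :: "'z set \<Rightarrow> ('z \<Rightarrow> real) set \<Rightarrow> real \<Rightarrow> nat" where
  "covering_number X F \<epsilon> = (LEAST n. \<exists>G. sup_cover X F \<epsilon> G \<and> card G = n)"

definition kolmogorov_dim :: "'z set \<Rightarrow> ('z \<Rightarrow> real) set \<Rightarrow> ereal" where
  "kolmogorov_dim X F =
     Limsup (at_right 0) (\<lambda>\<alpha>. ereal (ln (real (covering_number X F \<alpha>))) / ereal (ln (1 / \<alpha>)))"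

text \<open>Both dimensions are at most \<open>card X\<close> for a finite \<open>X\<close>, so \<open>real_of_ereal\<close> loses nothing.\<close>
definition class_dim :: "'z set \<Rightarrow> ('z \<Rightarrow> real) set \<Rightarrow> real" where
  "class_dim X F = real_of_ereal (max (eluder_dim X F) (kolmogorov_dim X F))"

text \<open>
  The limits superior say nothing about any fixed scale \<open>\<alpha>\<close>, whereas the number of
  queries is expressed through \<open>class_dim\<close> alone; how fast the limits are attained is recorded by
  a constant \<open>c\<close>. This is a parametrisation and not a restriction: lemma \<open>complexity_regular_exists\<close> shows
  that every class has such a \<open>c\<close>, unless its dimension is 0 or 1, where the prescribed number of
  queries is 0 because of its factor \<open>dim * log\<^sup>2 dim\<close>.
\<close>
definition complexity_regular :: "real \<Rightarrow> 'z set \<Rightarrow> ('z \<Rightarrow> real) set \<Rightarrow> bool" where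
  "complexity_regular c X F \<longleftrightarrow>
     1 / c \<le> class_dim X F \<and> 1 / c \<le> \<bar>ln (class_dim X F)\<bar> \<and>
     (\<forall>\<alpha>. 0 < \<alpha> \<and> \<alpha> \<le> 1 / 2 \<longrightarrow>
        ereal_of_enat (eluder_dim_at X F \<alpha>) \<le> ereal (c * class_dim X F * ln (1 / \<alpha>)) \<and>
        ln (real (covering_number X F \<alpha>)) \<le> c * class_dim X F * ln (1 / \<alpha>))"

lemma eluder_dim_at_le_card:
  assumes "finite X" "\<epsilon> > 0"
  shows "eluder_dim_at X F \<epsilon> \<le> enat (card X)"
  unfolding eluder_dim_at_def
proof (rule SUP_least)
  fix zs
  assume "zs \<in> {zs. set zs \<subseteq> X \<and>
    (\<exists>\<epsilon>'\<ge>\<epsilon>. \<forall>i<length zs. \<not> eps_dependent F \<epsilon>' (zs ! i) (take i zs))}"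
  then obtain \<epsilon>' where zs: "set zs \<subseteq> X" and "\<epsilon>' \<ge> \<epsilon>"
    and ind: "\<And>i. i < length zs \<Longrightarrow> \<not> eps_dependent F \<epsilon>' (zs ! i) (take i zs)"
    by auto
  have "zs ! i \<noteq> zs ! j" if "i < j" "j < length zs" for i j
  proof
    assume eq: "zs ! i = zs ! j"
    from ind[OF that(2)] obtain f f' where
      le: "seq_norm (\<lambda>x. f x - f' x) (take j zs) \<le> \<epsilon>'" and gt: "\<bar>f (zs ! j) - f' (zs ! j)\<bar> > \<epsilon>'"
      unfolding eps_dependent_def by force
    have "zs ! i \<in> set (take j zs)"
      using that by (auto simp: in_set_conv_nth intro!: exI[of _ i])
    then have "(f (zs ! i) - f' (zs ! i))\<^sup>2 \<le> (\<Sum>z\<leftarrow>take j zs. (f z - f' z)\<^sup>2)"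
      by (intro member_le_sum_list) auto
    then have "sqrt ((f (zs ! i) - f' (zs ! i))\<^sup>2) \<le> seq_norm (\<lambda>x. f x - f' x) (take j zs)"
      unfolding seq_norm_def by (rule real_sqrt_le_mono)
    with eq gt le show False by simp
  qed
  then have "distinct zs"
    by (metis distinct_conv_nth nat_neq_iff)
  then have "length zs = card (set zs)"
    by (simp add: distinct_card)
  also have "\<dots> \<le> card X"
    using zs assms(1) by (intro card_mono)
  finally show "enat (length zs) \<le> enat (card X)" by simp
qed

lemma ln_covering_number_le:
  assumes "finite X" "X \<noteq> {}" "F \<noteq> {}" "F \<subseteq> X \<rightarrow> {0..1}" "0 < \<alpha>" "\<alpha> \<le> 1 / 2"
  shows "ln (real (covering_number X F \<alpha>)) \<le> 2 * real (card X) * ln (1 / \<alpha>)"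
proof -
  define m where "m = nat \<lfloor>1 / \<alpha>\<rfloor>"
  define cell where "cell = (\<lambda>f :: 'a \<Rightarrow> real. \<lambda>z\<in>X. nat \<lfloor>f z / \<alpha>\<rfloor>)"
  define rep where "rep = (\<lambda>u. SOME f. f \<in> F \<and> cell f = u)"
  define G where "G = rep ` cell ` F"
  have rep: "rep (cell f) \<in> F \<and> cell (rep (cell f)) = cell f" if "f \<in> F" for f
    unfolding rep_def by (rule someI[of _ f]) (simp add: that)
  have sub: "cell ` F \<subseteq> X \<rightarrow>\<^sub>E {..m}"
  proof
    fix u assume "u \<in> cell ` F"
    then obtain f where f: "f \<in> F" "u = cell f" by auto
    have "nat \<lfloor>f z / \<alpha>\<rfloor> \<le> m" if "z \<in> X" for z
    proof -
      have "f \<in> X \<rightarrow> {0..1}" using f(1) assms(4) by (rule subsetD[rotated])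
      then have "f z \<in> {0..1}" using that by (rule Pi_mem)
      then have "f z \<le> 1" by simp
      then have "f z / \<alpha> \<le> 1 / \<alpha>" using assms(5) by (intro divide_right_mono) auto
      then show ?thesis unfolding m_def by (intro nat_mono floor_mono)
    qed
    then show "u \<in> X \<rightarrow>\<^sub>E {..m}" 
      unfolding f(2) cell_def by (intro restrict_PiE_iff[THEN iffD2]) simp
  qed
  have finE: "finite (X \<rightarrow>\<^sub>E {..m})" using assms(1) by (intro finite_PiE) auto
  have fin: "finite (cell ` F)" using finite_subset[OF sub finE] .
  have "card G \<le> card (cell ` F)" unfolding G_def using fin by (rule card_image_le)
  also have "\<dots> \<le> card (X \<rightarrow>\<^sub>E {..m})" using sub finE by (intro card_mono)
  also have "\<dots> = Suc m ^ card X" using assms(1) by (simp add: card_PiE)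
  finally have cG: "card G \<le> Suc m ^ card X" .
  have close: "\<bar>f z - g z\<bar> \<le> \<alpha>" if "f \<in> F" "g \<in> F" "cell f = cell g" "z \<in> X" for f g z
  proof -
    have "nat \<lfloor>f z / \<alpha>\<rfloor> = nat \<lfloor>g z / \<alpha>\<rfloor>"
      using fun_cong[OF that(3), of z] that(4) by (simp add: cell_def)
    moreover have "f \<in> X \<rightarrow> {0..1}" "g \<in> X \<rightarrow> {0..1}"
      using that(1,2) assms(4) by blast+
    then have "f z \<in> {0..1}" "g z \<in> {0..1}" using that(4) by blast+
    then have "0 \<le> f z / \<alpha>" "0 \<le> g z / \<alpha>" using assms(5) by simp_all
    then have "\<lfloor>f z / \<alpha>\<rfloor> \<ge> 0" "\<lfloor>g z / \<alpha>\<rfloor> \<ge> 0" by simp_all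
    ultimately have "\<lfloor>f z / \<alpha>\<rfloor> = \<lfloor>g z / \<alpha>\<rfloor>" by linarith
    then have "\<bar>f z / \<alpha> - g z / \<alpha>\<bar> \<le> 1" by linarith
    then have "\<bar>(f z - g z) / \<alpha>\<bar> \<le> 1" by (simp add: diff_divide_distrib)
    then show ?thesis using assms(5) by (simp add: abs_divide)
  qed
  have "sup_cover X F \<alpha> G"
    unfolding sup_cover_def
  proof (intro conjI ballI)
    show "finite G" unfolding G_def using fin by simp
    show "G \<subseteq> F" unfolding G_def using rep by auto
    fix f assume f: "f \<in> F"
    show "\<exists>g\<in>G. sup_norm X (\<lambda>z. f z - g z) \<le> \<alpha>"
    proof (rule bexI[of _ "rep (cell f)"])
      show "sup_norm X (\<lambda>z. f z - rep (cell f) z) \<le> \<alpha>"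
        unfolding sup_norm_def using assms(2) close[OF f] rep[OF f] by (intro cSUP_least) auto
      show "rep (cell f) \<in> G" unfolding G_def using f by auto
    qed
  qed
  then have ex: "\<exists>G'. sup_cover X F \<alpha> G' \<and> card G' = card G" by blast
  then have le: "covering_number X F \<alpha> \<le> card G"
    unfolding covering_number_def by (rule Least_le)
  have "\<exists>G'. sup_cover X F \<alpha> G' \<and> card G' = covering_number X F \<alpha>"
    unfolding covering_number_def
    by (rule LeastI[of "\<lambda>n. \<exists>G. sup_cover X F \<alpha> G \<and> card G = n", OF ex])
  then obtain G' where G': "sup_cover X F \<alpha> G'" "card G' = covering_number X F \<alpha>"
    by blast
  from G'(1) assms(3) have "finite G'" "G' \<noteq> {}"
    unfolding sup_cover_def by blast+
  then have "card G' > 0" by (simp add: card_gt_0_iff)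
  with G'(2) have pos: "covering_number X F \<alpha> > 0" by simp
  have inv: "1 / \<alpha> \<ge> 2" using assms(5,6) by (simp add: field_simps)
  have "real m \<le> 1 / \<alpha>" unfolding m_def using inv by linarith
  then have "real (Suc m) \<le> 1 / \<alpha> + 1" by simp
  also have "\<dots> \<le> 2 * (1 / \<alpha>)" using inv by simp
  also have "\<dots> \<le> (1 / \<alpha>) * (1 / \<alpha>)" using inv assms(5) by (intro mult_right_mono) auto
  finally have "real (Suc m) \<le> (1 / \<alpha>)\<^sup>2" by (simp add: power2_eq_square)
  then have "ln (real (Suc m)) \<le> ln ((1 / \<alpha>)\<^sup>2)" using assms(5) by (subst ln_le_cancel_iff) auto
  also have "\<dots> = 2 * ln (1 / \<alpha>)" using assms(5) by (subst ln_realpow) auto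
  finally have lnm: "ln (real (Suc m)) \<le> 2 * ln (1 / \<alpha>)" .
  have "covering_number X F \<alpha> \<le> Suc m ^ card X" using le cG by linarith
  then have "real (covering_number X F \<alpha>) \<le> real (Suc m ^ card X)"
    by (simp only: of_nat_le_iff)
  then have "real (covering_number X F \<alpha>) \<le> real (Suc m) ^ card X"
    by (simp only: of_nat_power)
  then have "ln (real (covering_number X F \<alpha>)) \<le> ln (real (Suc m) ^ card X)"
    using pos by (subst ln_le_cancel_iff) auto
  also have "\<dots> = real (card X) * ln (real (Suc m))" by (subst ln_realpow) auto
  also have "\<dots> \<le> real (card X) * (2 * ln (1 / \<alpha>))" using lnm by (intro mult_left_mono) auto
  finally show ?thesis by (simp add: mult_ac)
qed

lemma class_dim_nonneg: "class_dim X F \<ge> 0"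
proof -
  have "eventually (\<lambda>\<alpha>::real. 0 < \<alpha> \<and> \<alpha> < 1) (at_right 0)"
    unfolding eventually_at_right_field by (intro exI[of _ 1]) auto
  then have "eventually (\<lambda>\<alpha>. 0 \<le> ereal_of_enat (eluder_dim_at X F \<alpha>) / ereal (ln (1 / \<alpha>)))
      (at_right 0)"
  proof eventually_elim
    case (elim \<alpha>)
    then have "0 \<le> ereal (inverse (ln (1 / \<alpha>)))" by simp
    then show ?case
      using elim unfolding divide_ereal_def
      by (intro ereal_0_le_mult) (auto simp: ereal_of_enat_nonneg)
  qed
  then have "0 \<le> Liminf (at_right 0) (\<lambda>\<alpha>. ereal_of_enat (eluder_dim_at X F \<alpha>) / ereal (ln (1 / \<alpha>)))"
    by (intro Liminf_bounded)
  also have "\<dots> \<le> eluder_dim X F"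
    unfolding eluder_dim_def by (intro Liminf_le_Limsup) simp
  finally show ?thesis
    unfolding class_dim_def by (intro real_of_ereal_pos) (simp add: le_max_iff_disj)
qed

lemma complexity_regular_exists:
  assumes "finite X" "X \<noteq> {}" "F \<noteq> {}" "F \<subseteq> X \<rightarrow> {0..1}"
    and "class_dim X F \<noteq> 0" "class_dim X F \<noteq> 1"
  shows "\<exists>c>0. complexity_regular c X F"
proof -
  define d where "d = class_dim X F"
  define n where "n = real (card X)"
  define c where "c = 1 / d + 1 / \<bar>ln d\<bar> + n / (d * ln 2) + 2 * n / d"
  have d: "d > 0" "d \<noteq> 1" using class_dim_nonneg[of X F] assms(5,6) by (auto simp: d_def)
  have n: "n \<ge> 0" by (simp add: n_def)
  have lnd: "\<bar>ln d\<bar> > 0" using d by simp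
  have parts: "1 / d > 0" "1 / \<bar>ln d\<bar> > 0" "n / (d * ln 2) \<ge> 0" "2 * n / d \<ge> 0"
    using d lnd n by auto
  have c: "c > 0" "1 / d \<le> c" "1 / \<bar>ln d\<bar> \<le> c" "n / (d * ln 2) \<le> c" "2 * n / d \<le> c"
    using parts unfolding c_def by linarith+
  have "1 / c \<le> d" "1 / c \<le> \<bar>ln d\<bar>"
    using c(1,2,3) d lnd by (simp_all add: field_simps)
  moreover have "ereal_of_enat (eluder_dim_at X F \<alpha>) \<le> ereal (c * d * ln (1 / \<alpha>)) \<and>
      ln (real (covering_number X F \<alpha>)) \<le> c * d * ln (1 / \<alpha>)"
    if \<alpha>: "0 < \<alpha>" "\<alpha> \<le> 1 / 2" for \<alpha>
  proof
    have "2 \<le> 1 / \<alpha>" using \<alpha> by (simp add: field_simps)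
    then have ln2: "ln 2 \<le> ln (1 / \<alpha>)" using \<alpha> by (subst ln_le_cancel_iff) auto
    have ln2_pos: "ln (2::real) > 0" by simp
    have "n \<le> c * d * ln 2" using c(4) d by (simp add: field_simps)
    also have "\<dots> \<le> c * d * ln (1 / \<alpha>)" using ln2 c(1) d by (intro mult_left_mono) auto
    finally have "ereal n \<le> ereal (c * d * ln (1 / \<alpha>))" by simp
    moreover have "ereal_of_enat (eluder_dim_at X F \<alpha>) \<le> ereal n"
      using eluder_dim_at_le_card[OF assms(1) \<alpha>(1), of F]
      by (metis ereal_of_enat_le_iff ereal_of_enat_simps(1) n_def)
    ultimately show "ereal_of_enat (eluder_dim_at X F \<alpha>) \<le> ereal (c * d * ln (1 / \<alpha>))"
      by (rule order_trans[rotated])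
    have "2 * n \<le> c * d" using c(5) d by (simp add: field_simps)
    then have "2 * n * ln (1 / \<alpha>) \<le> c * d * ln (1 / \<alpha>)"
      using ln2 ln2_pos by (intro mult_right_mono) linarith+
    with ln_covering_number_le[OF assms(1-4) \<alpha>]
    show "ln (real (covering_number X F \<alpha>)) \<le> c * d * ln (1 / \<alpha>)"
      unfolding n_def by linarith
  qed
  ultimately show ?thesis
    unfolding complexity_regular_def using c(1) by (auto simp: d_def)
qed


section \<open>Active reward learning from human feedback\<close>

definition human_feedback ::
  "('s, 'a) mdp \<Rightarrow> ('s \<times> 'a \<Rightarrow> real) set \<Rightarrow> real \<Rightarrow> (nat \<Rightarrow> 's \<times> 'a \<Rightarrow> real) \<Rightarrow> bool" where
  "human_feedback M F \<Delta> f \<longleftrightarrow>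
     0 < \<Delta> \<and> F \<subseteq> sa_space M \<rightarrow> {0..1} \<and>
     (\<forall>h\<in>{1..horizon M}. f h \<in> F \<and>
        (\<forall>z\<in>sa_space M. \<bar>f h z - 1 / 2\<bar> > \<Delta> \<and> rew M h z = of_bool (f h z > 1 / 2)))"

text \<open>
  With \<open>C\<^sub>1\<close> independent of \<open>\<Delta>\<close>, too few queries are made as \<open>\<Delta>\<close> tends to 0: \<open>\<beta>\<^sup>2\<close> grows like \<open>ln (1/\<Delta>)\<close>,
  and an element of the pool on which \<open>F\<close> takes only the two values \<open>1/2 \<plusminus> d\<close>, \<open>d > \<Delta>\<close>, is not queried as long
  as another one has width above \<open>2 d\<close>. Hence \<open>C\<^sub>1\<close> is meant to be supplied with a polylogarithmic
  factor in \<open>1/\<Delta>\<close>, which the final bound on the number of queries suppresses anyway.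
\<close>
definition num_queries :: "real \<Rightarrow> real \<Rightarrow> real \<Rightarrow> real \<Rightarrow> nat" where
  "num_queries C\<^sub>1 d \<Delta> \<delta> = nat \<lceil>C\<^sub>1 * ((d\<^sup>2 + d * ln (1 / \<delta>)) * (ln d)\<^sup>2) / \<Delta>\<^sup>2\<rceil>"

definition conf_radius :: "real \<Rightarrow> real \<Rightarrow> real \<Rightarrow> nat \<Rightarrow> real" where
  "conf_radius C\<^sub>2 d \<delta> N = C\<^sub>2 * sqrt (ln (1 / \<delta>) + ln (real N) * d)"

definition width :: "('z \<Rightarrow> real) set \<Rightarrow> real \<Rightarrow> 'z list \<Rightarrow> 'z \<Rightarrow> real" where
  "width F \<beta> zs z =
     (SUP (f, f') \<in> {(f, f'). f \<in> F \<and> f' \<in> F \<and> seq_norm (\<lambda>x. f x - f' x) zs \<le> \<beta>}. \<bar>f z - f' z\<bar>)"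

text \<open>\<open>zs\<close> is a possible query sequence of the algorithm on the pool \<open>Z\<close>, ties broken arbitrarily.\<close>
definition active_queries ::
  "'z set \<Rightarrow> ('z \<Rightarrow> real) set \<Rightarrow> real \<Rightarrow> real \<Rightarrow> real \<Rightarrow> real \<Rightarrow> 'z set \<Rightarrow> 'z list \<Rightarrow> bool" where
  "active_queries X F C\<^sub>1 C\<^sub>2 \<Delta> \<delta> Z zs \<longleftrightarrow>
     (let d = class_dim X F; N = num_queries C\<^sub>1 d \<Delta> \<delta>; \<beta> = conf_radius C\<^sub>2 d \<delta> N in
       length zs = N \<and>
       (\<forall>k<N. is_arg_max (width F \<beta> (take k zs)) (\<lambda>z. z \<in> Z) (zs ! k)))"

text \<open>
  \<open>l i\<close> is the response to the \<open>i\<close>-th query, counted from 0, and \<open>G\<close> is the cover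
  \<open>C(F, \<Delta>/2)\<close>.
\<close>
definition learned_reward ::
  "'z set \<Rightarrow> ('z \<Rightarrow> real) set \<Rightarrow> ('z \<Rightarrow> real) set \<Rightarrow> real \<Rightarrow> 'z list \<Rightarrow> (nat \<Rightarrow> bool) \<Rightarrow>
     ('z \<Rightarrow> real) \<Rightarrow> bool" where
  "learned_reward X F G \<Delta> zs l r \<longleftrightarrow>
     (\<exists>ft fh.
        is_arg_min (\<lambda>f. \<Sum>i<length zs. (f (zs ! i) - of_bool (l i))\<^sup>2) (\<lambda>f. f \<in> F) ft \<and>
        fh \<in> G \<and> sup_norm X (\<lambda>z. fh z - ft z) \<le> \<Delta> / 2 \<and>
        r = (\<lambda>z. of_bool (fh z > 1 / 2)))"

text \<open>
  Joint law of the dataset and of the responses: given the dataset \<open>D\<close>, the response to the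
  \<open>i\<close>-th query \<open>zs D h ! i\<close> of stage \<open>h\<close> is \<open>True\<close> with probability \<open>f h (zs D h ! i)\<close>, independently
  over all \<open>h\<close> and \<open>i\<close>.
\<close>
definition feedback_law ::
  "('s, 'a) mdp \<Rightarrow> (nat \<Rightarrow> 's \<times> 'a \<Rightarrow> real) \<Rightarrow> ('s, 'a) dataset pmf \<Rightarrow>
     (('s, 'a) dataset \<Rightarrow> nat \<Rightarrow> ('s \<times> 'a) list) \<Rightarrow>
     (('s, 'a) dataset \<times> (nat \<times> nat \<Rightarrow> bool)) pmf" where
  "feedback_law M f p zs =
     bind_pmf p (\<lambda>D. map_pmf (Pair D)
       (Pi_pmf (SIGMA h:{1..horizon M}. {..<length (zs D h)}) False
          (\<lambda>(h, i). bernoulli_pmf (f h (zs D h ! i)))))"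


section \<open>Offline planning\<close>

definition log_factor :: "('s, 'a) mdp \<Rightarrow> nat \<Rightarrow> real \<Rightarrow> real" where
  "log_factor M K \<delta> =
     ln (real (card (states M)) * real (card (actions M)) * real (horizon M) * real K / \<delta>)"

definition bonus ::
  "('s, 'a) mdp \<Rightarrow> real \<Rightarrow> nat \<Rightarrow> real \<Rightarrow> ('s, 'a) dataset \<Rightarrow> nat \<Rightarrow> 's \<times> 'a \<Rightarrow> real" where
  "bonus M C K \<delta> D h z =
     C * real (horizon M) * sqrt (real (card (states M)) * log_factor M K \<delta>) / sqrt (real (visits K D h z) + 1)"

definition trunc :: "real \<Rightarrow> real \<Rightarrow> real \<Rightarrow> real" where
  "trunc a b x = max a (min b x)"

definition q_backup ::
  "('s, 'a) mdp \<Rightarrow> real \<Rightarrow> nat \<Rightarrow> real \<Rightarrow> ('s, 'a) dataset \<Rightarrow> (nat \<Rightarrow> 's \<times> 'a \<Rightarrow> real) \<Rightarrow>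
     nat \<Rightarrow> ('s \<Rightarrow> real) \<Rightarrow> 's \<times> 'a \<Rightarrow> real" where
  "q_backup M C K \<delta> D r h V z =
     trunc 0 (real (horizon M) - real h + 1)
       (r h z + (\<Sum>s'\<in>states M. emp_trans M K D h z s' * V s') - 2 * bonus M C K \<delta> D h z)"

text \<open>\<open>v_rem \<dots> n\<close> is the estimated value with \<open>n\<close> stages to go, i.e. at stage \<open>H + 1 - n\<close>.\<close>
primrec v_rem ::
  "('s, 'a) mdp \<Rightarrow> real \<Rightarrow> nat \<Rightarrow> real \<Rightarrow> ('s, 'a) dataset \<Rightarrow> (nat \<Rightarrow> 's \<times> 'a \<Rightarrow> real) \<Rightarrow>
     nat \<Rightarrow> 's \<Rightarrow> real" where
  "v_rem M C K \<delta> D r 0 = (\<lambda>s. 0)"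
| "v_rem M C K \<delta> D r (Suc n) =
     (\<lambda>s. MAX a\<in>actions M. q_backup M C K \<delta> D r (horizon M - n) (v_rem M C K \<delta> D r n) (s, a))"

definition q_hat ::
  "('s, 'a) mdp \<Rightarrow> real \<Rightarrow> nat \<Rightarrow> real \<Rightarrow> ('s, 'a) dataset \<Rightarrow> (nat \<Rightarrow> 's \<times> 'a \<Rightarrow> real) \<Rightarrow>
     nat \<Rightarrow> 's \<times> 'a \<Rightarrow> real" where
  "q_hat M C K \<delta> D r h = q_backup M C K \<delta> D r h (v_rem M C K \<delta> D r (horizon M - h))"

text \<open>
  \<open>\<pi>\<close> is a possible output on the dataset \<open>D\<close> with responses \<open>l\<close>, whatever the choices of
  minimisers and maximisers.
\<close>
definition lcbvi_output ::
  "('s, 'a) mdp \<Rightarrow> ('s \<times> 'a \<Rightarrow> real) set \<Rightarrow> ('s \<times> 'a \<Rightarrow> real) set \<Rightarrow> real \<Rightarrow> real \<Rightarrow> nat \<Rightarrow> real \<Rightarrow>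
     ('s, 'a) dataset \<Rightarrow> (nat \<Rightarrow> ('s \<times> 'a) list) \<Rightarrow> (nat \<times> nat \<Rightarrow> bool) \<Rightarrow>
     (nat \<Rightarrow> 's \<Rightarrow> 'a) \<Rightarrow> bool" where
  "lcbvi_output M F G C \<Delta> K \<delta> D zs l \<pi> \<longleftrightarrow>
     (\<exists>r.
        (\<forall>h\<in>{1..horizon M}. learned_reward (sa_space M) F G \<Delta> (zs h) (\<lambda>i. l (h, i)) (r h)) \<and>
        (\<forall>h\<in>{1..horizon M}. \<forall>s\<in>states M.
           is_arg_max (\<lambda>a. q_hat M C K \<delta> D r h (s, a)) (\<lambda>a. a \<in> actions M) (\<pi> h s)))"

end

theory Submission
  imports Defs
begin

text \<open>
  Labels are queried after all query points are fixed, so least squares over \<open>F\<close> is a fixed-design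
  regression and a cover of \<open>F\<close> at scale \<open>1/N\<close> gives the confidence radius \<open>\<beta>\<close>. Greedy queries
  of total number above \<open>(\<beta>\<^sup>2/\<epsilon>\<^sup>2 + 1)\<close> times the eluder dimension at scale \<open>\<epsilon> = \<Delta>/2\<close> force all widths on
  the pool below \<open>\<Delta>/2\<close>, and by the margin the learned reward is then exact on every visited pair.

  For each stage, pair, visit count and set \<open>U\<close> of next states, the number of transitions into \<open>U\<close> is
  controlled by the exponential supermartingale of Hoeffding's lemma along the histories of
  the compliance condition. The union over all \<open>U\<close> bounds the total variation distance, so the bound
  holds for any value estimate, however it depends on the data. With \<open>C = 1/2\<close> the penalty \<open>2 \<Gamma>\<close>
  equals this deviation bound; pessimism then costs at most \<open>4 \<Gamma>\<close> per stage along \<open>\<pi>\<^sup>*\<close>. A pair without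
  visits, whose reward may be wrong, has a penalty so large that its estimate is truncated to 0; this fails only if
  \<open>S log(SAHK/\<delta>) < 1\<close>, where either every pair is visited or the bound is trivial.
\<close>


section \<open>Value recursion and pessimism\<close>

text \<open>Two obstacles shape the proof. The regret bound carries an explicit factor 2, so the
  transition error after n visits must fit below H sqrt(S L) / sqrt(n + 1) with constant one, where
  L = ln(SAHK/\<delta>). The union over subsets of states adds (S + 1) ln 2 to L, which leaves
  little slack; it is absorbed because next-stage values span only H - 1, because Hoeffding's bound
  has 2n in the denominator where n + 1 is wanted, and because L itself is at least ln(S H). Visit
  counts are random, so every count from 1 to K is an event of its own; the factor K inside L pays
  for that.

  The other obstacle is circular: the number N of queries must exceed a multiple of \<beta>^2, and
  \<beta>^2 contains ln N. The factor ln(1/\<Delta>)^2 supplied with \<open>C\<^sub>1\<close>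
  resolves it: one logarithm pays for the eluder dimension at scale \<Delta>/2, the other for the
  growth of ln N.\<close>

lemma expectation_bind_pmf_finite:
  fixes g :: "'b \<Rightarrow> real"
  assumes "finite (set_pmf p)" "\<And>x. x \<in> set_pmf p \<Longrightarrow> finite (set_pmf (f x))"
  shows "measure_pmf.expectation (bind_pmf p f) g =
    measure_pmf.expectation p (\<lambda>x. measure_pmf.expectation (f x) g)"
  using assms
  by (subst pmf_expectation_bind[of "set_pmf p"]) (auto simp: integral_measure_pmf[of "set_pmf p"])

lemma expectation_mono_finite:
  fixes f g :: "'b \<Rightarrow> real"
  assumes "finite (set_pmf p)" "\<And>x. x \<in> set_pmf p \<Longrightarrow> f x \<le> g x"
  shows "measure_pmf.expectation p f \<le> measure_pmf.expectation p g"
  using assms by (intro integral_mono_AE integrable_measure_pmf_finite) (auto simp: AE_measure_pmf_iff)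

lemma expectation_cong_pmf:
  fixes f g :: "'b \<Rightarrow> real"
  assumes "\<And>x. x \<in> set_pmf p \<Longrightarrow> f x = g x"
  shows "measure_pmf.expectation p f = measure_pmf.expectation p g"
  using assms by (intro integral_cong_AE) (auto simp: AE_measure_pmf_iff)

lemma expectation_le_const:
  fixes f :: "'b \<Rightarrow> real"
  assumes "finite (set_pmf p)" "\<And>x. x \<in> set_pmf p \<Longrightarrow> f x \<le> c"
  shows "measure_pmf.expectation p f \<le> c"
  using expectation_mono_finite[of p f "\<lambda>_. c"] assms by simp

lemma expectation_ge_const:
  fixes f :: "'b \<Rightarrow> real"
  assumes "finite (set_pmf p)" "\<And>x. x \<in> set_pmf p \<Longrightarrow> c \<le> f x"
  shows "c \<le> measure_pmf.expectation p f"
  using expectation_mono_finite[of p "\<lambda>_. c" f] assms by simp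

lemma expectation_add_finite:
  fixes f g :: "'b \<Rightarrow> real"
  assumes "finite (set_pmf p)"
  shows "measure_pmf.expectation p (\<lambda>x. f x + g x) =
    measure_pmf.expectation p f + measure_pmf.expectation p g"
  using assms by (intro Bochner_Integration.integral_add integrable_measure_pmf_finite)

lemma trans_support:
  assumes "mdp_wf M" "h \<in> {1..horizon M}" "z \<in> sa_space M"
  shows "set_pmf (trans M h z) \<subseteq> states M" "finite (set_pmf (trans M h z))"
proof -
  show "set_pmf (trans M h z) \<subseteq> states M"
    using assms unfolding mdp_wf_def by blast
  then show "finite (set_pmf (trans M h z))"
    using assms(1) unfolding mdp_wf_def by (blast intro: finite_subset)
qed

lemma policy_support:
  assumes "mdp_wf M" "\<pi> \<in> policies M" "h \<in> {1..horizon M}" "s \<in> states M"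
  shows "set_pmf (\<pi> h s) \<subseteq> actions M" "finite (set_pmf (\<pi> h s))"
proof -
  show "set_pmf (\<pi> h s) \<subseteq> actions M"
    using assms(2-) unfolding policies_def by blast
  then show "finite (set_pmf (\<pi> h s))"
    using assms(1) unfolding mdp_wf_def by (blast intro: finite_subset)
qed

lemma finite_trajectory:
  assumes "mdp_wf M" "\<pi> \<in> policies M"
  shows "1 \<le> h \<Longrightarrow> h + n \<le> Suc (horizon M) \<Longrightarrow> s \<in> states M \<Longrightarrow>
    finite (set_pmf (trajectory M \<pi> n h s))"
proof (induction n arbitrary: h s)
  case (Suc n)
  have h: "h \<in> {1..horizon M}" using Suc.prems by auto
  note p = policy_support[OF assms h Suc.prems(3)]
  have t: "set_pmf (trans M h (s, a)) \<subseteq> states M" "finite (set_pmf (trans M h (s, a)))"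
    if "a \<in> set_pmf (\<pi> h s)" for a
    using trans_support[OF assms(1) h, of "(s, a)"] p(1) that Suc.prems(3) by auto
  have "finite (set_pmf (trajectory M \<pi> n (Suc h) s'))" if "s' \<in> states M" for s'
    using Suc.IH[of "Suc h" s'] Suc.prems that by auto
  then show ?case using p t by (auto simp: subset_iff)
qed simp

section \<open>Bellman recursion for totals along a trajectory\<close>

lemma expected_total_beyond: "expected_total M \<pi> g (Suc (horizon M)) s = 0"
  by (simp add: expected_total_def)

text \<open>Bellman equation: the sum over a trajectory splits into its head and the sum over its
  tail with the stage shifted by one. Keeping \<open>g\<close> general lets the same recursion serve
  both the values and the penalties accumulated along a policy.\<close>

lemma expected_total_step:
  assumes "mdp_wf M" "\<pi> \<in> policies M" and h: "h \<in> {1..horizon M}" and s: "s \<in> states M"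
  shows "expected_total M \<pi> g h s = measure_pmf.expectation (\<pi> h s) (\<lambda>a. g h (s, a) +
    measure_pmf.expectation (trans M h (s, a)) (expected_total M \<pi> g (Suc h)))"
proof -
  define n where "n = horizon M - h"
  have n: "Suc (horizon M) - h = Suc n" "Suc (horizon M) - Suc h = n" using h by (auto simp: n_def)
  define T where "T = trajectory M \<pi> n (Suc h)"
  define G where "G = (\<lambda>\<tau>. \<Sum>i<length \<tau>. g (h + i) (\<tau> ! i))"
  define G' where "G' = (\<lambda>\<tau>. \<Sum>i<length \<tau>. g (Suc h + i) (\<tau> ! i))"
  note p = policy_support[OF assms(1,2) h s]
  have t: "set_pmf (trans M h (s, a)) \<subseteq> states M" "finite (set_pmf (trans M h (s, a)))"
    if "a \<in> set_pmf (\<pi> h s)" for a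
    using trans_support[OF assms(1) h, of "(s, a)"] p(1) that s by auto
  have T: "finite (set_pmf (T s'))" if "s' \<in> states M" for s'
    unfolding T_def using finite_trajectory[OF assms(1,2), of "Suc h" n s'] h that by (auto simp: n_def)
  have G: "G (z # \<tau>) = g h z + G' \<tau>" for z \<tau>
    unfolding G_def G'_def by (simp add: sum.lessThan_Suc_shift del: sum.lessThan_Suc)
  have et: "expected_total M \<pi> g (Suc h) s' = measure_pmf.expectation (T s') G'" for s'
    by (simp only: expected_total_def n T_def G'_def)
  have "expected_total M \<pi> g h s = measure_pmf.expectation
      (bind_pmf (\<pi> h s) (\<lambda>a. bind_pmf (trans M h (s, a)) (\<lambda>s'. map_pmf ((#) (s, a)) (T s')))) G"
    by (simp only: expected_total_def n T_def G_def trajectory.simps)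
  also have "\<dots> = measure_pmf.expectation (\<pi> h s) (\<lambda>a. measure_pmf.expectation
      (bind_pmf (trans M h (s, a)) (\<lambda>s'. map_pmf ((#) (s, a)) (T s'))) G)"
    using p t T by (intro expectation_bind_pmf_finite) (auto simp: subset_iff)
  also have "\<dots> = measure_pmf.expectation (\<pi> h s) (\<lambda>a. g h (s, a) +
    measure_pmf.expectation (trans M h (s, a)) (expected_total M \<pi> g (Suc h)))"
  proof (rule expectation_cong_pmf)
    fix a assume a: "a \<in> set_pmf (\<pi> h s)"
    have "measure_pmf.expectation (bind_pmf (trans M h (s, a)) (\<lambda>s'. map_pmf ((#) (s, a)) (T s'))) G
      = measure_pmf.expectation (trans M h (s, a)) (\<lambda>s'. measure_pmf.expectation (map_pmf ((#) (s, a)) (T s')) G)"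
      using t[OF a] T by (intro expectation_bind_pmf_finite) (auto simp: subset_iff)
    also have "\<dots> = measure_pmf.expectation (trans M h (s, a)) (\<lambda>s'. g h (s, a) + expected_total M \<pi> g (Suc h) s')"
    proof (rule expectation_cong_pmf)
      fix s' assume "s' \<in> set_pmf (trans M h (s, a))"
      then have "finite (set_pmf (T s'))" using t(1)[OF a] T by auto
      then show "measure_pmf.expectation (map_pmf ((#) (s, a)) (T s')) G
        = g h (s, a) + expected_total M \<pi> g (Suc h) s'"
        by (simp add: G et expectation_add_finite)
    qed
    also have "\<dots> = g h (s, a) + measure_pmf.expectation (trans M h (s, a)) (expected_total M \<pi> g (Suc h))"
      using t(2)[OF a] by (simp add: expectation_add_finite)
    finally show "measure_pmf.expectation (bind_pmf (trans M h (s, a)) (\<lambda>s'. map_pmf ((#) (s, a)) (T s'))) G = \<dots>" .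
  qed
  finally show ?thesis .
qed

text \<open>Backward induction over the stages, packaged so that the state can be generalised; the
  base case is the fictitious stage after the last one, where all totals vanish.\<close>

lemma stage_induct [consumes 1, case_names beyond step]:
  fixes H h :: nat
  assumes "h \<in> {1..Suc H}"
    and "P (Suc H)" and "\<And>h. h \<in> {1..H} \<Longrightarrow> P (Suc h) \<Longrightarrow> P h"
  shows "P h"
proof -
  have "h \<le> Suc H" "1 \<le> h" using assms(1) by auto
  then show ?thesis
    by (induction rule: inc_induct) (use assms(2,3) in auto)
qed

lemma expected_total_mono:
  assumes "mdp_wf M" "\<pi> \<in> policies M" "h \<in> {1..Suc (horizon M)}" "s \<in> states M"
    and "\<And>h z. h \<in> {1..horizon M} \<Longrightarrow> z \<in> sa_space M \<Longrightarrow> g h z \<le> g' h z"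
  shows "expected_total M \<pi> g h s \<le> expected_total M \<pi> g' h s"
  using assms(3,4)
proof (induction arbitrary: s rule: stage_induct)
  case (step h)
  note p = policy_support[OF assms(1,2) step(1,3)]
  show ?case
    unfolding expected_total_step[OF assms(1,2) step(1,3)]
  proof (intro expectation_mono_finite p(2) add_mono)
    fix a assume "a \<in> set_pmf (\<pi> h s)"
    then have z: "(s, a) \<in> sa_space M" using p(1) step(3) by auto
    show "g h (s, a) \<le> g' h (s, a)" using assms(5)[OF step(1) z] .
    fix s' assume "s' \<in> set_pmf (trans M h (s, a))"
    then show "expected_total M \<pi> g (Suc h) s' \<le> expected_total M \<pi> g' (Suc h) s'"
      using trans_support[OF assms(1) step(1) z] step(2) by auto
  next
    fix a assume "a \<in> set_pmf (\<pi> h s)"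
    then show "finite (set_pmf (trans M h (s, a)))"
      using trans_support[OF assms(1) step(1), of "(s,a)"] p(1) step(3) by auto
  qed
qed (simp add: expected_total_beyond)

lemma expected_total_const:
  assumes "mdp_wf M" "\<pi> \<in> policies M" "h \<in> {1..Suc (horizon M)}" "s \<in> states M"
  shows "expected_total M \<pi> (\<lambda>h z. c) h s = c * (real (Suc (horizon M)) - real h)"
  using assms(3,4)
proof (induction arbitrary: s rule: stage_induct)
  case (step h)
  note p = policy_support[OF assms(1,2) step(1,3)]
  have "expected_total M \<pi> (\<lambda>h z. c) h s =
    measure_pmf.expectation (\<pi> h s) (\<lambda>a. c + c * (real (Suc (horizon M)) - real (Suc h)))"
    unfolding expected_total_step[OF assms(1,2) step(1,3)]
  proof (rule expectation_cong_pmf, rule arg_cong2[where f = "(+)", OF refl])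
    fix a assume "a \<in> set_pmf (\<pi> h s)"
    then have z: "(s, a) \<in> sa_space M" using p(1) step(3) by auto
    have "measure_pmf.expectation (trans M h (s, a)) (expected_total M \<pi> (\<lambda>h z. c) (Suc h))
      = measure_pmf.expectation (trans M h (s, a)) (\<lambda>_. c * (real (Suc (horizon M)) - real (Suc h)))"
      using trans_support[OF assms(1) step(1) z] step(2) by (intro expectation_cong_pmf) auto
    then show "measure_pmf.expectation (trans M h (s, a)) (expected_total M \<pi> (\<lambda>h z. c) (Suc h))
      = c * (real (Suc (horizon M)) - real (Suc h))" by simp
  qed
  then show ?case by (simp add: algebra_simps)
qed (simp add: expected_total_beyond)

lemma expected_total_mult:
  "expected_total M \<pi> (\<lambda>h z. c * g h z) h s = c * expected_total M \<pi> g h s"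
  unfolding expected_total_def by (simp flip: sum_distrib_left)

section \<open>Comparing a pessimistic estimate with true values\<close>

lemma det_policy_in_policies:
  "(\<And>h s. h \<in> {1..horizon M} \<Longrightarrow> s \<in> states M \<Longrightarrow> \<pi> h s \<in> actions M) \<Longrightarrow> det_policy \<pi> \<in> policies M"
  by (auto simp: policies_def det_policy_def)

text \<open>\<open>V\<close> lies below its own true Bellman backup at the actions that \<pi> takes,
  so by monotonicity of the backup it stays below the value of \<pi> at every stage.\<close>

lemma pessimistic_value_le:
  assumes wf: "mdp_wf M"
    and V0: "\<And>s. V (Suc (horizon M)) s = 0"
    and \<pi>: "\<And>h s. h \<in> {1..horizon M} \<Longrightarrow> s \<in> states M \<Longrightarrow> \<pi> h s \<in> actions M \<and> V h s = Q h (s, \<pi> h s)"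
    and Q: "\<And>h z. h \<in> {1..horizon M} \<Longrightarrow> z \<in> sa_space M \<Longrightarrow>
      Q h z \<le> rew M h z + measure_pmf.expectation (trans M h z) (V (Suc h))"
    and h: "h \<in> {1..Suc (horizon M)}" and s: "s \<in> states M"
  shows "V h s \<le> value_fn M (det_policy \<pi>) h s"
  using h s
proof (induction arbitrary: s rule: stage_induct)
  case beyond
  then show ?case by (simp add: value_fn_def expected_total_beyond V0)
next
  case (step h)
  have pol: "det_policy \<pi> \<in> policies M" using \<pi> by (auto intro: det_policy_in_policies)
  define z where "z = (s, \<pi> h s)"
  have z: "z \<in> sa_space M" using \<pi>[OF step(1,3)] step(3) by (simp add: z_def)
  have "V h s \<le> rew M h z + measure_pmf.expectation (trans M h z) (V (Suc h))"
    using Q[OF step(1) z] \<pi>[OF step(1,3)] by (simp add: z_def)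
  also have "\<dots> \<le> rew M h z + measure_pmf.expectation (trans M h z) (value_fn M (det_policy \<pi>) (Suc h))"
    using trans_support[OF wf step(1) z] step(2) by (intro add_left_mono expectation_mono_finite) auto
  also have "\<dots> = value_fn M (det_policy \<pi>) h s"
    unfolding value_fn_def expected_total_step[OF wf pol step(1,3)] by (simp add: det_policy_def z_def)
  finally show ?case .
qed

text \<open>\<open>V\<close> dominates \<open>Q\<close> at every action, including those of an
  arbitrary comparison policy. The backup errors \<open>b\<close> therefore add up along the
  trajectory of that policy, and not along that of the learned one.\<close>

lemma value_le_pessimistic_plus_bonus:
  assumes wf: "mdp_wf M" and pol: "\<pi> \<in> policies M"
    and V0: "\<And>s. V (Suc (horizon M)) s = 0"
    and V: "\<And>h s a. h \<in> {1..horizon M} \<Longrightarrow> s \<in> states M \<Longrightarrow> a \<in> actions M \<Longrightarrow> Q h (s, a) \<le> V h s"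
    and Q: "\<And>h z. h \<in> {1..horizon M} \<Longrightarrow> z \<in> sa_space M \<Longrightarrow>
      rew M h z + measure_pmf.expectation (trans M h z) (V (Suc h)) \<le> Q h z + b h z"
    and h: "h \<in> {1..Suc (horizon M)}" and s: "s \<in> states M"
  shows "value_fn M \<pi> h s \<le> V h s + expected_total M \<pi> b h s"
  using h s
proof (induction arbitrary: s rule: stage_induct)
  case beyond
  then show ?case by (simp add: value_fn_def expected_total_beyond V0)
next
  case (step h)
  note p = policy_support[OF wf pol step(1,3)]
  have "value_fn M \<pi> h s \<le> measure_pmf.expectation (\<pi> h s) (\<lambda>a. V h s + (b h (s, a) +
    measure_pmf.expectation (trans M h (s, a)) (expected_total M \<pi> b (Suc h))))"
    unfolding value_fn_def expected_total_step[OF wf pol step(1,3)]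
  proof (intro expectation_mono_finite p(2))
    fix a assume a: "a \<in> set_pmf (\<pi> h s)"
    then have z: "(s, a) \<in> sa_space M" using p(1) step(3) by auto
    note t = trans_support[OF wf step(1) z]
    have "measure_pmf.expectation (trans M h (s, a)) (value_fn M \<pi> (Suc h))
      \<le> measure_pmf.expectation (trans M h (s, a)) (\<lambda>s'. V (Suc h) s' + expected_total M \<pi> b (Suc h) s')"
      using t step(2) by (intro expectation_mono_finite) auto
    also have "\<dots> = measure_pmf.expectation (trans M h (s, a)) (V (Suc h)) +
      measure_pmf.expectation (trans M h (s, a)) (expected_total M \<pi> b (Suc h))"
      using t by (simp add: expectation_add_finite)
    finally show "rew M h (s, a) + measure_pmf.expectation (trans M h (s, a)) (expected_total M \<pi> (rew M) (Suc h))
      \<le> V h s + (b h (s, a) + measure_pmf.expectation (trans M h (s, a)) (expected_total M \<pi> b (Suc h)))"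
      using Q[OF step(1) z] V[OF step(1,3), of a] z by (simp add: value_fn_def)
  qed
  also have "\<dots> = V h s + expected_total M \<pi> b h s"
    unfolding expected_total_step[OF wf pol step(1,3)] using p(2) by (simp add: expectation_add_finite)
  finally show ?case .
qed


section \<open>Concentration of the empirical transitions\<close>

text \<open>Hoeffding's lemma for a variable of range 1. It is needed for both signs of
  \<open>l\<close>, as least squares later uses multipliers of either sign; a negative
  \<open>l\<close> is reduced to a positive one by passing to the complement of
  \<open>U\<close>.\<close>

lemma Hoeffding_indicator_pmf:
  fixes l :: real
  shows "(\<integral>\<^sup>+x. ennreal (exp (l * (indicator U x - measure_pmf.prob q U))) \<partial>measure_pmf q)
    \<le> ennreal (exp (l\<^sup>2 / 8))"
proof -
  have pos: "(\<integral>\<^sup>+x. ennreal (exp (l * (indicator U x - measure_pmf.prob q U))) \<partial>measure_pmf q)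
    \<le> ennreal (exp (l\<^sup>2 / 8))" if "l > 0" for l and U :: "'a set"
  proof -
    define P where "P = measure_pmf.prob q U"
    interpret interval_bounded_random_variable "measure_pmf q" "\<lambda>x. indicator U x - P" "- P" "1 - P"
      by unfold_locales (auto simp: indicator_def)
    have "measure_pmf.expectation q (\<lambda>x. indicator U x - P) = 0"
      by (subst Bochner_Integration.integral_diff)
        (auto simp: P_def intro!: measure_pmf.integrable_const_bound[where B = 1])
    from Hoeffdings_lemma_nn_integral_0[OF that this] show ?thesis
      by (simp add: P_def)
  qed
  consider "l > 0" | "l = 0" | "l < 0" by linarith
  then show ?thesis
  proof cases
    case 3
    have c: "measure_pmf.prob q (- U) = 1 - measure_pmf.prob q U"
      using measure_pmf.prob_compl[of U q] by (simp add: Compl_eq_Diff_UNIV)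
    have "l * (indicator U x - measure_pmf.prob q U) =
        - l * (indicator (- U) x - measure_pmf.prob q (- U))" for x
      unfolding c by (simp add: indicator_def algebra_simps)
    then show ?thesis using pos[of "- l" "- U"] 3 by simp
  qed (use pos in auto)
qed

text \<open>The compensator is already part of \<open>W\<close>, so Markov's inequality at level 1
  leaves nothing to optimise.\<close>

lemma exp_moment_tail:
  assumes "(\<integral>\<^sup>+x. ennreal (exp (W x)) \<partial>measure_pmf p) \<le> 1"
  shows "measure_pmf.prob p {x. c \<le> W x} \<le> exp (- c)"
proof -
  have "emeasure (measure_pmf p) {x \<in> UNIV. 1 \<le> ennreal (exp (- c)) * ennreal (exp (W x))}
    \<le> ennreal (exp (- c)) * (\<integral>\<^sup>+x. ennreal (exp (W x)) * indicator UNIV x \<partial>measure_pmf p)"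
    by (intro nn_integral_Markov_inequality) auto
  also have "\<dots> \<le> ennreal (exp (- c))"
    using mult_left_mono[OF assms, of "ennreal (exp (- c))"] by simp
  also have "{x \<in> UNIV. 1 \<le> ennreal (exp (- c)) * ennreal (exp (W x))} = {x. c \<le> W x}"
    by (auto simp flip: ennreal_mult exp_add)
  finally show ?thesis
    by (simp add: measure_pmf.emeasure_eq_measure)
qed

section \<open>From conditional probabilities to a factorised joint law\<close>

lemma map_pmf_disintegrate:
  fixes X :: "'w \<Rightarrow> 'x" and Y :: "'w \<Rightarrow> 'y"
  assumes "\<And>\<omega> s. \<omega> \<in> set_pmf p \<Longrightarrow>
    measure_pmf.prob p {\<omega>'. X \<omega>' = X \<omega> \<and> Y \<omega>' = s} =
    measure_pmf.prob p {\<omega>'. X \<omega>' = X \<omega>} * pmf (\<kappa> (X \<omega>)) s"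
  shows "map_pmf (\<lambda>\<omega>. (X \<omega>, Y \<omega>)) p = bind_pmf (map_pmf X p) (\<lambda>x. map_pmf (Pair x) (\<kappa> x))"
proof (rule pmf_eqI)
  fix xs :: "'x \<times> 'y"
  obtain x s where xs: "xs = (x, s)" by force
  have "pmf (map_pmf (Pair x') (\<kappa> x')) xs = indicator {x} x' * pmf (\<kappa> x) s" for x'
  proof (cases "x' = x")
    case True
    have "inj_on (Pair x) (set_pmf (\<kappa> x) \<union> {s})" by (simp add: inj_on_def)
    then show ?thesis using True xs pmf_map_inj'[of "Pair x" "\<kappa> x" s] by (simp add: inj_def)
  next
    case False
    then have "xs \<notin> set_pmf (map_pmf (Pair x') (\<kappa> x'))" using xs by auto
    then have "pmf (map_pmf (Pair x') (\<kappa> x')) xs = 0" by (rule pmf_eq_0_set_pmf[THEN iffD2])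
    then show ?thesis using False by simp
  qed
  then have rhs: "pmf (bind_pmf (map_pmf X p) (\<lambda>x. map_pmf (Pair x) (\<kappa> x))) xs =
      pmf (map_pmf X p) x * pmf (\<kappa> x) s"
    by (simp add: pmf_bind measure_pmf_single del: integral_map_pmf)
  have lhs: "pmf (map_pmf (\<lambda>\<omega>. (X \<omega>, Y \<omega>)) p) xs = measure_pmf.prob p {\<omega>'. X \<omega>' = x \<and> Y \<omega>' = s}"
    unfolding pmf_map xs by (rule arg_cong[where f = "measure_pmf.prob p"]) auto
  have pX: "pmf (map_pmf X p) x = measure_pmf.prob p {\<omega>'. X \<omega>' = x}"
    unfolding pmf_map by (rule arg_cong[where f = "measure_pmf.prob p"]) auto
  show "pmf (map_pmf (\<lambda>\<omega>. (X \<omega>, Y \<omega>)) p) xs =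
      pmf (bind_pmf (map_pmf X p) (\<lambda>x. map_pmf (Pair x) (\<kappa> x))) xs"
  \<comment> \<open>For a value that \<open>X\<close> never takes both sides vanish, so the product
    identity is needed only on the support.\<close>
  proof (cases "x \<in> X ` set_pmf p")
    case True
    then show ?thesis using assms by (auto simp: lhs rhs pX)
  next
    case False
    then have "measure_pmf.prob p {\<omega>'. X \<omega>' = x} = 0"
      by (auto simp: measure_pmf_zero_iff)
    moreover have "measure_pmf.prob p {\<omega>'. X \<omega>' = x \<and> Y \<omega>' = s} = 0"
      using False by (auto simp: measure_pmf_zero_iff)
    ultimately show ?thesis by (simp add: lhs rhs pX)
  qed
qed

text \<open>Exactly the information on which compliance conditions: the current pair is included,
  the next state it leads to is not. With lists, \<open>last\<close> recovers the current pair and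
  the other entries determine all earlier transitions at stage \<open>h\<close>.\<close>

definition history :: "nat \<Rightarrow> nat \<Rightarrow> ('s, 'a) dataset \<Rightarrow> ('s \<times> 'a) list \<times> 's list" where
  "history h k D = (map (sa D h) [1..<Suc k], map (state D (Suc h)) [1..<k])"

lemma history_eq_iff: "history h k D = history h k D' \<longleftrightarrow>
    (\<forall>j\<in>{1..k}. sa D h j = sa D' h j) \<and> (\<forall>j\<in>{1..<k}. state D (Suc h) j = state D' (Suc h) j)"
  unfolding history_def by (auto simp del: upt_Suc)

lemma last_history: "1 \<le> k \<Longrightarrow> last (fst (history h k D)) = sa D h k"
  by (auto simp: history_def)

text \<open>Compliance in kernel form: given the history, the next state has a law that depends only
  on the current pair. Compliance speaks of next states in \<open>states M\<close>; for any other
  \<open>s\<close> both sides are zero.\<close>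

lemma compliant_history:
  assumes "mdp_wf M" "\<forall>D\<in>set_pmf p. dataset_in M K D" "compliant M K p"
    and h: "h \<in> {1..horizon M}" and k: "k \<in> {1..K}"
  shows "map_pmf (\<lambda>D. (history h k D, state D (Suc h) k)) p =
    bind_pmf (map_pmf (history h k) p) (\<lambda>x. map_pmf (Pair x) (trans M h (last (fst x))))"
proof (rule map_pmf_disintegrate)
  fix D s assume D: "D \<in> set_pmf p"
  have last: "last (fst (history h k D)) = sa D h k" using k by (simp add: last_history)
  have z: "sa D h k \<in> sa_space M"
    using assms(2) D h k by (auto simp: dataset_in_def sa_def)
  have pos: "measure_pmf.prob p {D'. history h k D' = history h k D} > 0"
    using D by (auto simp: zero_less_measure_iff measure_pmf_zero_iff)
  show "measure_pmf.prob p {D'. history h k D' = history h k D \<and> state D' (Suc h) k = s} =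
      measure_pmf.prob p {D'. history h k D' = history h k D} *
      pmf (trans M h (last (fst (history h k D)))) s"
  proof (cases "s \<in> states M")
    case True
    have "\<P>(D' in measure_pmf p. state D' (h + 1) k = s \<bar>
            (\<forall>j\<in>{1..k}. sa D' h j = sa D h j) \<and>
            (\<forall>j\<in>{1..<k}. state D' (h + 1) j = state D (h + 1) j)) = pmf (trans M h (sa D h k)) s"
      using assms(3) D True h k unfolding compliant_def by blast
    then have "measure_pmf.prob p {D'. state D' (Suc h) k = s \<and> history h k D' = history h k D} /
       measure_pmf.prob p {D'. history h k D' = history h k D} = pmf (trans M h (sa D h k)) s"
      by (simp add: cond_prob_def history_eq_iff)
    moreover have "{D'. state D' (Suc h) k = s \<and> history h k D' = history h k D} =
      {D'. history h k D' = history h k D \<and> state D' (Suc h) k = s}" by auto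
    ultimately show ?thesis using pos by (simp add: last field_simps)
  next
    case False
    have "s \<notin> set_pmf (trans M h (sa D h k))"
      using trans_support(1)[OF assms(1) h z] False by auto
    moreover have "measure_pmf.prob p {D'. history h k D' = history h k D \<and> state D' (Suc h) k = s} = 0"
      using assms(2) False h k by (auto simp: measure_pmf_zero_iff dataset_in_def)
    ultimately show ?thesis by (simp add: last set_pmf_iff)
  qed
qed

text \<open>Supermartingale argument in which time is the index \<open>k\<close> of the episode, at
  a fixed stage. Given the history, the earlier increments are constants and the new one has
  exponential moment at most 1: by Hoeffding if the current pair is \<open>z\<close>, trivially
  otherwise, since the increment is then 0.\<close>

lemma transition_exp_moment:
  fixes l :: real
  defines "w \<equiv> \<lambda>M h z U z' s'. if z' = z
    then l * (indicator U s' - measure_pmf.prob (trans M h z) U) - l\<^sup>2 / 8 else 0"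
  assumes "mdp_wf (M :: ('s, 'a) mdp)" "\<forall>D\<in>set_pmf p. dataset_in M K D" "compliant M K p"
    and h: "h \<in> {1..horizon M}"
  shows "k \<le> K \<Longrightarrow>
    (\<integral>\<^sup>+D. ennreal (exp (\<Sum>j\<in>{1..k}. w M h z U (sa D h j) (state D (Suc h) j))) \<partial>measure_pmf p) \<le> 1"
proof (induction k)
  case 0
  then show ?case by simp
next
  case (Suc k)
  \<comment> \<open>\<open>m\<close> reads the first \<open>k\<close> increments off the history of
    index \<open>Suc k\<close>, which already contains their next states. The shift
    \<open>j - 1\<close> translates episodes counted from 1 to list positions counted from
    0.\<close>
  define m where "m = (\<lambda>x :: _ list \<times> 's list. ennreal (exp (\<Sum>j\<in>{1..k}. w M h z U (fst x ! (j - 1)) (snd x ! (j - 1)))))"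
  define \<phi> where "\<phi> = (\<lambda>(x :: _ list \<times> 's list) s. ennreal (exp (w M h z U (last (fst x)) s)))"
  have m: "m (history h (Suc k) D) =
      ennreal (exp (\<Sum>j\<in>{1..k}. w M h z U (sa D h j) (state D (Suc h) j)))" for D
  proof -
    have "(\<Sum>j\<in>{1..k}. w M h z U (fst (history h (Suc k) D) ! (j - 1)) (snd (history h (Suc k) D) ! (j - 1)))
      = (\<Sum>j\<in>{1..k}. w M h z U (sa D h j) (state D (Suc h) j))"
      by (rule sum.cong) (auto simp: history_def simp del: upt_Suc)
    then show ?thesis by (simp add: m_def)
  qed
  have \<phi>: "(\<integral>\<^sup>+s. \<phi> x s \<partial>measure_pmf (trans M h (last (fst x)))) \<le> 1" for x
  proof (cases "last (fst x) = z")
    case True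
    have "(\<integral>\<^sup>+s. \<phi> x s \<partial>measure_pmf (trans M h z)) =
      (\<integral>\<^sup>+s. ennreal (exp (- l\<^sup>2 / 8)) * ennreal (exp (l * (indicator U s - measure_pmf.prob (trans M h z) U)))
        \<partial>measure_pmf (trans M h z))"
      unfolding \<phi>_def w_def True by (auto simp flip: ennreal_mult exp_add)
    also have "\<dots> \<le> ennreal (exp (- l\<^sup>2 / 8)) * ennreal (exp (l\<^sup>2 / 8))"
      by (subst nn_integral_cmult) (auto intro!: mult_left_mono Hoeffding_indicator_pmf)
    also have "\<dots> = 1" by (simp flip: ennreal_mult exp_add)
    finally show ?thesis using True by simp
  next
    case False
    then show ?thesis by (simp add: \<phi>_def w_def)
  qed
  have "(\<integral>\<^sup>+D. ennreal (exp (\<Sum>j\<in>{1..Suc k}. w M h z U (sa D h j) (state D (Suc h) j))) \<partial>measure_pmf p)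
    = (\<integral>\<^sup>+D. m (history h (Suc k) D) * \<phi> (history h (Suc k) D) (state D (Suc h) (Suc k)) \<partial>measure_pmf p)"
    by (intro nn_integral_cong) (simp add: m \<phi>_def last_history exp_add ennreal_mult)
  also have "\<dots> = (\<integral>\<^sup>+(x, s). m x * \<phi> x s \<partial>measure_pmf (map_pmf (\<lambda>D. (history h (Suc k) D, state D (Suc h) (Suc k))) p))"
    by simp
  also have "\<dots> = (\<integral>\<^sup>+x. \<integral>\<^sup>+s. m x * \<phi> x s \<partial>measure_pmf (trans M h (last (fst x))) \<partial>measure_pmf (map_pmf (history h (Suc k)) p))"
    using Suc.prems by (subst compliant_history[OF assms(2-4) h]) (auto simp del: nn_integral_map_pmf, simp)
  also have "\<dots> \<le> (\<integral>\<^sup>+x. m x \<partial>measure_pmf (map_pmf (history h (Suc k)) p))"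
    by (intro nn_integral_mono) (use mult_left_mono[OF \<phi>, of "m _"] in \<open>simp add: nn_integral_cmult\<close>)
  also have "\<dots> = (\<integral>\<^sup>+D. ennreal (exp (\<Sum>j\<in>{1..k}. w M h z U (sa D h j) (state D (Suc h) j))) \<partial>measure_pmf p)"
    by (simp add: m)
  also have "\<dots> \<le> 1" using Suc by simp
  finally show ?case .
qed

definition emp_count :: "nat \<Rightarrow> ('s, 'a) dataset \<Rightarrow> nat \<Rightarrow> 's \<times> 'a \<Rightarrow> 's set \<Rightarrow> nat" where
  "emp_count K D h z U = card {k\<in>{1..K}. sa D h k = z \<and> state D (Suc h) k \<in> U}"

text \<open>The number of visits is random and is therefore fixed to \<open>n\<close> inside the
  event. There \<open>W\<close> is the exponent of an ordinary Hoeffding bound for \<open>n\<close>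
  samples.\<close>

lemma transition_tail:
  assumes "mdp_wf M" "\<forall>D\<in>set_pmf p. dataset_in M K D" "compliant M K p"
    and h: "h \<in> {1..horizon M}" and t: "t \<ge> 0"
  shows "measure_pmf.prob p {D. visits K D h z = n \<and>
      real n * (measure_pmf.prob (trans M h z) U + t) \<le> real (emp_count K D h z U)}
    \<le> exp (- (2 * real n * t\<^sup>2))"
proof -
  \<comment> \<open>The choice 4t maximises lt - l^2/8, with maximum 2t^2.\<close>
  define l where "l = 4 * t"
  define P where "P = measure_pmf.prob (trans M h z) U"
  define w where "w = (\<lambda>z' s'. if z' = z
    then l * (indicator U s' - measure_pmf.prob (trans M h z) U) - l\<^sup>2 / 8 else 0)"
  define W where "W = (\<lambda>D. \<Sum>j\<in>{1..K}. w (sa D h j) (state D (Suc h) j))"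
  have W: "W D = l * (real (emp_count K D h z U) - real (visits K D h z) * P) - real (visits K D h z) * l\<^sup>2 / 8" for D
  proof -
    have "W D = (\<Sum>j\<in>{1..K}. l * of_bool (sa D h j = z \<and> state D (Suc h) j \<in> U)
        - (l * P + l\<^sup>2 / 8) * of_bool (sa D h j = z))"
      unfolding W_def by (rule sum.cong) (auto simp: w_def P_def algebra_simps)
    also have "\<dots> = l * real (emp_count K D h z U) - (l * P + l\<^sup>2 / 8) * real (visits K D h z)"
      by (simp add: sum_subtractf emp_count_def visits_def Int_def flip: sum_distrib_left)
    finally show ?thesis by (simp add: algebra_simps)
  qed
  have mom: "(\<integral>\<^sup>+D. ennreal (exp (W D)) \<partial>measure_pmf p) \<le> 1"
    unfolding W_def w_def by (rule transition_exp_moment[OF assms(1-4) order_refl])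
  have le: "2 * real n * t\<^sup>2 \<le> W D"
    if "visits K D h z = n" "real n * (P + t) \<le> real (emp_count K D h z U)" for D
  proof -
    have "l * (real n * t) \<le> l * (real (emp_count K D h z U) - real n * P)"
      using that t by (intro mult_left_mono) (auto simp: l_def algebra_simps)
    then show ?thesis using that by (simp add: W l_def power2_eq_square algebra_simps)
  qed
  have "measure_pmf.prob p {D. visits K D h z = n \<and> real n * (P + t) \<le> real (emp_count K D h z U)}
      \<le> measure_pmf.prob p {D. 2 * real n * t\<^sup>2 \<le> W D}"
    using le by (intro measure_pmf.finite_measure_mono) auto
  also have "\<dots> \<le> exp (- (2 * real n * t\<^sup>2))"
    by (rule exp_moment_tail[OF mom])
  finally show ?thesis unfolding P_def .
qed

text \<open>Split at \<open>U\<close>, where \<open>P'\<close> is at least \<open>P\<close>. The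
  part on \<open>U\<close> lies in [0, B t], and the part off \<open>U\<close> in [-B t, 0] because
  the totals agree. The two parts have opposite signs, so no factor 2 is lost, and one-sided control
  of the sets suffices.\<close>

lemma sum_mult_diff_le_TV:
  fixes P' P V :: "'s \<Rightarrow> real"
  assumes S: "finite S" and V: "\<And>s. s \<in> S \<Longrightarrow> 0 \<le> V s \<and> V s \<le> B"
    and tot: "sum P' S = sum P S"
    and TV: "\<And>U. U \<subseteq> S \<Longrightarrow> sum P' U - sum P U \<le> t"
    and B: "0 \<le> B"
  shows "\<bar>(\<Sum>s\<in>S. P' s * V s) - (\<Sum>s\<in>S. P s * V s)\<bar> \<le> B * t"
proof -
  define U where "U = {s\<in>S. P' s \<ge> P s}"
  have U: "U \<subseteq> S" "finite U" using S by (auto simp: U_def)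
  have eq: "(\<Sum>s\<in>S. P' s * V s) - (\<Sum>s\<in>S. P s * V s) =
      (\<Sum>s\<in>U. (P' s - P s) * V s) + (\<Sum>s\<in>S-U. (P' s - P s) * V s)"
    by (simp add: sum.subset_diff[OF U(1) S] left_diff_distrib sum_subtractf)
  have c: "sum P' (S - U) - sum P (S - U) = - (sum P' U - sum P U)"
    using sum.subset_diff[OF U(1) S, of P'] sum.subset_diff[OF U(1) S, of P] tot by simp
  have t: "B * (sum P' U - sum P U) \<le> B * t" using TV[OF U(1)] B by (intro mult_left_mono)
  have 1: "(\<Sum>s\<in>U. (P' s - P s) * V s) \<le> (\<Sum>s\<in>U. (P' s - P s) * B)"
    using V U by (intro sum_mono mult_left_mono) (auto simp: U_def)
  have 2: "(\<Sum>s\<in>U. (P' s - P s) * V s) \<ge> 0"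
    using V U by (intro sum_nonneg mult_nonneg_nonneg) (auto simp: U_def)
  have 3: "(\<Sum>s\<in>S-U. (P' s - P s) * V s) \<le> 0"
    using V by (intro sum_nonpos mult_nonpos_nonneg) (auto simp: U_def)
  have 4: "(\<Sum>s\<in>S-U. (P' s - P s) * V s) \<ge> (\<Sum>s\<in>S-U. (P' s - P s) * B)"
    using V by (intro sum_mono mult_left_mono_neg) (auto simp: U_def)
  have 5: "(\<Sum>s\<in>U. (P' s - P s) * B) = B * (sum P' U - sum P U)"
    by (simp add: sum_subtractf sum_distrib_left algebra_simps)
  have 6: "(\<Sum>s\<in>S-U. (P' s - P s) * B) = - (B * (sum P' U - sum P U))"
    by (metis (no_types) c mult.commute mult_minus_right sum_distrib_right sum_subtractf)
  show ?thesis using 1 2 3 4 5 6 t unfolding eq by linarith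
qed

text \<open>After squaring and using 2n \<ge> n + 1, it remains to absorb (S + 1) ln 2 into S L. As
  S H \<ge> 4, L is at least 2 ln 2; for S \<ge> 3 this suffices, since S + 1 \<le> 2(S -
  1).\<close>

lemma deviation_numeric:
  fixes L :: real and S H n :: nat
  assumes S: "2 \<le> S" and H: "2 \<le> H" and L: "ln (real S * real H) \<le> L" and n: "1 \<le> n"
  shows "(real H - 1) * sqrt ((L + (real S + 1) * ln 2) / (2 * real n)) \<le>
    real H * sqrt (real S * L) / sqrt (real n + 1)"
proof -
  have ln2: "ln (2::real) > 0" by simp
  have "ln (2 * 2) \<le> ln (real S * real H)"
    using S H by (intro ln_mono mult_mono) auto
  moreover have "ln (2 * 2) = 2 * ln (2::real)" by (subst ln_mult) auto
  ultimately have L2: "2 * ln 2 \<le> L" using L by linarith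
  then have L0: "0 \<le> L" using ln2 by linarith
  have main: "(real H - 1)\<^sup>2 * (L + (real S + 1) * ln 2) \<le> (real H)\<^sup>2 * (real S * L)"
  proof (cases "S = 2")
    case True
    \<comment> \<open>For S = 2 the absorption needs L \<ge> 3 ln 2, which holds once H \<ge> 4. For
      H \<le> 3 the ratio (H - 1)/H \<le> 2/3 gives the missing room instead: 4/9 times 5/2 is below
      2.\<close>
    show ?thesis
    proof (cases "H \<le> 3")
      case h: True
      have "3 * (real H - 1) \<le> 2 * real H" using h by simp
      then have "(3 * (real H - 1))\<^sup>2 \<le> (2 * real H)\<^sup>2" using H by (intro power_mono) auto
      then have a: "(real H - 1)\<^sup>2 \<le> 4 / 9 * (real H)\<^sup>2"
        by (simp add: power2_eq_square algebra_simps)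
      have "(real H - 1)\<^sup>2 * (L + (real S + 1) * ln 2) \<le> (4 / 9 * (real H)\<^sup>2) * (5 / 2 * L)"
        using a L2 True L0 ln2 by (intro mult_mono add_nonneg_nonneg L0) auto
      also have "\<dots> = 10 / 9 * ((real H)\<^sup>2 * L)" by simp
      also have "\<dots> \<le> 2 * ((real H)\<^sup>2 * L)"
        using mult_nonneg_nonneg[OF zero_le_power2[of "real H"] L0] by linarith
      also have "\<dots> = (real H)\<^sup>2 * (real S * L)" using True by simp
      finally show ?thesis .
    next
      case False
      have "ln (2 ^ 3) \<le> ln (real S * real H)"
        using False True by (intro ln_mono) auto
      then have "3 * ln 2 \<le> L" using L by (subst (asm) ln_realpow) auto
      then show ?thesis using True H ln2 by (intro mult_mono power_mono add_nonneg_nonneg mult_nonneg_nonneg L0) auto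
    qed
  next
    case False
    then have "real S \<ge> 3" using S by simp
    then have "(real S + 1) * ln 2 \<le> (2 * (real S - 1)) * ln 2"
      using ln2 by (intro mult_right_mono) auto
    also have "\<dots> \<le> (real S - 1) * L" using mult_left_mono[OF L2, of "real S - 1"] S by (simp only: mult_ac)
    finally have "L + (real S + 1) * ln 2 \<le> real S * L" by (simp add: algebra_simps)
    then show ?thesis using H L2 ln2 by (intro mult_mono power_mono add_nonneg_nonneg mult_nonneg_nonneg L0) auto
  qed
  have P0: "0 \<le> (L + (real S + 1) * ln 2) / (2 * real n)"
    by (intro divide_nonneg_nonneg add_nonneg_nonneg mult_nonneg_nonneg L0) auto
  have Q0: "0 \<le> (real H)\<^sup>2 * (real S * L)"
    by (intro mult_nonneg_nonneg L0) auto
  have "((real H - 1) * sqrt ((L + (real S + 1) * ln 2) / (2 * real n)))\<^sup>2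
      = (real H - 1)\<^sup>2 * (L + (real S + 1) * ln 2) / (2 * real n)"
    unfolding power_mult_distrib real_sqrt_pow2[OF P0] by simp
  also have "\<dots> \<le> (real H)\<^sup>2 * (real S * L) / (2 * real n)"
    using main by (intro divide_right_mono) auto
  also have "\<dots> \<le> (real H)\<^sup>2 * (real S * L) / (real n + 1)"
    using n by (intro divide_left_mono Q0) auto
  also have "\<dots> = (real H * sqrt (real S * L) / sqrt (real n + 1))\<^sup>2"
    using L0 by (simp add: power_mult_distrib power_divide)
  finally show ?thesis
    by (rule power2_le_imp_le) (use L0 in auto)
qed

text \<open>In the radius, \<open>log_factor\<close> pays for stages, pairs, visit counts and the
  confidence level; of the S + 1 copies of ln 2, S pay for the subsets \<open>U\<close> and one
  halves the failure probability.\<close>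

definition accurate_transitions :: "('s, 'a) mdp \<Rightarrow> nat \<Rightarrow> real \<Rightarrow> ('s, 'a) dataset \<Rightarrow> bool" where
  "accurate_transitions M K \<delta> D \<longleftrightarrow> (\<forall>h\<in>{1..horizon M}. \<forall>z\<in>sa_space M. \<forall>U. U \<subseteq> states M \<longrightarrow>
     1 \<le> visits K D h z \<longrightarrow> real (emp_count K D h z U) / real (visits K D h z)
       \<le> measure_pmf.prob (trans M h z) U +
          sqrt ((log_factor M K \<delta> + (real (card (states M)) + 1) * ln 2) / (2 * real (visits K D h z))))"

lemma visits_le: "visits K D h z \<le> K"
proof -
  have "visits K D h z \<le> card {1..K}" unfolding visits_def by (intro card_mono) auto
  then show ?thesis by simp
qed

lemma log_factor_ge:
  assumes "mdp_wf M" "1 \<le> K" "0 < \<delta>" "\<delta> < 1"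
  shows "ln (real (card (states M)) * real (card (actions M)) * real (horizon M) * real K) \<le> log_factor M K \<delta>"
    "1 \<le> card (states M)" "1 \<le> card (actions M)" "1 \<le> horizon M"
proof -
  show c: "1 \<le> card (states M)" "1 \<le> card (actions M)" "1 \<le> horizon M"
    using assms(1) unfolding mdp_wf_def by (auto simp: Suc_le_eq card_gt_0_iff)
  have "0 < real (card (states M)) * real (card (actions M)) * real (horizon M) * real K"
    using c assms(2) by auto
  moreover from this have "real (card (states M)) * real (card (actions M)) * real (horizon M) * real K * \<delta>
      \<le> real (card (states M)) * real (card (actions M)) * real (horizon M) * real K * 1"
    using assms(4) by (intro mult_left_mono) auto
  ultimately show "ln (real (card (states M)) * real (card (actions M)) * real (horizon M) * real K) \<le> log_factor M K \<delta>"
    unfolding log_factor_def using assms(3)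
    by (intro ln_mono) (simp_all only: pos_le_divide_eq mult_1_right)
qed

lemma log_factor_nonneg:
  assumes "mdp_wf M" "1 \<le> K" "0 < \<delta>" "\<delta> < 1"
  shows "0 \<le> log_factor M K \<delta>"
proof -
  note c = log_factor_ge[OF assms]
  have "1 * 1 * 1 * 1 \<le> real (card (states M)) * real (card (actions M)) * real (horizon M) * real K"
    using c(2-4) assms(2) by (intro mult_mono) auto
  then have "0 \<le> ln (real (card (states M)) * real (card (actions M)) * real (horizon M) * real K)"
    by simp
  with c(1) show ?thesis by linarith
qed

text \<open>Union bound over \<open>I\<close>. The visit count is a coordinate of the index, so the
  random count of a given dataset merely selects the event to which a violation belongs.\<close>

lemma prob_accurate_transitions:
  assumes "mdp_wf M" "\<forall>D\<in>set_pmf p. dataset_in M K D" "compliant M K p"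
    and "1 \<le> K" "0 < \<delta>" "\<delta> < 1"
  shows "measure_pmf.prob p {D. \<not> accurate_transitions M K \<delta> D} \<le> \<delta> / 2"
proof -
  define \<Lambda> where "\<Lambda> = log_factor M K \<delta> + (real (card (states M)) + 1) * ln 2"
  define I where "I = {1..horizon M} \<times> sa_space M \<times> {1..K} \<times> Pow (states M)"
  define bad where "bad = (\<lambda>(h, z, n, U). {D. visits K D h z = n \<and>
      real n * (measure_pmf.prob (trans M h z) U + sqrt (\<Lambda> / (2 * real n))) \<le> real (emp_count K D h z U)})"
  note c = log_factor_ge[OF assms(1,4-6)]
  have fin: "finite (states M)" "finite (actions M)" using assms(1) by (auto simp: mdp_wf_def)
  then have finI: "finite I" unfolding I_def by auto
  have \<Lambda>: "\<Lambda> \<ge> 0" using log_factor_nonneg[OF assms(1,4-6)] by (auto simp: \<Lambda>_def)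
  have "measure_pmf.prob p (bad i) \<le> exp (- \<Lambda>)" if "i \<in> I" for i
  proof -
    obtain h z n U where i: "i = (h, z, n, U)" by (cases i)
    have h: "h \<in> {1..horizon M}" and n: "1 \<le> n" using that by (auto simp: i I_def)
    have "measure_pmf.prob p (bad i) \<le> exp (- (2 * real n * (sqrt (\<Lambda> / (2 * real n)))\<^sup>2))"
      unfolding i bad_def prod.case
      by (rule transition_tail[OF assms(1-3) h]) (use \<Lambda> in auto)
    also have "\<dots> = exp (- \<Lambda>)" using \<Lambda> n by simp
    finally show ?thesis .
  qed
  then have "(\<Sum>i\<in>I. measure_pmf.prob p (bad i)) \<le> (\<Sum>i\<in>I. exp (- \<Lambda>))"
    by (intro sum_mono)
  moreover have "{D. \<not> accurate_transitions M K \<delta> D} \<subseteq> (\<Union>i\<in>I. bad i)"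
  proof
    fix D assume "D \<in> {D. \<not> accurate_transitions M K \<delta> D}"
    then obtain h z U where *: "h \<in> {1..horizon M}" "z \<in> sa_space M" "U \<subseteq> states M" "1 \<le> visits K D h z"
      and gt: "real (emp_count K D h z U) / real (visits K D h z)
       > measure_pmf.prob (trans M h z) U + sqrt (\<Lambda> / (2 * real (visits K D h z)))"
      unfolding accurate_transitions_def \<Lambda>_def by (auto simp: not_le)
    have "real (visits K D h z) * (measure_pmf.prob (trans M h z) U + sqrt (\<Lambda> / (2 * real (visits K D h z))))
        \<le> real (visits K D h z) * (real (emp_count K D h z U) / real (visits K D h z))"
      using gt by (intro mult_left_mono) auto
    also have "\<dots> = real (emp_count K D h z U)" using *(4) by simp
    finally have "D \<in> bad (h, z, visits K D h z, U)" by (simp add: bad_def)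
    moreover have "(h, z, visits K D h z, U) \<in> I"
      using * visits_le by (auto simp: I_def)
    ultimately show "D \<in> (\<Union>i\<in>I. bad i)" by blast
  qed
  then have "measure_pmf.prob p {D. \<not> accurate_transitions M K \<delta> D} \<le> measure_pmf.prob p (\<Union>i\<in>I. bad i)"
    by (intro measure_pmf.finite_measure_mono) auto
  moreover have "measure_pmf.prob p (\<Union>i\<in>I. bad i) \<le> (\<Sum>i\<in>I. measure_pmf.prob p (bad i))"
    using finI by (intro measure_pmf.finite_measure_subadditive_finite) auto
  \<comment> \<open>\<open>I\<close> has S A H K 2^S elements and exp \<Lambda> is (S A H K /
    \<delta>) 2^(S + 1), so exactly \<delta>/2 is left.\<close>
  moreover have "(\<Sum>i\<in>I. exp (- \<Lambda>)) = \<delta> / 2"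
  proof -
    define N where "N = real (card (states M)) * real (card (actions M)) * real (horizon M) * real K"
    have N: "N > 0" using c assms(4) by (auto simp: N_def)
    have cI: "real (card I) = N * 2 ^ card (states M)"
      using fin by (simp add: I_def card_cartesian_product card_Pow N_def)
    have "(real (card (states M)) + 1) * ln 2 = ln (2 ^ Suc (card (states M)))"
      by (subst ln_realpow) auto
    then have "exp \<Lambda> = N / \<delta> * 2 ^ Suc (card (states M))"
      using N assms(5) by (simp add: \<Lambda>_def log_factor_def N_def[symmetric] exp_add)
    then have "exp (- \<Lambda>) = \<delta> / (N * 2 ^ Suc (card (states M)))"
      by (simp add: exp_minus inverse_eq_divide)
    then show ?thesis using cI N by simp
  qed
  ultimately show ?thesis by linarith
qed


section \<open>Suboptimality of pessimistic planning\<close>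

lemma sum_emp_trans:
  assumes "finite U" "1 \<le> visits K D h z"
  shows "(\<Sum>s'\<in>U. emp_trans M K D h z s') = real (emp_count K D h z U) / real (visits K D h z)"
proof -
  have "(\<Sum>s'\<in>U. card {k\<in>{1..K}. sa D h k = z \<and> state D (h + 1) k = s'}) =
    card (\<Union>s'\<in>U. {k\<in>{1..K}. sa D h k = z \<and> state D (h + 1) k = s'})"
    using assms(1) by (intro card_UN_disjoint[symmetric]) auto
  also have "(\<Union>s'\<in>U. {k\<in>{1..K}. sa D h k = z \<and> state D (h + 1) k = s'}) =
    {k\<in>{1..K}. sa D h k = z \<and> state D (Suc h) k \<in> U}" by auto
  finally have "(\<Sum>s'\<in>U. real (card {k\<in>{1..K}. sa D h k = z \<and> state D (h + 1) k = s'})) =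
      real (emp_count K D h z U)"
    unfolding emp_count_def of_nat_sum[symmetric] by (rule arg_cong)
  then show ?thesis
    using assms(2) by (simp add: emp_trans_def flip: sum_divide_distrib)
qed

lemma emp_count_states:
  assumes "dataset_in M K D" "h \<in> {1..horizon M}"
  shows "emp_count K D h z (states M) = visits K D h z"
  unfolding emp_count_def visits_def using assms
  by (intro arg_cong[where f = card]) (auto simp: dataset_in_def)

lemma sum_emp_trans_states:
  assumes "mdp_wf M" "dataset_in M K D" "h \<in> {1..horizon M}"
  shows "(\<Sum>s'\<in>states M. emp_trans M K D h z s') = 1"
proof (cases "visits K D h z = 0")
  case True
  have "finite (states M)" "states M \<noteq> {}" using assms(1) unfolding mdp_wf_def by blast+
  then show ?thesis using True by (simp add: emp_trans_def)
next
  case False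
  have "finite (states M)" using assms(1) unfolding mdp_wf_def by blast
  then show ?thesis
    using sum_emp_trans[of "states M" K D h z M] emp_count_states[OF assms(2,3), of z] False
    by simp
qed

lemma emp_trans_nonneg: "0 \<le> emp_trans M K D h z s"
  by (simp add: emp_trans_def)

lemma v_rem_bounds:
  assumes "mdp_wf M"
  shows "n \<le> horizon M \<Longrightarrow> 0 \<le> v_rem M C K \<delta> D r n s \<and> v_rem M C K \<delta> D r n s \<le> real n"
proof (induction n arbitrary: s)
  case (Suc n)
  define q where "q = (\<lambda>a. q_backup M C K \<delta> D r (horizon M - n) (v_rem M C K \<delta> D r n) (s, a))"
  have A: "finite (actions M)" "actions M \<noteq> {}" using assms by (auto simp: mdp_wf_def)
  have q: "0 \<le> q a \<and> q a \<le> real (Suc n)" for a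
    using Suc.prems by (auto simp: q_def q_backup_def trunc_def of_nat_diff)
  have "(MAX a\<in>actions M. q a) \<in> q ` actions M" using A by (intro Max_in) auto
  then show ?case using q by (auto simp: q_def)
qed simp

lemma expectation_trans_sum:
  assumes "mdp_wf M" "h \<in> {1..horizon M}" "z \<in> sa_space M"
  shows "measure_pmf.expectation (trans M h z) V = (\<Sum>s'\<in>states M. pmf (trans M h z) s' * V s')"
  using assms trans_support[OF assms]
  by (subst integral_measure_pmf_real[of "states M"]) (auto simp: mdp_wf_def mult.commute)

text \<open>\<open>V\<close> is quantified after the accuracy event, so it may be the data-dependent
  estimate itself. If S = 1 both kernels coincide, and if H = 1 the next-stage values vanish; these
  cases lie outside the numerical estimate and have error 0.\<close>

lemma transition_error:
  assumes wf: "mdp_wf M" and D: "dataset_in M K D" and acc: "accurate_transitions M K \<delta> D"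
    and K: "1 \<le> K" and \<delta>: "0 < \<delta>" "\<delta> < 1"
    and h: "h \<in> {1..horizon M}" and z: "z \<in> sa_space M" and n: "1 \<le> visits K D h z"
    and V: "\<And>s. s \<in> states M \<Longrightarrow> 0 \<le> V s \<and> V s \<le> real (horizon M) - real h"
  shows "\<bar>(\<Sum>s'\<in>states M. emp_trans M K D h z s' * V s') - measure_pmf.expectation (trans M h z) V\<bar>
    \<le> real (horizon M) * sqrt (real (card (states M)) * log_factor M K \<delta>) / sqrt (real (visits K D h z) + 1)"
proof -
  define S where "S = card (states M)"
  define H where "H = horizon M"
  define t where "t = sqrt ((log_factor M K \<delta> + (real S + 1) * ln 2) / (2 * real (visits K D h z)))"
  note c = log_factor_ge[OF wf K \<delta>]
  have L0: "0 \<le> log_factor M K \<delta>" by (rule log_factor_nonneg[OF wf K \<delta>])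
  have fin: "finite (states M)" using wf by (simp add: mdp_wf_def)
  have tot: "sum (emp_trans M K D h z) (states M) = sum (pmf (trans M h z)) (states M)"
    using sum_emp_trans_states[OF wf D h] trans_support(1)[OF wf h z] fin by (simp add: sum_pmf_eq_1)
  have rhs0: "0 \<le> real H * sqrt (real S * log_factor M K \<delta>) / sqrt (real (visits K D h z) + 1)"
    using L0 by simp
  have TV: "sum (emp_trans M K D h z) U - sum (pmf (trans M h z)) U \<le> t" if "U \<subseteq> states M" for U
  proof -
    have finU: "finite U" using that fin by (rule finite_subset)
    have "real (emp_count K D h z U) / real (visits K D h z) \<le> measure_pmf.prob (trans M h z) U + t"
      using acc h z that n unfolding accurate_transitions_def t_def S_def by blast
    then show ?thesis
      by (simp add: sum_emp_trans[OF finU n] measure_measure_pmf_finite[OF finU])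
  qed
  have B: "0 \<le> real H - real h" "real H - real h \<le> real H - 1" using h by (auto simp: H_def)
  show ?thesis
  proof (cases "S = 1 \<or> H = 1")
    case True
    have "(\<Sum>s'\<in>states M. emp_trans M K D h z s' * V s') = (\<Sum>s'\<in>states M. pmf (trans M h z) s' * V s')"
    proof (cases "S = 1")
      case True
      then obtain s where "states M = {s}" by (auto simp: S_def card_1_singleton_iff)
      with tot show ?thesis by simp
    next
      case False
      then have "H = 1" using \<open>S = 1 \<or> H = 1\<close> by simp
      then have "V s = 0" if "s \<in> states M" for s
        using V[OF that] h by (simp add: H_def)
      then show ?thesis by simp
    qed
    then show ?thesis using rhs0 by (simp add: expectation_trans_sum[OF wf h z] S_def H_def)
  next
    case False
    have S: "2 \<le> S" "2 \<le> H" using False c by (auto simp: S_def H_def)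
    have "ln (real S * real H) \<le> ln (real (card (states M)) * real (card (actions M)) * real (horizon M) * real K)"
    proof (rule ln_mono)
      have "real S * 1 * real H * 1 \<le> real S * real (card (actions M)) * real H * real K"
        using c K by (intro mult_mono) auto
      then show "real S * real H \<le> real (card (states M)) * real (card (actions M)) * real (horizon M) * real K"
        by (simp add: S_def H_def)
    qed (use S in auto)
    also note c(1)
    finally have L: "ln (real S * real H) \<le> log_factor M K \<delta>" .
    have "\<bar>(\<Sum>s'\<in>states M. emp_trans M K D h z s' * V s') - (\<Sum>s'\<in>states M. pmf (trans M h z) s' * V s')\<bar>
      \<le> (real H - real h) * t"
      using V by (intro sum_mult_diff_le_TV fin tot TV B) (auto simp: H_def)
    also have "\<dots> \<le> (real H - 1) * t"
      using B L0 by (intro mult_right_mono) (auto simp: t_def)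
    also have "\<dots> \<le> real H * sqrt (real S * log_factor M K \<delta>) / sqrt (real (visits K D h z) + 1)"
      unfolding t_def by (rule deviation_numeric[OF S L n])
    finally show ?thesis by (simp add: expectation_trans_sum[OF wf h z] S_def H_def)
  qed
qed

text \<open>At a visited pair the untruncated estimate lies between the true backup minus 2 \<gamma>
  and the true backup. As the true backup lies in the truncation interval, truncation preserves both
  bounds.\<close>

lemma q_hat_accurate:
  fixes C :: real
  assumes wf: "mdp_wf M" and D: "dataset_in M K D" and acc: "accurate_transitions M K \<delta> D"
    and K: "1 \<le> K" and \<delta>: "0 < \<delta>" "\<delta> < 1" and C: "C = 1 / 2"
    and r01: "\<And>h z. h \<in> {1..horizon M} \<Longrightarrow> r h z \<le> 1"
    and r: "\<And>h z. h \<in> {1..horizon M} \<Longrightarrow> z \<in> sa_space M \<Longrightarrow> 1 \<le> visits K D h z \<Longrightarrow> r h z = rew M h z"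
    and unvisited: "1 \<le> real (card (states M)) * log_factor M K \<delta> \<or>
      (\<forall>h\<in>{1..horizon M}. \<forall>z\<in>sa_space M. 1 \<le> visits K D h z)"
    and h: "h \<in> {1..horizon M}" and z: "z \<in> sa_space M"
  defines "V \<equiv> v_rem M C K \<delta> D r (horizon M - h)"
  shows "q_hat M C K \<delta> D r h z \<le> rew M h z + measure_pmf.expectation (trans M h z) V"
    and "rew M h z + measure_pmf.expectation (trans M h z) V \<le> q_hat M C K \<delta> D r h z +
      2 * (real (horizon M) * sqrt (real (card (states M)) * log_factor M K \<delta>)) * (1 / sqrt (real (visits K D h z) + 1))"
proof -
  define \<beta> where "\<beta> = real (horizon M) * sqrt (real (card (states M)) * log_factor M K \<delta>)"
  define \<gamma> where "\<gamma> = \<beta> / sqrt (real (visits K D h z) + 1)"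
  define EV where "EV = measure_pmf.expectation (trans M h z) V"
  define PV where "PV = (\<Sum>s'\<in>states M. emp_trans M K D h z s' * V s')"
  define b where "b = real (horizon M) - real h"
  have V: "0 \<le> V s \<and> V s \<le> b" for s
    using v_rem_bounds[OF wf, of "horizon M - h" C K \<delta> D r s] h by (auto simp: V_def b_def of_nat_diff)
  have b: "0 \<le> b" "b + 1 \<le> real (horizon M)" using h by (auto simp: b_def)
  have L0: "0 \<le> log_factor M K \<delta>" by (rule log_factor_nonneg[OF wf K \<delta>])
  \<comment> \<open>With \<open>C = 1 / 2\<close> the subtracted penalty \<open>2 * bonus\<close> is
    \<gamma> itself.\<close>
  have q: "q_hat M C K \<delta> D r h z = max 0 (min (b + 1) (r h z + PV - \<gamma>))"
    by (simp add: q_hat_def q_backup_def trunc_def bonus_def C b_def PV_def \<gamma>_def \<beta>_def V_def)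
  have \<gamma>: "0 \<le> \<gamma>" using L0 by (simp add: \<gamma>_def \<beta>_def)
  have rew: "0 \<le> rew M h z \<and> rew M h z \<le> 1"
  proof -
    have "rew M h z \<in> {0, 1}" using wf h z unfolding mdp_wf_def by blast
    then show ?thesis by auto
  qed
  have EV: "0 \<le> EV" "EV \<le> b"
    unfolding EV_def using V trans_support[OF wf h z]
    by (intro expectation_ge_const expectation_le_const; simp)+
  have PV: "PV \<le> b"
  proof -
    have "PV \<le> (\<Sum>s'\<in>states M. emp_trans M K D h z s' * b)"
      unfolding PV_def using V by (intro sum_mono mult_left_mono emp_trans_nonneg) auto
    also have "\<dots> = b" using sum_emp_trans_states[OF wf D h, of z] by (simp flip: sum_distrib_right)
    finally show ?thesis .
  qed
  have "q_hat M C K \<delta> D r h z \<le> rew M h z + EV \<and> rew M h z + EV \<le> q_hat M C K \<delta> D r h z + 2 * \<gamma>"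
  proof (cases "1 \<le> visits K D h z")
    case True
    have "\<bar>PV - EV\<bar> \<le> \<gamma>"
      unfolding PV_def EV_def \<gamma>_def \<beta>_def
      by (rule transition_error[OF wf D acc K \<delta> h z True]) (use V in \<open>auto simp: b_def\<close>)
    moreover have "r h z = rew M h z" using r[OF h z True] .
    ultimately show ?thesis using rew EV \<gamma> unfolding q by linarith
  next
    case False
    \<comment> \<open>At an unvisited pair \<gamma> = \<beta> is at least the horizon, hence at
      least 1 + \<open>b\<close>. The estimate is thus truncated to 0 whatever the learned reward,
      while the true backup is at most 1 + \<open>b\<close> and hence below 2 \<gamma>.\<close>
    then have "1 \<le> real (card (states M)) * log_factor M K \<delta>" using unvisited h z by blast
    then have "real (horizon M) * 1 \<le> \<beta>"
      unfolding \<beta>_def by (intro mult_left_mono real_le_rsqrt) auto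
    moreover have "\<gamma> = \<beta>" using False by (simp add: \<gamma>_def not_less_eq_eq)
    ultimately show ?thesis using rew EV PV b r01[OF h, of z] unfolding q by linarith
  qed
  then show "q_hat M C K \<delta> D r h z \<le> rew M h z + measure_pmf.expectation (trans M h z) V"
    and "rew M h z + measure_pmf.expectation (trans M h z) V \<le> q_hat M C K \<delta> D r h z +
      2 * (real (horizon M) * sqrt (real (card (states M)) * log_factor M K \<delta>)) * (1 / sqrt (real (visits K D h z) + 1))"
    by (simp_all add: EV_def \<gamma>_def \<beta>_def)
qed

text \<open>S ln(SAHK/\<delta>) < 1 forces SAHK < 4, as ln 4 \<ge> 1, and S = 1, as 2 ln 2 \<ge> 1.
  A single action then leaves one pair, which every episode visits; with at least two actions, H = K
  = 1.\<close>

lemma small_log_factor: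
  assumes wf: "mdp_wf M" and D: "dataset_in M K D"
    and K: "1 \<le> K" and \<delta>: "0 < \<delta>" "\<delta> < 1"
    and lt: "real (card (states M)) * log_factor M K \<delta> < 1"
  shows "(\<forall>h\<in>{1..horizon M}. \<forall>z\<in>sa_space M. 1 \<le> visits K D h z) \<or>
    horizon M = 1 \<and> K = 1 \<and> ln 2 \<le> real (card (states M)) * log_factor M K \<delta>"
proof -
  define S where "S = card (states M)"
  define A where "A = card (actions M)"
  define H where "H = horizon M"
  note c = log_factor_ge[OF wf K \<delta>]
  have pos: "1 \<le> S" "1 \<le> A" "1 \<le> H" using c by (auto simp: S_def A_def H_def)
  have L0: "0 \<le> log_factor M K \<delta>" by (rule log_factor_nonneg[OF wf K \<delta>])
  have L: "ln (real m) \<le> log_factor M K \<delta>" if "1 \<le> m" "m \<le> S * A * H * K" for m :: nat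
  proof -
    have "real m \<le> real (S * A * H * K)" using that by (simp only: of_nat_le_iff)
    then have "ln (real m) \<le> ln (real (S * A * H * K))" using that by (intro ln_mono) auto
    also have "real (S * A * H * K) = real (card (states M)) * real (card (actions M)) * real (horizon M) * real K"
      by (simp add: S_def A_def H_def)
    also note c(1)
    finally show ?thesis .
  qed
  have ln2: "ln (2::real) \<ge> 1 / 2" using ln2_ge_two_thirds by simp
  have ln4: "ln (4::real) \<ge> 1"
  proof -
    have "ln (4::real) = 2 * ln 2" using ln_realpow[of 2 2] by simp
    then show ?thesis using ln2 by simp
  qed
  have not4: "\<not> 4 \<le> S * A * H * K"
  proof
    assume "4 \<le> S * A * H * K"
    then have "1 \<le> log_factor M K \<delta>" using L[of 4] ln4 by simp
    then have "1 * 1 \<le> real S * log_factor M K \<delta>" using pos by (intro mult_mono) auto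
    then show False using lt by (simp add: S_def)
  qed
  have S1: "S = 1"
  proof (rule ccontr)
    assume "S \<noteq> 1"
    then have S2: "2 \<le> S" using pos by simp
    then have "2 * 1 * 1 * 1 \<le> S * A * H * K" using pos K by (intro mult_le_mono) auto
    then have "1 / 2 \<le> log_factor M K \<delta>" using L[of 2] ln2 by simp
    then have "2 * (1 / 2) \<le> real S * log_factor M K \<delta>" using S2 by (intro mult_mono) auto
    then show False using lt by (simp add: S_def)
  qed
  show ?thesis
  proof (cases "A = 1")
    case True
    from S1 True obtain s a where sa: "states M = {s}" "actions M = {a}"
      by (auto simp: S_def A_def card_1_singleton_iff)
    have "1 \<le> visits K D h z" if "h \<in> {1..horizon M}" "z \<in> sa_space M" for h z
    proof -
      have "1 \<in> {k\<in>{1..K}. sa D h k = z}"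
        using D that K sa by (auto simp: dataset_in_def sa_def)
      then have "card {k\<in>{1..K}. sa D h k = z} > 0" by (subst card_gt_0_iff) auto
      then show ?thesis by (simp add: visits_def)
    qed
    then show ?thesis by blast
  next
    case False
    then have A2: "2 \<le> A" using pos by simp
    have "1 * 2 * 1 * 1 \<le> S * A * H * K" using A2 pos K by (intro mult_le_mono) auto
    then have "ln 2 \<le> log_factor M K \<delta>" using L[of 2] by simp
    moreover have "H = 1"
    proof (rule ccontr)
      assume "H \<noteq> 1"
      then have "1 * 2 * 2 * 1 \<le> S * A * H * K" using A2 pos K by (intro mult_le_mono) auto
      then show False using not4 by simp
    qed
    moreover have "K = 1"
    proof (rule ccontr)
      assume "K \<noteq> 1"
      then have "1 * 2 * 1 * 2 \<le> S * A * H * K" using A2 pos K by (intro mult_le_mono) auto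
      then show False using not4 by simp
    qed
    ultimately show ?thesis using S1 by (simp add: S_def H_def)
  qed
qed

lemma value_fn_bounds:
  assumes "mdp_wf M" "\<pi> \<in> policies M" "h \<in> {1..Suc (horizon M)}" "s \<in> states M"
  shows "0 \<le> value_fn M \<pi> h s" "value_fn M \<pi> h s \<le> real (Suc (horizon M)) - real h"
proof -
  have r: "0 \<le> rew M h z \<and> rew M h z \<le> 1" if "h \<in> {1..horizon M}" "z \<in> sa_space M" for h z
  proof -
    have "rew M h z \<in> {0, 1}" using assms(1) that unfolding mdp_wf_def by blast
    then show ?thesis by auto
  qed
  show "0 \<le> value_fn M \<pi> h s"
    using expected_total_mono[OF assms, of "\<lambda>h z. 0" "rew M"] r
      expected_total_const[OF assms, of 0] by (simp add: value_fn_def)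
  show "value_fn M \<pi> h s \<le> real (Suc (horizon M)) - real h"
    using expected_total_mono[OF assms, of "rew M" "\<lambda>h z. 1"] r
      expected_total_const[OF assms, of 1] by (simp add: value_fn_def)
qed

text \<open>The estimate at stage 1 is sandwiched: it is at most the value of the output policy, and
  at least the optimal value minus the errors 2 \<gamma> summed along an optimal trajectory.\<close>

lemma planning_suboptimality:
  fixes C :: real
  assumes wf: "mdp_wf M" and D: "dataset_in M K D" and acc: "accurate_transitions M K \<delta> D"
    and K: "1 \<le> K" and \<delta>: "0 < \<delta>" "\<delta> < 1" and C: "C = 1 / 2"
    and r01: "\<And>h z. h \<in> {1..horizon M} \<Longrightarrow> r h z \<le> 1"
    and r: "\<And>h z. h \<in> {1..horizon M} \<Longrightarrow> z \<in> sa_space M \<Longrightarrow> 1 \<le> visits K D h z \<Longrightarrow> r h z = rew M h z"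
    and \<pi>: "\<And>h s. h \<in> {1..horizon M} \<Longrightarrow> s \<in> states M \<Longrightarrow>
      is_arg_max (\<lambda>a. q_hat M C K \<delta> D r h (s, a)) (\<lambda>a. a \<in> actions M) (\<pi> h s)"
    and opt: "optimal_policy M \<pi>opt"
  shows "opt_value M 1 (init_state M) - value_fn M (det_policy \<pi>) 1 (init_state M)
    \<le> 2 * (real (horizon M) * sqrt (real (card (states M)) * log_factor M K \<delta>) *
       expected_total M \<pi>opt (\<lambda>h z. 1 / sqrt (real (visits K D h z) + 1)) 1 (init_state M))"
proof -
  define \<beta> where "\<beta> = real (horizon M) * sqrt (real (card (states M)) * log_factor M K \<delta>)"
  define N where "N = (\<lambda>h z. 1 / sqrt (real (visits K D h z) + 1))"
  have A: "finite (actions M)" "actions M \<noteq> {}" and s1: "init_state M \<in> states M"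
    using wf by (auto simp: mdp_wf_def)
  have h1: "1 \<in> {1..Suc (horizon M)}" by simp
  have L0: "0 \<le> log_factor M K \<delta>" by (rule log_factor_nonneg[OF wf K \<delta>])
  have po: "\<pi>opt \<in> policies M" and vo: "value_fn M \<pi>opt 1 (init_state M) = opt_value M 1 (init_state M)"
    using opt by (auto simp: optimal_policy_def)
  have \<pi>A: "\<pi> h s \<in> actions M" and \<pi>max: "\<And>a. a \<in> actions M \<Longrightarrow> q_hat M C K \<delta> D r h (s, a) \<le> q_hat M C K \<delta> D r h (s, \<pi> h s)"
    if "h \<in> {1..horizon M}" "s \<in> states M" for h s
    using \<pi>[OF that] by (auto simp: is_arg_max_linorder)
  have pd: "det_policy \<pi> \<in> policies M" using \<pi>A by (rule det_policy_in_policies)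
  have "opt_value M 1 (init_state M) - value_fn M (det_policy \<pi>) 1 (init_state M)
    \<le> 2 * \<beta> * expected_total M \<pi>opt N 1 (init_state M)"
  proof (cases "1 \<le> real (card (states M)) * log_factor M K \<delta> \<or>
      (\<forall>h\<in>{1..horizon M}. \<forall>z\<in>sa_space M. 1 \<le> visits K D h z)")
    case un: True
    \<comment> \<open>\<open>v_rem\<close> counts the stages still to go, so stage \<open>h\<close>
      corresponds to \<open>Suc (horizon M) - h\<close>.\<close>
    define V where "V = (\<lambda>h. v_rem M C K \<delta> D r (Suc (horizon M) - h))"
    define Q where "Q = q_hat M C K \<delta> D r"
    have V0: "V (Suc (horizon M)) s = 0" for s by (simp add: V_def)
    have VSuc: "V (Suc h) = v_rem M C K \<delta> D r (horizon M - h)" for h by (simp add: V_def)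
    have Vmax: "V h s = (MAX a\<in>actions M. Q h (s, a))" if "h \<in> {1..horizon M}" for h s
    proof -
      have "Suc (horizon M) - h = Suc (horizon M - h)" "horizon M - (horizon M - h) = h"
        using that by auto
      then show ?thesis by (simp add: V_def Q_def q_hat_def)
    qed
    have q1: "Q h z \<le> rew M h z + measure_pmf.expectation (trans M h z) (V (Suc h))"
      and q2: "rew M h z + measure_pmf.expectation (trans M h z) (V (Suc h)) \<le> Q h z + 2 * \<beta> * N h z"
      if "h \<in> {1..horizon M}" "z \<in> sa_space M" for h z
      unfolding Q_def VSuc \<beta>_def N_def
      by (rule q_hat_accurate[OF wf D acc K \<delta> C _ _ un that]; fact r01 r)+
    have "V 1 (init_state M) \<le> value_fn M (det_policy \<pi>) 1 (init_state M)"
    proof (rule pessimistic_value_le[where Q = Q and V = V, OF wf V0 _ q1 h1 s1])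
      fix h s assume hs: "h \<in> {1..horizon M}" "s \<in> states M"
      have "(MAX a\<in>actions M. Q h (s, a)) = Q h (s, \<pi> h s)"
        using A \<pi>A[OF hs] \<pi>max[OF hs] by (intro Max_eqI) (auto simp: Q_def)
      then show "\<pi> h s \<in> actions M \<and> V h s = Q h (s, \<pi> h s)"
        using Vmax[OF hs(1)] \<pi>A[OF hs] by simp
    qed
    moreover have "value_fn M \<pi>opt 1 (init_state M) \<le> V 1 (init_state M) +
        expected_total M \<pi>opt (\<lambda>h z. 2 * \<beta> * N h z) 1 (init_state M)"
    proof (rule value_le_pessimistic_plus_bonus[where Q = Q and V = V, OF wf po V0 _ q2 h1 s1])
    qed (use A Vmax in \<open>auto intro: Max_ge\<close>)
    moreover have "expected_total M \<pi>opt (\<lambda>h z. 2 * \<beta> * N h z) 1 (init_state M)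
        = 2 * \<beta> * expected_total M \<pi>opt N 1 (init_state M)"
      by (rule expected_total_mult)
    ultimately show ?thesis using vo by simp
  next
    case False
    then have HK: "horizon M = 1" "K = 1" and l2: "ln 2 \<le> real (card (states M)) * log_factor M K \<delta>"
      using small_log_factor[OF wf D K \<delta>] by auto
    \<comment> \<open>The degenerate case H = K = 1: each pair has at most one visit and \<beta>
      \<ge> sqrt(ln 2) \<ge> sqrt(1/2), so the right-hand side is at least 1, which no gap between
      values exceeds.\<close>
    have "N h z \<ge> 1 / sqrt 2" for h z
      using visits_le[of K D h z] HK by (auto simp: N_def intro!: divide_left_mono)
    then have "1 / sqrt 2 \<le> expected_total M \<pi>opt N 1 (init_state M)"
      using expected_total_mono[OF wf po h1 s1, of "\<lambda>h z. 1 / sqrt 2" N]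
        expected_total_const[OF wf po h1 s1, of "1 / sqrt 2"] HK by simp
    moreover have "sqrt (1 / 2) \<le> \<beta>"
      using l2 HK ln2_ge_two_thirds by (auto simp: \<beta>_def)
    ultimately have "sqrt (1 / 2) * (1 / sqrt 2) \<le> \<beta> * expected_total M \<pi>opt N 1 (init_state M)"
      by (intro mult_mono) (auto intro: order_trans[rotated])
    then have "1 \<le> 2 * \<beta> * expected_total M \<pi>opt N 1 (init_state M)"
      by (simp add: real_sqrt_divide)
    moreover have "value_fn M \<pi>opt 1 (init_state M) \<le> 1"
      using value_fn_bounds(2)[OF wf po h1 s1] HK by simp
    moreover have "0 \<le> value_fn M (det_policy \<pi>) 1 (init_state M)"
      by (rule value_fn_bounds(1)[OF wf pd h1 s1])
    ultimately show ?thesis using vo by simp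
  qed
  then show ?thesis by (simp add: \<beta>_def N_def)
qed


section \<open>Least squares with a fixed design\<close>

text \<open>The labels of all stages form one product law over \<open>I\<close>, while a regression
  uses only those of one stage, \<open>J\<close>. By independence the moment is a product of
  one-label moments, the factors outside \<open>J\<close> being 1.\<close>

lemma feedback_exp_moment:
  fixes q :: "'i \<Rightarrow> real"
  assumes fin: "finite I" and J: "J \<subseteq> I" and q: "\<And>i. i \<in> I \<Longrightarrow> q i \<in> {0..1}"
  shows "(\<integral>\<^sup>+l. ennreal (exp (\<Sum>i\<in>J. a i * (of_bool (l i) - q i) - (a i)\<^sup>2 / 8))
      \<partial>measure_pmf (Pi_pmf I False (\<lambda>i. bernoulli_pmf (q i)))) \<le> 1"
proof -
  define g where "g = (\<lambda>i b. ennreal (if i \<in> J then exp (a i * (of_bool b - q i) - (a i)\<^sup>2 / 8) else 1))"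
  have eq: "ennreal (exp (\<Sum>i\<in>J. a i * (of_bool (l i) - q i) - (a i)\<^sup>2 / 8)) = (\<Prod>i\<in>I. g i (l i))" for l
  proof -
    have "(\<Prod>i\<in>I. g i (l i)) = (\<Prod>i\<in>J. g i (l i))"
      using fin J by (intro prod.mono_neutral_right) (auto simp: g_def)
    also have "\<dots> = (\<Prod>i\<in>J. ennreal (exp (a i * (of_bool (l i) - q i) - (a i)\<^sup>2 / 8)))"
      by (rule prod.cong) (auto simp: g_def)
    also have "\<dots> = ennreal (exp (\<Sum>i\<in>J. a i * (of_bool (l i) - q i) - (a i)\<^sup>2 / 8))"
      using finite_subset[OF J fin] by (simp add: prod_ennreal exp_sum)
    finally show ?thesis by simp
  qed
  have "(\<integral>\<^sup>+b. g i b \<partial>measure_pmf (bernoulli_pmf (q i))) \<le> 1" if i: "i \<in> I" for i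
  proof (cases "i \<in> J")
    case True
    have P: "measure_pmf.prob (bernoulli_pmf (q i)) {True} = q i"
      using q[OF i] by (simp add: measure_pmf_single)
    have "(\<integral>\<^sup>+b. g i b \<partial>measure_pmf (bernoulli_pmf (q i))) =
      (\<integral>\<^sup>+b. ennreal (exp (- (a i)\<^sup>2 / 8)) * ennreal (exp (a i * (indicator {True} b -
        measure_pmf.prob (bernoulli_pmf (q i)) {True}))) \<partial>measure_pmf (bernoulli_pmf (q i)))"
      unfolding P using True
      by (intro nn_integral_cong) (auto simp: g_def indicator_def simp flip: ennreal_mult exp_add)
    also have "\<dots> \<le> ennreal (exp (- (a i)\<^sup>2 / 8)) * ennreal (exp ((a i)\<^sup>2 / 8))"
      by (subst nn_integral_cmult) (simp, intro mult_left_mono Hoeffding_indicator_pmf, simp)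
    also have "\<dots> = 1" by (simp flip: ennreal_mult exp_add)
    finally show ?thesis .
  qed (simp add: g_def)
  then have "(\<Prod>i\<in>I. \<integral>\<^sup>+b. g i b \<partial>measure_pmf (bernoulli_pmf (q i))) \<le> (\<Prod>i\<in>I. 1)"
    by (intro prod_mono_ennreal)
  then show ?thesis unfolding eq nn_integral_prod_Pi_pmf[OF fin] by simp
qed

text \<open>Here \<phi> is the truth, \<psi> the minimiser and \<open>g\<close> a cover element near
  \<psi>. The noise is tested against \<open>g\<close>, which unlike \<psi> ranges over a finite
  set. With a = 2(g - \<phi>) the noise term is a(y - \<phi>) - a^2/8, the exponent of Hoeffding's
  lemma.\<close>

lemma least_squares_basic_inequality:
  fixes y \<phi> \<psi> g :: "nat \<Rightarrow> real"
  assumes min: "(\<Sum>i<n. (\<psi> i - y i)\<^sup>2) \<le> (\<Sum>i<n. (\<phi> i - y i)\<^sup>2)"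
    and y: "\<And>i. i < n \<Longrightarrow> y i \<in> {0..1}" and \<phi>: "\<And>i. i < n \<Longrightarrow> \<phi> i \<in> {0..1}"
    and \<psi>: "\<And>i. i < n \<Longrightarrow> \<psi> i \<in> {0..1}" and g: "\<And>i. i < n \<Longrightarrow> g i \<in> {0..1}"
    and close: "\<And>i. i < n \<Longrightarrow> \<bar>\<psi> i - g i\<bar> \<le> \<alpha>"
    and noise: "(\<Sum>i<n. 2 * (y i - \<phi> i) * (g i - \<phi> i) - (g i - \<phi> i)\<^sup>2 / 2) \<le> c"
  shows "(\<Sum>i<n. (\<psi> i - \<phi> i)\<^sup>2) \<le> 6 * real n * \<alpha> + 2 * c"
proof -
  have "(\<psi> i - \<phi> i)\<^sup>2 / 2 \<le> ((\<psi> i - y i)\<^sup>2 - (\<phi> i - y i)\<^sup>2) +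
      (2 * (y i - \<phi> i) * (g i - \<phi> i) - (g i - \<phi> i)\<^sup>2 / 2) + 3 * \<alpha>" if i: "i < n" for i
  proof -
    have "\<bar>(y i - \<phi> i) * (\<psi> i - g i)\<bar> \<le> 1 * \<alpha>"
      unfolding abs_mult using y[OF i] \<phi>[OF i] close[OF i] by (intro mult_mono) auto
    then have 1: "(y i - \<phi> i) * (\<psi> i - g i) \<le> \<alpha>" by linarith
    have "\<bar>(g i - \<psi> i) * (g i + \<psi> i - 2 * \<phi> i)\<bar> \<le> \<alpha> * 2"
      unfolding abs_mult using g[OF i] \<psi>[OF i] \<phi>[OF i] close[OF i] by (intro mult_mono) auto
    then have 2: "(g i - \<psi> i) * (g i + \<psi> i - 2 * \<phi> i) \<le> \<alpha> * 2" by linarith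
    \<comment> \<open>Replacing \<psi> by \<open>g\<close> costs 2 \<alpha> in the cross term and
      \<alpha> in the halved quadratic term, whence 3 \<alpha> per index and 6 \<alpha> after
      doubling.\<close>
    have "((\<psi> i - y i)\<^sup>2 - (\<phi> i - y i)\<^sup>2) +
      (2 * (y i - \<phi> i) * (g i - \<phi> i) - (g i - \<phi> i)\<^sup>2 / 2) - (\<psi> i - \<phi> i)\<^sup>2 / 2
      = - 2 * ((y i - \<phi> i) * (\<psi> i - g i)) - (g i - \<psi> i) * (g i + \<psi> i - 2 * \<phi> i) / 2"
      by (simp add: power2_eq_square field_simps)
    then show ?thesis using 1 2 by linarith
  qed
  then have "(\<Sum>i<n. (\<psi> i - \<phi> i)\<^sup>2 / 2) \<le> (\<Sum>i<n. ((\<psi> i - y i)\<^sup>2 - (\<phi> i - y i)\<^sup>2) +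
      (2 * (y i - \<phi> i) * (g i - \<phi> i) - (g i - \<phi> i)\<^sup>2 / 2) + 3 * \<alpha>)"
    by (intro sum_mono) auto
  also have "\<dots> = ((\<Sum>i<n. (\<psi> i - y i)\<^sup>2) - (\<Sum>i<n. (\<phi> i - y i)\<^sup>2)) +
      (\<Sum>i<n. 2 * (y i - \<phi> i) * (g i - \<phi> i) - (g i - \<phi> i)\<^sup>2 / 2) + real n * (3 * \<alpha>)"
    by (simp only: sum.distrib sum_subtractf sum_constant card_lessThan)
  finally show ?thesis using min noise by (simp flip: sum_divide_distrib)
qed

section \<open>Finite covers and the confidence set\<close>

lemma sup_norm_upper:
  assumes "finite X" "z \<in> X"
  shows "\<bar>f z\<bar> \<le> sup_norm X f"
  unfolding sup_norm_def using assms by (intro cSUP_upper) auto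

text \<open>Functions are grouped by their values rounded to a grid of mesh \<alpha>, with a
  representative taken from each group so that the cover stays inside \<open>F\<close>. Without an
  existing cover, the \<open>LEAST\<close> in \<open>covering_number\<close> would be
  meaningless.\<close>

lemma sup_cover_exists:
  fixes F :: "('z \<Rightarrow> real) set"
  assumes "finite X" "X \<noteq> {}" "F \<subseteq> X \<rightarrow> {0..1}" "0 < \<alpha>"
  shows "\<exists>G. sup_cover X F \<alpha> G"
proof -
  define cell where "cell = (\<lambda>f :: 'z \<Rightarrow> real. \<lambda>z\<in>X. \<lfloor>f z / \<alpha>\<rfloor>)"
  define rep where "rep = (\<lambda>u. SOME f. f \<in> F \<and> cell f = u)"
  have rep: "rep (cell f) \<in> F" "cell (rep (cell f)) = cell f" if "f \<in> F" for f
    using someI[of "\<lambda>g. g \<in> F \<and> cell g = cell f" f] that by (auto simp: rep_def)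
  have "cell ` F \<subseteq> X \<rightarrow>\<^sub>E {0..\<lfloor>1 / \<alpha>\<rfloor>}"
  proof
    fix u assume "u \<in> cell ` F"
    then obtain f where f: "f \<in> F" "u = cell f" by auto
    have "\<lfloor>f z / \<alpha>\<rfloor> \<in> {0..\<lfloor>1 / \<alpha>\<rfloor>}" if "z \<in> X" for z
    proof -
      have "f z \<in> {0..1}" using f(1) assms(3) that by blast
      then have "0 \<le> f z / \<alpha>" "f z / \<alpha> \<le> 1 / \<alpha>" using assms(4) by (auto intro: divide_right_mono)
      then show ?thesis by (auto intro: floor_mono)
    qed
    then show "u \<in> X \<rightarrow>\<^sub>E {0..\<lfloor>1 / \<alpha>\<rfloor>}" unfolding f(2) cell_def by auto
  qed
  moreover have "finite (X \<rightarrow>\<^sub>E {0..\<lfloor>1 / \<alpha>\<rfloor>})" using assms(1) by (intro finite_PiE) auto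
  ultimately have fin: "finite (cell ` F)" by (rule finite_subset)
  have "sup_cover X F \<alpha> (rep ` cell ` F)"
    unfolding sup_cover_def
  proof (intro conjI ballI)
    fix f assume f: "f \<in> F"
    have "\<bar>f z - rep (cell f) z\<bar> \<le> \<alpha>" if z: "z \<in> X" for z
    proof -
      have "\<lfloor>f z / \<alpha>\<rfloor> = \<lfloor>rep (cell f) z / \<alpha>\<rfloor>"
        using fun_cong[OF rep(2)[OF f], of z] z by (simp add: cell_def)
      then have "\<bar>f z / \<alpha> - rep (cell f) z / \<alpha>\<bar> \<le> 1" by linarith
      then show ?thesis using assms(4) by (simp add: abs_divide flip: diff_divide_distrib)
    qed
    then have "sup_norm X (\<lambda>z. f z - rep (cell f) z) \<le> \<alpha>"
      unfolding sup_norm_def using assms(2) by (intro cSUP_least) auto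
    then show "\<exists>g\<in>rep ` cell ` F. sup_norm X (\<lambda>z. f z - g z) \<le> \<alpha>" using f by auto
  qed (use fin rep in auto)
  then show ?thesis by blast
qed

lemma covering_number_attained:
  assumes "finite X" "X \<noteq> {}" "F \<subseteq> X \<rightarrow> {0..1}" "0 < \<alpha>"
  obtains G where "sup_cover X F \<alpha> G" "card G = covering_number X F \<alpha>"
proof -
  from sup_cover_exists[OF assms] obtain G where "sup_cover X F \<alpha> G" by blast
  then have "\<exists>G'. sup_cover X F \<alpha> G' \<and> card G' = card G" by blast
  then have "\<exists>G'. sup_cover X F \<alpha> G' \<and> card G' = covering_number X F \<alpha>"
    unfolding covering_number_def by (rule LeastI)
  with that show ?thesis by blast
qed

lemma seq_norm_nth: "(seq_norm f zs)\<^sup>2 = (\<Sum>i<length zs. (f (zs ! i))\<^sup>2)"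
proof -
  have "(\<Sum>z\<leftarrow>zs. (f z)\<^sup>2) = (\<Sum>i<length zs. (f (zs ! i))\<^sup>2)"
    by (simp add: sum_list_sum_nth atLeast0LessThan)
  then show ?thesis by (simp add: seq_norm_def sum_nonneg)
qed

text \<open>The minimiser depends on the labels, so the union runs over a cover of scale 1/n. Its
  discretisation error 6 n \<alpha> is the constant 6 in \<open>R\<close>; the rest of
  \<open>R\<close> is twice the level \<open>c\<close> at which the union bound gives \<delta>. The
  event quantifies over all minimisers, which makes tie-breaking irrelevant.\<close>

lemma least_squares_confidence:
  fixes F :: "('z \<Rightarrow> real) set" and q :: "'h \<times> nat \<Rightarrow> real"
  assumes X: "finite X" "X \<noteq> {}" and F: "F \<subseteq> X \<rightarrow> {0..1}" and fs: "fs \<in> F"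
    and zs: "set zs \<subseteq> X" and n: "1 \<le> length zs" and \<delta>: "0 < \<delta>"
    and I: "finite I" "Pair h ` {..<length zs} \<subseteq> I"
    and q: "\<And>i. i \<in> I \<Longrightarrow> q i \<in> {0..1}" and qfs: "\<And>i. i < length zs \<Longrightarrow> q (h, i) = fs (zs ! i)"
  defines "R \<equiv> 6 + 2 * ln (real (covering_number X F (1 / real (length zs)))) + 2 * ln (1 / \<delta>)"
  shows "measure_pmf.prob (Pi_pmf I False (\<lambda>i. bernoulli_pmf (q i)))
    {l. \<exists>ft. is_arg_min (\<lambda>f. \<Sum>i<length zs. (f (zs ! i) - of_bool (l (h, i)))\<^sup>2) (\<lambda>f. f \<in> F) ft \<and>
      R < (seq_norm (\<lambda>z. ft z - fs z) zs)\<^sup>2} \<le> \<delta>"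
proof -
  define n where "n = length zs"
  define \<alpha> where "\<alpha> = 1 / real n"
  define \<mu> where "\<mu> = Pi_pmf I False (\<lambda>i. bernoulli_pmf (q i))"
  have n1: "1 \<le> n" using n by (simp add: n_def)
  then have \<alpha>: "0 < \<alpha>" by (simp add: \<alpha>_def)
  obtain G where G: "sup_cover X F \<alpha> G" "card G = covering_number X F \<alpha>"
    using covering_number_attained[OF X F \<alpha>] .
  have Gfin: "finite G" "G \<subseteq> F" using G(1) by (auto simp: sup_cover_def)
  have "G \<noteq> {}" using G(1) fs by (auto simp: sup_cover_def)
  then have Gpos: "0 < card G" using Gfin by (simp add: card_gt_0_iff)
  define c where "c = ln (real (card G)) + ln (1 / \<delta>)"
  define W where "W = (\<lambda>g l. \<Sum>i<n. 2 * (of_bool (l (h, i)) - fs (zs ! i)) * (g (zs ! i) - fs (zs ! i))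
      - (g (zs ! i) - fs (zs ! i))\<^sup>2 / 2)"
  have zsX: "zs ! i \<in> X" if "i < n" for i using that zs by (auto simp: n_def)
  have F01: "f (zs ! i) \<in> {0..1}" if "f \<in> F" "i < n" for f i using F that zsX by blast
  have tail: "measure_pmf.prob \<mu> {l. c \<le> W g l} \<le> exp (- c)" for g
  proof (rule exp_moment_tail)
    define a where "a = (\<lambda>i :: 'h \<times> nat. 2 * (g (zs ! snd i) - fs (zs ! snd i)))"
    have "W g l = (\<Sum>i\<in>Pair h ` {..<n}. a i * (of_bool (l i) - q i) - (a i)\<^sup>2 / 8)" for l
      unfolding W_def using qfs
      by (subst sum.reindex) (auto simp: inj_on_def a_def n_def power2_eq_square field_simps intro!: sum.cong)
    then show "(\<integral>\<^sup>+l. ennreal (exp (W g l)) \<partial>measure_pmf \<mu>) \<le> 1"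
      unfolding \<mu>_def using feedback_exp_moment[OF I(1) _ q, where J = "Pair h ` {..<n}" and a = a] I(2)
      by (simp add: n_def)
  qed
  have "{l. \<exists>ft. is_arg_min (\<lambda>f. \<Sum>i<length zs. (f (zs ! i) - of_bool (l (h, i)))\<^sup>2) (\<lambda>f. f \<in> F) ft \<and>
      R < (seq_norm (\<lambda>z. ft z - fs z) zs)\<^sup>2} \<subseteq> (\<Union>g\<in>G. {l. c \<le> W g l})"
  proof
    fix l assume "l \<in> {l. \<exists>ft. is_arg_min (\<lambda>f. \<Sum>i<length zs. (f (zs ! i) - of_bool (l (h, i)))\<^sup>2) (\<lambda>f. f \<in> F) ft \<and>
      R < (seq_norm (\<lambda>z. ft z - fs z) zs)\<^sup>2}"
    then obtain ft where ft: "is_arg_min (\<lambda>f. \<Sum>i<n. (f (zs ! i) - of_bool (l (h, i)))\<^sup>2) (\<lambda>f. f \<in> F) ft"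
      and gt: "R < (seq_norm (\<lambda>z. ft z - fs z) zs)\<^sup>2" by (auto simp: n_def)
    have ftF: "ft \<in> F" and min: "(\<Sum>i<n. (ft (zs ! i) - of_bool (l (h, i)))\<^sup>2) \<le>
      (\<Sum>i<n. (fs (zs ! i) - of_bool (l (h, i)))\<^sup>2)"
      using ft fs by (auto simp: is_arg_min_linorder)
    obtain g where g: "g \<in> G" "sup_norm X (\<lambda>z. ft z - g z) \<le> \<alpha>"
      using G(1) ftF by (auto simp: sup_cover_def)
    have "c \<le> W g l"
    proof (rule ccontr)
      assume "\<not> c \<le> W g l"
      then have "W g l \<le> c" by simp
      then have "(\<Sum>i<n. (ft (zs ! i) - fs (zs ! i))\<^sup>2) \<le> 6 * real n * \<alpha> + 2 * c"
        using sup_norm_upper[OF X(1), of _ "\<lambda>z. ft z - g z"] g(2) zsX Gfin(2) g(1) ftF fs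
        by (intro least_squares_basic_inequality[OF min, where g = "\<lambda>i. g (zs ! i)"])
           (auto simp: W_def intro!: F01[THEN atLeastAtMost_iff[THEN iffD1, THEN conjunct1]]
              F01[THEN atLeastAtMost_iff[THEN iffD1, THEN conjunct2]] intro: order_trans)
      also have "\<dots> = R" using n G(2) by (auto simp: R_def c_def \<alpha>_def n_def)
      finally show False using gt by (simp add: seq_norm_nth n_def)
    qed
    then show "l \<in> (\<Union>g\<in>G. {l. c \<le> W g l})" using g(1) by blast
  qed
  then have "measure_pmf.prob \<mu> {l. \<exists>ft. is_arg_min (\<lambda>f. \<Sum>i<length zs. (f (zs ! i) - of_bool (l (h, i)))\<^sup>2) (\<lambda>f. f \<in> F) ft \<and>
      R < (seq_norm (\<lambda>z. ft z - fs z) zs)\<^sup>2} \<le> measure_pmf.prob \<mu> (\<Union>g\<in>G. {l. c \<le> W g l})"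
    by (intro measure_pmf.finite_measure_mono) auto
  also have "\<dots> \<le> (\<Sum>g\<in>G. measure_pmf.prob \<mu> {l. c \<le> W g l})"
    using Gfin by (intro measure_pmf.finite_measure_subadditive_finite) auto
  also have "\<dots> \<le> (\<Sum>g\<in>G. exp (- c))" by (intro sum_mono tail)
  also have "\<dots> = \<delta>"
    using Gpos \<delta> by (simp add: c_def exp_minus exp_add exp_diff ln_div)
  finally show ?thesis by (simp add: \<mu>_def)
qed


section \<open>Widths along greedy queries\<close>

text \<open>
  Greedy packing of a sequence into \<open>m\<close> bins, each an \<open>\<epsilon>\<close>-independent sequence. An element that
  fits into no bin would see the squared norm \<open>\<epsilon>\<^sup>2\<close> in each of the \<open>m\<close> bins, hence more
  than \<open>\<beta>\<^sup>2\<close> in total.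
\<close>
lemma independent_bins:
  fixes zs :: "'z list" and m :: nat
  assumes \<epsilon>: "0 < \<epsilon>" and m: "\<beta>\<^sup>2 < real m * \<epsilon>\<^sup>2" and \<beta>: "0 \<le> \<beta>"
    and wide: "\<And>k. k < length zs \<Longrightarrow> \<exists>f\<in>F. \<exists>f'\<in>F. seq_norm (\<lambda>x. f x - f' x) (take k zs) \<le> \<beta> \<and>
      \<epsilon> < \<bar>f (zs ! k) - f' (zs ! k)\<bar>"
  shows "k \<le> length zs \<Longrightarrow> \<exists>bs :: nat \<Rightarrow> 'z list. (\<Sum>j<m. length (bs j)) = k \<and>
    (\<forall>j<m. set (bs j) \<subseteq> set zs \<and> (\<forall>i<length (bs j). \<not> eps_dependent F \<epsilon> (bs j ! i) (take i (bs j)))) \<and>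
    (\<forall>g :: 'z \<Rightarrow> real. (\<Sum>j<m. \<Sum>z\<leftarrow>bs j. g z) = (\<Sum>z\<leftarrow>take k zs. g z))"
proof (induction k)
  case 0
  show ?case by (rule exI[of _ "\<lambda>_. []"]) simp
next
  case (Suc k)
  then obtain bs :: "nat \<Rightarrow> 'z list" where len: "(\<Sum>j<m. length (bs j)) = k"
    and ind: "\<And>j. j < m \<Longrightarrow> set (bs j) \<subseteq> set zs \<and>
      (\<forall>i<length (bs j). \<not> eps_dependent F \<epsilon> (bs j ! i) (take i (bs j)))"
    and tot: "\<And>g :: 'z \<Rightarrow> real. (\<Sum>j<m. \<Sum>z\<leftarrow>bs j. g z) = (\<Sum>z\<leftarrow>take k zs. g z)"
    by auto
  have k: "k < length zs" using Suc.prems by simp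
  define x where "x = zs ! k"
  have "\<exists>j<m. \<not> eps_dependent F \<epsilon> x (bs j)"
  proof (rule ccontr)
    assume "\<not> (\<exists>j<m. \<not> eps_dependent F \<epsilon> x (bs j))"
    then have dep: "eps_dependent F \<epsilon> x (bs j)" if "j < m" for j using that by blast
    obtain f f' where f: "f \<in> F" "f' \<in> F" and le: "seq_norm (\<lambda>x. f x - f' x) (take k zs) \<le> \<beta>"
      and gt: "\<epsilon> < \<bar>f x - f' x\<bar>"
      using wide[OF k] by (auto simp: x_def)
    have "\<epsilon>\<^sup>2 \<le> (\<Sum>z\<leftarrow>bs j. (f z - f' z)\<^sup>2)" if "j < m" for j
    proof -
      have "\<epsilon> < sqrt (\<Sum>z\<leftarrow>bs j. (f z - f' z)\<^sup>2)"
        using dep[OF that] f gt unfolding eps_dependent_def seq_norm_def by force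
      then have "sqrt (\<epsilon>\<^sup>2) < sqrt (\<Sum>z\<leftarrow>bs j. (f z - f' z)\<^sup>2)" using \<epsilon> by simp
      then show ?thesis by (simp only: real_sqrt_less_iff less_imp_le)
    qed
    then have "(\<Sum>j<m. \<epsilon>\<^sup>2) \<le> (\<Sum>j<m. \<Sum>z\<leftarrow>bs j. (f z - f' z)\<^sup>2)" by (intro sum_mono) auto
    then have "real m * \<epsilon>\<^sup>2 \<le> (\<Sum>z\<leftarrow>take k zs. (f z - f' z)\<^sup>2)" by (simp add: tot)
    also have "\<dots> \<le> \<beta>\<^sup>2" using le unfolding seq_norm_def by (rule sqrt_le_D)
    finally show False using m by simp
  qed
  then obtain j\<^sub>0 where j0: "j\<^sub>0 < m" "\<not> eps_dependent F \<epsilon> x (bs j\<^sub>0)" by blast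
  define bs' where "bs' = bs(j\<^sub>0 := bs j\<^sub>0 @ [x])"
  \<comment> \<open>Stated for any additive functional of lists: it serves the total length as well
    as the sums of all \<open>g\<close>, which say that the bins together hold the prefix with
    multiplicity.\<close>
  have upd: "(\<Sum>j<m. \<phi> (bs' j)) = (\<Sum>j<m. \<phi> (bs j)) + \<phi> [x]"
    if add: "\<And>us vs. \<phi> (us @ vs) = \<phi> us + \<phi> vs" for \<phi> :: "'z list \<Rightarrow> 'c :: comm_monoid_add"
  proof -
    have "(\<Sum>j<m. \<phi> (bs' j)) = (\<Sum>j<m. \<phi> (bs j) + (if j = j\<^sub>0 then \<phi> [x] else 0))"
      by (rule sum.cong) (auto simp: bs'_def add)
    then show ?thesis using j0(1) by (simp add: sum.distrib)
  qed
  show ?case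
  proof (intro exI[of _ bs'] conjI allI impI)
    show "(\<Sum>j<m. length (bs' j)) = Suc k" using upd[of length] len by simp
    show "(\<Sum>j<m. \<Sum>z\<leftarrow>bs' j. g z) = (\<Sum>z\<leftarrow>take (Suc k) zs. g z)" for g :: "'z \<Rightarrow> real"
      using upd[of "\<lambda>us. \<Sum>z\<leftarrow>us. g z"] tot[of g] k by (simp add: take_Suc_conv_app_nth x_def)
    show "set (bs' j) \<subseteq> set zs" if "j < m" for j
      using ind[OF that] k by (auto simp: bs'_def x_def)
    show "\<not> eps_dependent F \<epsilon> (bs' j ! i) (take i (bs' j))" if "j < m" "i < length (bs' j)" for j i
      using ind[OF that(1)] that(2) j0(2)
      by (cases "i < length (bs j)") (auto simp: bs'_def nth_append split: if_splits simp: less_Suc_eq)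
  qed
qed

text \<open>\<open>m\<close> is the least number of bins with m \<epsilon>^2 > \<beta>^2, and each
  bin is a witness sequence for the eluder dimension at scale \<epsilon>, so it has at most
  \<open>E\<close> elements.\<close>

lemma wide_sequence_length:
  fixes zs :: "'z list" and E :: real
  assumes \<epsilon>: "0 < \<epsilon>" and \<beta>: "0 \<le> \<beta>" and zs: "set zs \<subseteq> X"
    and wide: "\<And>k. k < length zs \<Longrightarrow> \<exists>f\<in>F. \<exists>f'\<in>F. seq_norm (\<lambda>x. f x - f' x) (take k zs) \<le> \<beta> \<and>
      \<epsilon> < \<bar>f (zs ! k) - f' (zs ! k)\<bar>"
    and E: "ereal_of_enat (eluder_dim_at X F \<epsilon>) \<le> ereal E"
  shows "real (length zs) \<le> (\<beta>\<^sup>2 / \<epsilon>\<^sup>2 + 1) * E"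
proof -
  define m where "m = Suc (nat \<lfloor>\<beta>\<^sup>2 / \<epsilon>\<^sup>2\<rfloor>)"
  have "0 \<le> \<beta>\<^sup>2 / \<epsilon>\<^sup>2" by simp
  then have m1: "real m \<le> \<beta>\<^sup>2 / \<epsilon>\<^sup>2 + 1" and "\<beta>\<^sup>2 / \<epsilon>\<^sup>2 < real m"
    unfolding m_def by linarith+
  then have m2: "\<beta>\<^sup>2 < real m * \<epsilon>\<^sup>2" using \<epsilon> by (simp add: divide_less_eq)
  obtain bs :: "nat \<Rightarrow> 'z list" where len: "(\<Sum>j<m. length (bs j)) = length zs"
    and ind: "\<And>j. j < m \<Longrightarrow> set (bs j) \<subseteq> set zs \<and>
      (\<forall>i<length (bs j). \<not> eps_dependent F \<epsilon> (bs j ! i) (take i (bs j)))"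
    using independent_bins[OF \<epsilon> m2 \<beta> wide, of "length zs"] by auto
  have bin: "real (length (bs j)) \<le> E" if "j < m" for j
  proof -
    have "enat (length (bs j)) \<le> eluder_dim_at X F \<epsilon>"
      unfolding eluder_dim_at_def using ind[OF that] zs by (intro SUP_upper) auto
    then have "ereal_of_enat (enat (length (bs j))) \<le> ereal_of_enat (eluder_dim_at X F \<epsilon>)"
      by (simp only: ereal_of_enat_le_iff)
    also note E
    finally show ?thesis by simp
  qed
  have "0 \<le> ereal_of_enat (eluder_dim_at X F \<epsilon>)" by simp
  also note E
  finally have E0: "0 \<le> E" by simp
  have "real (length zs) = (\<Sum>j<m. real (length (bs j)))" using len by (simp flip: of_nat_sum)
  also have "\<dots> \<le> (\<Sum>j<m. E)" using bin by (intro sum_mono) auto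
  also have "\<dots> \<le> (\<beta>\<^sup>2 / \<epsilon>\<^sup>2 + 1) * E" using m1 E0 by (simp add: mult_right_mono)
  finally show ?thesis .
qed

lemma seq_norm_take_le: "seq_norm f (take k zs) \<le> seq_norm f zs"
proof -
  have "(\<Sum>z\<leftarrow>zs. (f z)\<^sup>2) = (\<Sum>z\<leftarrow>take k zs. (f z)\<^sup>2) + (\<Sum>z\<leftarrow>drop k zs. (f z)\<^sup>2)"
    by (simp flip: sum_list_append map_append)
  moreover have "0 \<le> (\<Sum>z\<leftarrow>drop k zs. (f z)\<^sup>2)" by (intro sum_list_nonneg) auto
  ultimately show ?thesis unfolding seq_norm_def by simp
qed

text \<open>Norms over prefixes are smaller, so a pair \<open>f\<close>, \<open>f'\<close> that
  still separates \<open>z\<close> by more than \<epsilon> at the end was admissible at every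
  earlier step. Each greedy choice was at least as wide as \<open>z\<close>, and the sequence would
  exceed the packing bound.\<close>

lemma final_width_small:
  fixes zs :: "'z list" and E :: real
  assumes \<epsilon>: "0 < \<epsilon>" and \<beta>: "0 \<le> \<beta>" and Z: "Z \<subseteq> X" and F: "F \<subseteq> X \<rightarrow> {0..1}"
    and greedy: "\<And>k. k < length zs \<Longrightarrow> is_arg_max (width F \<beta> (take k zs)) (\<lambda>z. z \<in> Z) (zs ! k)"
    and E: "ereal_of_enat (eluder_dim_at X F \<epsilon>) \<le> ereal E"
    and len: "(\<beta>\<^sup>2 / \<epsilon>\<^sup>2 + 1) * E < real (length zs)"
    and z: "z \<in> Z" and f: "f \<in> F" "f' \<in> F" and le: "seq_norm (\<lambda>x. f x - f' x) zs \<le> \<beta>"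
  shows "\<bar>f z - f' z\<bar> \<le> \<epsilon>"
proof (rule ccontr)
  assume gt: "\<not> \<bar>f z - f' z\<bar> \<le> \<epsilon>"
  have zsZ: "zs ! k \<in> Z" and max: "\<And>y. y \<in> Z \<Longrightarrow> width F \<beta> (take k zs) y \<le> width F \<beta> (take k zs) (zs ! k)"
    if "k < length zs" for k
    using greedy[OF that] by (auto simp: is_arg_max_linorder)
  have "set zs \<subseteq> X" by (auto simp: in_set_conv_nth intro!: subsetD[OF Z] zsZ)
  moreover have "\<exists>f\<in>F. \<exists>f'\<in>F. seq_norm (\<lambda>x. f x - f' x) (take k zs) \<le> \<beta> \<and> \<epsilon> < \<bar>f (zs ! k) - f' (zs ! k)\<bar>"
    if k: "k < length zs" for k
  proof -
    define P where "P = {(f, f'). f \<in> F \<and> f' \<in> F \<and> seq_norm (\<lambda>x. f x - f' x) (take k zs) \<le> \<beta>}"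
    have P: "(f, f') \<in> P" using f le seq_norm_take_le[of "\<lambda>x. f x - f' x" k zs] by (auto simp: P_def)
    \<comment> \<open>A supremum of reals bounds its members only if the set is bounded; here
      differences of values in [0, 1] are at most 1.\<close>
    have bdd: "bdd_above ((\<lambda>(f, f'). \<bar>f y - f' y\<bar>) ` P)" if "y \<in> Z" for y
    proof (rule bdd_aboveI2)
      fix p assume "p \<in> P"
      then obtain g g' where p: "p = (g, g')" "g \<in> F" "g' \<in> F" by (auto simp: P_def)
      then have "g y \<in> {0..1}" "g' y \<in> {0..1}" using F Z that by blast+
      then show "(case p of (f, f') \<Rightarrow> \<bar>f y - f' y\<bar>) \<le> 1" by (auto simp: p)
    qed
    have "\<epsilon> < \<bar>f z - f' z\<bar>" using gt by simp
    also have "\<dots> \<le> width F \<beta> (take k zs) z"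
      unfolding width_def P_def[symmetric] using cSUP_upper[OF P bdd[OF z]] by simp
    also have "\<dots> \<le> width F \<beta> (take k zs) (zs ! k)" by (rule max[OF k z])
    finally have "\<epsilon> < (SUP (f, f')\<in>P. \<bar>f (zs ! k) - f' (zs ! k)\<bar>)"
      unfolding width_def P_def .
    moreover have "P \<noteq> {}" using P by blast
    ultimately obtain p where "p \<in> P" "\<epsilon> < (case p of (f, f') \<Rightarrow> \<bar>f (zs ! k) - f' (zs ! k)\<bar>)"
      using less_cSUP_iff[OF _ bdd[OF zsZ[OF k]]] by blast
    then show ?thesis by (auto simp: P_def)
  qed
  ultimately have "real (length zs) \<le> (\<beta>\<^sup>2 / \<epsilon>\<^sup>2 + 1) * E"
    by (rule wide_sequence_length[OF \<epsilon> \<beta> _ _ E])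
  with len show False by simp
qed


section \<open>The number of queries\<close>

lemma nat_ceiling_bounds:
  fixes x :: real
  assumes "0 \<le> x"
  shows "x \<le> real (nat \<lceil>x\<rceil>)" "real (nat \<lceil>x\<rceil>) \<le> x + 1"
  using assms by linarith+

text \<open>Resolves the self-reference in the choice of \<open>C\<^sub>1\<close>, whose logarithm
  reappears in the bound it must exceed. The witness is a square s^2, because ln(2 s^2) \<le> 2s
  makes the left side linear in s.\<close>

lemma exceeds_affine_ln:
  fixes a b m :: real
  assumes "0 \<le> a" "0 \<le> b" "0 \<le> m"
  shows "\<exists>x\<ge>m. 1 \<le> x \<and> a + b * ln (2 * x) < x"
proof -
  define s where "s = a + 2 * b + m + 1"
  have s: "1 \<le> s" "m \<le> s" using assms by (auto simp: s_def)
  have ss: "s \<le> s\<^sup>2" using s by (simp add: power2_eq_square)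
  have "ln (2 * s\<^sup>2) = ln 2 + 2 * ln s" using s by (simp add: ln_mult ln_realpow)
  also have "\<dots> \<le> 2 * s" using ln_le_minus_one[of s] ln_le_minus_one[of 2] s by simp
  finally have "a + b * ln (2 * s\<^sup>2) \<le> a * s + b * (2 * s)"
    using assms s by (intro add_mono mult_left_mono) (auto simp: mult_le_cancel_left1)
  also have "\<dots> = (a + 2 * b) * s" by (simp add: algebra_simps)
  also have "\<dots> < s * s" using s assms by (intro mult_strict_right_mono) (auto simp: s_def)
  finally show ?thesis using s ss by (intro exI[of _ "s\<^sup>2"]) (auto simp flip: power2_eq_square)
qed

text \<open>The lower bounds 1/c on d and |ln d| make every scale at least a constant, so that
  lower-order terms can be absorbed. The summand I/d in the last bound is harmless: it will be
  multiplied by d^2, and d I is part of \<open>y\<close>.\<close>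

lemma query_scale_bounds:
  fixes c d \<Delta> I :: real
  defines "l \<equiv> ln (1 / \<Delta>)" and "w \<equiv> (ln d)\<^sup>2" and "y \<equiv> d\<^sup>2 + d * I"
  assumes c: "0 < c" and d: "1 / c \<le> d" "1 / c \<le> \<bar>ln d\<bar>" and \<Delta>: "0 < \<Delta>" "\<Delta> < 1 / 2" and I: "1 / 2 \<le> I"
  shows "1 / 2 \<le> l" "1 \<le> c\<^sup>2 * w" "0 < d" "0 < y" "1 \<le> c ^ 4 * (l\<^sup>2 * w * y / \<Delta>\<^sup>2)" "ln (2 / \<Delta>) \<le> 2 * l"
    and "ln (l\<^sup>2 * w * y / \<Delta>\<^sup>2) \<le> 4 * l + (2 * c + 1) * w + I / d"
proof -
  have ln2: "1 / 2 \<le> ln (2 :: real)" using ln2_ge_two_thirds by simp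
  have "2 \<le> 1 / \<Delta>" using \<Delta> by (simp add: field_simps)
  then have l2: "ln 2 \<le> l" unfolding l_def by (intro ln_mono) auto
  then show l: "1 / 2 \<le> l" using ln2 by linarith
  have c1: "1 \<le> c * \<bar>ln d\<bar>" using d(2) c by (simp add: field_simps)
  then have "1\<^sup>2 \<le> (c * \<bar>ln d\<bar>)\<^sup>2" by (intro power_mono) auto
  then show w: "1 \<le> c\<^sup>2 * w" by (simp add: w_def power_mult_distrib)
  have "0 < 1 / c" using c by simp
  then show d0: "0 < d" using d(1) by linarith
  have cd: "1 \<le> c * d" using d(1) c by (simp add: field_simps)
  then have "1\<^sup>2 \<le> (c * d)\<^sup>2" by (intro power_mono) auto
  then have cd2: "1 \<le> c\<^sup>2 * d\<^sup>2" by (simp add: power_mult_distrib)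
  show y0: "0 < y" using d0 I by (auto simp: y_def intro!: add_pos_nonneg)
  have "c\<^sup>2 * d\<^sup>2 \<le> c\<^sup>2 * y" using d0 I by (intro mult_left_mono) (auto simp: y_def)
  then have cy: "1 \<le> c\<^sup>2 * y" using cd2 by linarith
  have w0: "0 < w" using w c by (metis mult_zero_right not_one_le_zero w_def zero_less_power2 power_zero_numeral)
  have "\<Delta>\<^sup>2 \<le> (1 / 2)\<^sup>2" using \<Delta> by (intro power_mono) auto
  also have "\<dots> \<le> l\<^sup>2" using l by (intro power_mono) auto
  finally have "1 \<le> l\<^sup>2 / \<Delta>\<^sup>2" using \<Delta> by simp
  then have "1 * 1 * 1 \<le> (c\<^sup>2 * w) * (c\<^sup>2 * y) * (l\<^sup>2 / \<Delta>\<^sup>2)"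
    using w cy w0 y0 by (intro mult_mono) auto
  then show "1 \<le> c ^ 4 * (l\<^sup>2 * w * y / \<Delta>\<^sup>2)" by (simp add: power4_eq_xxxx power2_eq_square mult_ac)
  have "ln (2 / \<Delta>) = ln 2 + l" using \<Delta> by (simp add: l_def ln_div)
  then show "ln (2 / \<Delta>) \<le> 2 * l" using l2 by simp
  \<comment> \<open>Factoring out d^2 separates the confidence level from ln d, which is at most c
    (ln d)^2 because c |ln d| \<ge> 1.\<close>
  have "y = d\<^sup>2 * (1 + I / d)" using d0 by (simp add: y_def field_simps power2_eq_square)
  moreover have "0 < 1 + I / d" using d0 I by (intro add_pos_nonneg) auto
  ultimately have "ln y = 2 * ln d + ln (1 + I / d)" using d0 by (simp add: ln_mult ln_realpow)
  also have "\<dots> \<le> 2 * (c * w) + I / d"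
  proof (intro add_mono mult_left_mono)
    have "ln d \<le> \<bar>ln d\<bar> * 1" by simp
    also have "\<dots> \<le> \<bar>ln d\<bar> * (c * \<bar>ln d\<bar>)" using c1 by (intro mult_left_mono) auto
    finally show "ln d \<le> c * w" by (simp add: w_def power2_eq_square mult_ac abs_mult_self_eq)
    show "ln (1 + I / d) \<le> I / d" using d0 I by (intro ln_add_one_self_le_self) auto
  qed auto
  finally have lny: "ln y \<le> 2 * (c * w) + I / d" .
  have lnD: "ln \<Delta> = - l" using \<Delta> by (simp add: l_def ln_div)
  have "ln (l\<^sup>2 * w * y / \<Delta>\<^sup>2) = 2 * ln l + ln w + ln y + 2 * l"
    using l w0 y0 \<Delta> lnD by (simp add: ln_div ln_mult ln_realpow)
  moreover have "ln l \<le> l" "ln w \<le> w" using ln_le_minus_one[of l] ln_le_minus_one[of w] l w0 by auto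
  ultimately show "ln (l\<^sup>2 * w * y / \<Delta>\<^sup>2) \<le> 4 * l + (2 * c + 1) * w + I / d"
    using lny by (simp add: algebra_simps)
qed

text \<open>Writing \<open>T\<close> for the prescribed budget without its constant, the packing
  requirement is at most T (a + b ln(2 \<open>C\<^sub>1\<close>)), so it suffices that
  \<open>C\<^sub>1\<close> exceeds this affine function of its own logarithm. The two last
  properties of \<beta> are those needed for confidence and for small widths.\<close>

lemma query_budget_sufficient:
  fixes c :: real
  assumes c: "0 < c"
  shows "\<exists>C\<^sub>1>0. \<exists>C\<^sub>2>0. \<forall>d \<Delta> \<delta>. 1 / c \<le> d \<and> 1 / c \<le> \<bar>ln d\<bar> \<and> 0 < \<Delta> \<and> \<Delta> < 1 / 2 \<and> 0 < \<delta> \<and> \<delta> \<le> 1 / 2 \<longrightarrow>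
    (let N = num_queries (C\<^sub>1 * (ln (1 / \<Delta>))\<^sup>2) d \<Delta> \<delta>; \<beta> = conf_radius C\<^sub>2 d \<delta> N in
      2 \<le> N \<and>
      real N \<le> 2 * C\<^sub>1 * ((ln (1 / \<Delta>))\<^sup>2 * (ln d)\<^sup>2 * (d\<^sup>2 + d * ln (1 / \<delta>)) / \<Delta>\<^sup>2) \<and>
      6 + 2 * (c * d * ln (real N)) + 2 * ln (1 / \<delta>) \<le> \<beta>\<^sup>2 \<and> 0 \<le> \<beta> \<and>
      (\<beta>\<^sup>2 / (\<Delta> / 2)\<^sup>2 + 1) * (c * d * ln (2 / \<Delta>)) < real N)"
proof -
  \<comment> \<open>As I \<ge> 1/2, 6 + 2 I \<le> 14 I; the summand 2c covers the logarithm of the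
    covering number.\<close>
  define \<kappa> where "\<kappa> = 2 * c + 14"
  have \<kappa>: "0 < \<kappa>" using c by (simp add: \<kappa>_def)
  \<comment> \<open>Up to the common factor \<open>T\<close>, these collect the coefficient of
    \<rho> = ln(2 \<open>C\<^sub>1\<close>) and all remaining terms.\<close>
  define b where "b = 2 * c * (4 * \<kappa>) * (2 * c\<^sup>2)"
  define a where "a = 2 * c * ((4 * \<kappa> + 2) * (2 * c\<^sup>2) + 4 * \<kappa> * (2 * c\<^sup>2 + 4 * c\<^sup>2 + 2 * (2 * c + 1)))"
  have ab: "0 \<le> a" "0 \<le> b" using c \<kappa> by (auto simp: a_def b_def intro!: mult_nonneg_nonneg add_nonneg_nonneg)
  \<comment> \<open>At least 2 c^4 makes \<open>C\<^sub>1 * T\<close> at least 2, so N \<ge> 2 and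
    rounding up costs at most a factor 2.\<close>
  obtain C\<^sub>1 where C1: "2 * c ^ 4 \<le> C\<^sub>1" "1 \<le> C\<^sub>1" "a + b * ln (2 * C\<^sub>1) < C\<^sub>1"
    using exceeds_affine_ln[OF ab, of "2 * c ^ 4"] c by auto
  define C\<^sub>2 where "C\<^sub>2 = sqrt \<kappa>"
  have C12: "0 < C\<^sub>1" "0 < C\<^sub>2" using C1 \<kappa> by (auto simp: C\<^sub>2_def)
  show ?thesis
  proof (rule exI[of _ C\<^sub>1], rule conjI[OF C12(1)], rule exI[of _ C\<^sub>2], rule conjI[OF C12(2)], intro allI impI)
    fix d \<Delta> \<delta> :: real
    assume "1 / c \<le> d \<and> 1 / c \<le> \<bar>ln d\<bar> \<and> 0 < \<Delta> \<and> \<Delta> < 1 / 2 \<and> 0 < \<delta> \<and> \<delta> \<le> 1 / 2"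
    then have d: "1 / c \<le> d" "1 / c \<le> \<bar>ln d\<bar>" and \<Delta>: "0 < \<Delta>" "\<Delta> < 1 / 2" and \<delta>: "0 < \<delta>" "\<delta> \<le> 1 / 2"
      by auto
    define l where "l = ln (1 / \<Delta>)"
    define w where "w = (ln d)\<^sup>2"
    define I where "I = ln (1 / \<delta>)"
    define y where "y = d\<^sup>2 + d * I"
    define T where "T = l\<^sup>2 * w * y / \<Delta>\<^sup>2"
    define N where "N = num_queries (C\<^sub>1 * (ln (1 / \<Delta>))\<^sup>2) d \<Delta> \<delta>"
    define \<beta> where "\<beta> = conf_radius C\<^sub>2 d \<delta> N"
    have "2 \<le> 1 / \<delta>" using \<delta> by (simp add: field_simps)
    then have "ln 2 \<le> I" unfolding I_def by (intro ln_mono) auto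
    then have I: "1 / 2 \<le> I" using ln2_ge_two_thirds by simp
    note B = query_scale_bounds[OF c d \<Delta> I, folded l_def w_def y_def, folded T_def]
    have w0: "0 \<le> w" by (simp add: w_def)
    have "C\<^sub>1 * l\<^sup>2 * (y * w) / \<Delta>\<^sup>2 = C\<^sub>1 * T" by (simp add: T_def mult_ac)
    then have N: "N = nat \<lceil>C\<^sub>1 * T\<rceil>"
      unfolding N_def num_queries_def l_def[symmetric] w_def[symmetric] I_def[symmetric] y_def[symmetric]
      by (simp add: mult_ac)
    have c4: "0 < c ^ 4" using c by simp
    have T0: "0 < T" using B(5) c4 by (metis linorder_not_le mult_nonneg_nonpos not_one_le_zero order.trans less_imp_le)
    have "2 * (c ^ 4 * T) \<le> C\<^sub>1 * T" using C1(1) T0 mult_right_mono[OF C1(1), of T] by simp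
    then have CT: "2 \<le> C\<^sub>1 * T" using B(5) by linarith
    have N1: "C\<^sub>1 * T \<le> real N" "real N \<le> C\<^sub>1 * T + 1"
      unfolding N using CT by (intro nat_ceiling_bounds; simp)+
    have N2: "2 \<le> N" using N1 CT by linarith
    have N3: "real N \<le> 2 * C\<^sub>1 * T" using N1 CT by linarith
    have lnN0: "0 \<le> ln (real N)" using N2 by simp
    have sq0: "0 \<le> I + ln (real N) * d" using I lnN0 B(3) by simp
    have \<beta>2: "\<beta>\<^sup>2 = \<kappa> * (I + ln (real N) * d)"
      using sq0 \<kappa> by (simp add: \<beta>_def conf_radius_def C\<^sub>2_def I_def power_mult_distrib)
    have \<beta>0: "0 \<le> \<beta>"
      using sq0 \<kappa> by (simp add: \<beta>_def conf_radius_def C\<^sub>2_def I_def)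
    have r3: "6 + 2 * (c * d * ln (real N)) + 2 * I \<le> \<beta>\<^sup>2"
    proof -
      have "0 \<le> c * I" "0 \<le> ln (real N) * d" using c I lnN0 B(3) by auto
      moreover have "\<beta>\<^sup>2 = 2 * (c * I) + 14 * I + 2 * (c * d * ln (real N)) + 14 * (ln (real N) * d)"
        unfolding \<beta>2 \<kappa>_def by (simp add: algebra_simps)
      ultimately show ?thesis using I by linarith
    qed
    have "ln (real N) \<le> ln (2 * C\<^sub>1 * T)" using N2 N3 by (intro ln_mono) auto
    also have "\<dots> = ln (2 * C\<^sub>1) + ln T" using C1 T0 by (simp add: ln_mult)
    also have "\<dots> \<le> ln (2 * C\<^sub>1) + 4 * l + (2 * c + 1) * w + I / d" using B(7) by simp
    finally have lnN: "ln (real N) \<le> ln (2 * C\<^sub>1) + 4 * l + (2 * c + 1) * w + I / d" .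
    define \<rho> where "\<rho> = ln (2 * C\<^sub>1)"
    have \<rho>0: "0 \<le> \<rho>" using C1 by (simp add: \<rho>_def)
    have l0: "0 \<le> l" and l1: "1 \<le> 2 * l" using B(1) by auto
    have u1: "w \<le> 2 * (l * w)" using mult_right_mono[OF l1 w0] by simp
    have u2: "l \<le> c\<^sup>2 * (l * w)" using mult_left_mono[OF B(2) l0] by (simp add: mult_ac)
    have u3: "1 \<le> 2 * c\<^sup>2 * (l * w)" using l1 u2 by linarith
    have dI: "0 \<le> d * I" using B(3) I by simp
    have "d\<^sup>2 * ln (real N) \<le> d\<^sup>2 * (\<rho> + 4 * l + (2 * c + 1) * w + I / d)"
      using lnN by (intro mult_left_mono) (auto simp: \<rho>_def)
    also have "\<dots> = d\<^sup>2 * (\<rho> + 4 * l + (2 * c + 1) * w) + d * I"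
      using B(3) by (simp add: field_simps power2_eq_square)
    also have "\<dots> \<le> y * (\<rho> + 4 * l + (2 * c + 1) * w) + y * 1"
      using dI \<rho>0 l0 w0 c by (intro add_mono mult_right_mono) (auto simp: y_def)
    also have "\<dots> = y * (1 * (\<rho> + 1) + 4 * l + (2 * c + 1) * w)" by (simp add: algebra_simps)
    also have "\<dots> \<le> y * (2 * c\<^sup>2 * (l * w) * (\<rho> + 1) + 4 * (c\<^sup>2 * (l * w)) + (2 * c + 1) * (2 * (l * w)))"
      using u1 u2 u3 B(4) \<rho>0 c by (intro mult_left_mono add_mono mult_right_mono) auto
    also have "\<dots> = l * w * y * (2 * c\<^sup>2 * (\<rho> + 1) + 4 * c\<^sup>2 + 2 * (2 * c + 1))" by (simp add: algebra_simps)
    finally have v1: "d\<^sup>2 * ln (real N) \<le> l * w * y * (2 * c\<^sup>2 * (\<rho> + 1) + 4 * c\<^sup>2 + 2 * (2 * c + 1))" .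
    have "d * I \<le> y * 1" by (simp add: y_def)
    also have "\<dots> \<le> y * (2 * c\<^sup>2 * (l * w))" using u3 B(4) by (intro mult_left_mono) auto
    finally have v2: "d * I \<le> l * w * y * (2 * c\<^sup>2)" by (simp add: mult_ac)
    \<comment> \<open>Prepares the estimate 1 \<le> 2 I / \<Delta>^2, which turns the summand 1 of
      the packing bound into a multiple of the budget.\<close>
    have "\<Delta>\<^sup>2 \<le> (1 / 2)\<^sup>2" using \<Delta> by (intro power_mono) auto
    then have "\<Delta>\<^sup>2 \<le> 2 * I" using I by (simp add: power2_eq_square)
    then have D1: "1 \<le> 2 * I / \<Delta>\<^sup>2" using \<Delta> by simp
    have "1 \<le> 2 / \<Delta>" using \<Delta> by (simp add: field_simps)
    then have lp: "0 \<le> ln (2 / \<Delta>)" by (rule ln_ge_zero)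
    have e: "\<beta>\<^sup>2 / (\<Delta> / 2)\<^sup>2 = 4 * \<beta>\<^sup>2 / \<Delta>\<^sup>2" by (simp add: power_divide)
    have "(\<beta>\<^sup>2 / (\<Delta> / 2)\<^sup>2 + 1) * (c * d * ln (2 / \<Delta>)) \<le>
        (4 * \<beta>\<^sup>2 / \<Delta>\<^sup>2 + 2 * I / \<Delta>\<^sup>2) * (c * d * (2 * l))"
      unfolding e using D1 B(3,6) c l0 I lp
      by (intro mult_mono add_mono add_nonneg_nonneg divide_nonneg_nonneg mult_nonneg_nonneg) auto
    also have "\<dots> = 2 * c * l / \<Delta>\<^sup>2 * ((4 * \<kappa> + 2) * (d * I) + 4 * \<kappa> * (d\<^sup>2 * ln (real N)))"
      unfolding \<beta>2 by (simp add: power2_eq_square divide_simps) (simp add: algebra_simps)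
    also have "\<dots> \<le> 2 * c * l / \<Delta>\<^sup>2 * ((4 * \<kappa> + 2) * (l * w * y * (2 * c\<^sup>2)) +
        4 * \<kappa> * (l * w * y * (2 * c\<^sup>2 * (\<rho> + 1) + 4 * c\<^sup>2 + 2 * (2 * c + 1))))"
      using v1 v2 \<kappa> c l0 by (intro mult_left_mono add_mono) auto
    also have "\<dots> = T * (a + b * \<rho>)"
      unfolding T_def a_def b_def by (simp add: power2_eq_square divide_simps) (simp add: algebra_simps)
    also have "\<dots> < T * C\<^sub>1" using C1(3) T0 by (intro mult_strict_left_mono) (auto simp: \<rho>_def)
    also have "\<dots> \<le> real N" using N1(1) by (simp add: mult.commute)
    finally have r4: "(\<beta>\<^sup>2 / (\<Delta> / 2)\<^sup>2 + 1) * (c * d * ln (2 / \<Delta>)) < real N" .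
    show "let N = num_queries (C\<^sub>1 * (ln (1 / \<Delta>))\<^sup>2) d \<Delta> \<delta>; \<beta> = conf_radius C\<^sub>2 d \<delta> N in
      2 \<le> N \<and>
      real N \<le> 2 * C\<^sub>1 * ((ln (1 / \<Delta>))\<^sup>2 * (ln d)\<^sup>2 * (d\<^sup>2 + d * ln (1 / \<delta>)) / \<Delta>\<^sup>2) \<and>
      6 + 2 * (c * d * ln (real N)) + 2 * ln (1 / \<delta>) \<le> \<beta>\<^sup>2 \<and> 0 \<le> \<beta> \<and>
      (\<beta>\<^sup>2 / (\<Delta> / 2)\<^sup>2 + 1) * (c * d * ln (2 / \<Delta>)) < real N"
      unfolding Let_def N_def[symmetric] \<beta>_def[symmetric]
      using N2 N3 r3 \<beta>0 r4 by (simp add: T_def l_def w_def y_def I_def)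
  qed
qed

text \<open>Of the five logarithms, two come from ln(1/\<Delta>)^2, two from (ln d)^2 and one from
  the confidence level. As cd \<ge> 1, the linear term in d is dominated by c d^2.\<close>

lemma query_count_polylog:
  fixes c d \<Delta> \<delta> :: real and H :: nat
  assumes c: "0 < c" and d: "1 / c \<le> d" and \<Delta>: "0 < \<Delta>" "\<Delta> < 1 / 2" and \<delta>: "0 < \<delta>" "\<delta> < 1" and H: "1 \<le> H"
  shows "(ln (1 / \<Delta>))\<^sup>2 * (ln d)\<^sup>2 * (d\<^sup>2 + d * ln (1 / (\<delta> / (2 * real H)))) / \<Delta>\<^sup>2
    \<le> (1 + 3 * c) * (1 + \<bar>ln c\<bar>)\<^sup>2 * (d\<^sup>2 / \<Delta>\<^sup>2) * ln (d + real H + 1 / \<Delta> + 1 / \<delta>) ^ 5"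
proof -
  define Y where "Y = ln (d + real H + 1 / \<Delta> + 1 / \<delta>)"
  have "0 < 1 / c" using c by simp
  then have d0: "0 < d" using d by linarith
  have D: "2 \<le> 1 / \<Delta>" and D': "1 \<le> 1 / \<delta>" using \<Delta> \<delta> by (simp_all add: field_simps)
  have H': "1 \<le> real H" using H by simp
  have Y: "ln x \<le> Y" if "0 < x" "x \<le> d + real H + 1 / \<Delta> + 1 / \<delta>" for x
    unfolding Y_def using that by (intro ln_mono) auto
  have "exp 1 \<le> (3::real)" by (rule exp_le)
  then have "ln (exp 1) \<le> Y" using D D' d0 H by (intro Y) auto
  then have Y1: "1 \<le> Y" by simp
  have lD: "ln (1 / \<Delta>) \<le> Y" "0 \<le> ln (1 / \<Delta>)" using D D' d0 \<Delta> by (auto intro!: Y)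
  then have l2: "(ln (1 / \<Delta>))\<^sup>2 \<le> Y\<^sup>2" by (intro power_mono)
  have "ln d \<le> Y" using D D' d0 by (intro Y) auto
  \<comment> \<open>For small d the logarithm is negative and \<open>Y\<close> does not bound its
    modulus; the regularity constant does.\<close>
  moreover have "- ln d \<le> \<bar>ln c\<bar>"
  proof -
    have "ln (1 / c) \<le> ln d" using d c by (intro ln_mono) auto
    then show ?thesis using c by (simp add: ln_div)
  qed
  moreover have "\<bar>ln c\<bar> \<le> \<bar>ln c\<bar> * Y" using Y1 by (simp add: mult_le_cancel_left1)
  ultimately have "\<bar>ln d\<bar> \<le> (1 + \<bar>ln c\<bar>) * Y" using Y1 by (simp add: algebra_simps)
  then have w: "(ln d)\<^sup>2 \<le> ((1 + \<bar>ln c\<bar>) * Y)\<^sup>2" by (metis abs_ge_zero power2_abs power_mono)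
  have "ln (1 / (\<delta> / (2 * real H))) = ln 2 + ln (real H) + ln (1 / \<delta>)"
    using \<delta> H by (simp add: ln_mult ln_div)
  also have "\<dots> \<le> Y + Y + Y"
    by (intro add_mono Y) (use D D' d0 H' in linarith)+
  finally have I: "ln (1 / (\<delta> / (2 * real H))) \<le> 3 * Y" by simp
  have "d\<^sup>2 + d * ln (1 / (\<delta> / (2 * real H))) \<le> d\<^sup>2 * Y + (c * d) * d * (3 * Y)"
  proof (intro add_mono)
    show "d\<^sup>2 \<le> d\<^sup>2 * Y" using Y1 by (simp add: mult_le_cancel_left1)
    have "1 * d \<le> (c * d) * d" using d c d0 by (intro mult_right_mono) (auto simp: field_simps)
    then show "d * ln (1 / (\<delta> / (2 * real H))) \<le> (c * d) * d * (3 * Y)"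
      using I d0 Y1 c by (intro order_trans[OF mult_left_mono[OF I]] mult_right_mono) auto
  qed
  also have "\<dots> = (1 + 3 * c) * d\<^sup>2 * Y" by (simp add: algebra_simps power2_eq_square)
  finally have y: "d\<^sup>2 + d * ln (1 / (\<delta> / (2 * real H))) \<le> (1 + 3 * c) * d\<^sup>2 * Y" .
  have "ln 1 \<le> ln (1 / (\<delta> / (2 * real H)))" using \<delta> H by (intro ln_mono) (auto simp: field_simps)
  then have y0: "0 \<le> d\<^sup>2 + d * ln (1 / (\<delta> / (2 * real H)))" using d0 by simp
  have "(ln (1 / \<Delta>))\<^sup>2 * (ln d)\<^sup>2 * (d\<^sup>2 + d * ln (1 / (\<delta> / (2 * real H)))) / \<Delta>\<^sup>2
    \<le> Y\<^sup>2 * ((1 + \<bar>ln c\<bar>) * Y)\<^sup>2 * ((1 + 3 * c) * d\<^sup>2 * Y) / \<Delta>\<^sup>2"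
    by (intro divide_right_mono mult_mono l2 w y y0) auto
  also have "\<dots> = (1 + 3 * c) * (1 + \<bar>ln c\<bar>)\<^sup>2 * (d\<^sup>2 / \<Delta>\<^sup>2) * Y ^ 5"
    by (simp add: power_mult_distrib power2_eq_square eval_nat_numeral mult_ac)
  finally show ?thesis by (simp add: Y_def)
qed


section \<open>High-probability guarantee\<close>

text \<open>Values in [0, 1] lie within 1/2 of 1/2, and there is at least one state-action pair.
  This keeps ln(1/\<Delta>) away from 0.\<close>

lemma human_feedback_margin:
  assumes "mdp_wf M" "human_feedback M F \<Delta> f"
  shows "0 < \<Delta>" "\<Delta> < 1 / 2"
proof -
  show "0 < \<Delta>" using assms(2) by (simp add: human_feedback_def)
  obtain a where "a \<in> actions M" using assms(1) by (auto simp: mdp_wf_def)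
  then have z: "(init_state M, a) \<in> sa_space M" and h: "1 \<in> {1..horizon M}"
    using assms(1) by (auto simp: mdp_wf_def)
  have "f 1 \<in> F" "\<Delta> < \<bar>f 1 (init_state M, a) - 1 / 2\<bar>" "F \<subseteq> sa_space M \<rightarrow> {0..1}"
    using assms(2) h z unfolding human_feedback_def by blast+
  moreover from this z have "f 1 (init_state M, a) \<in> {0..1}" by blast
  ultimately show "\<Delta> < 1 / 2" by (auto simp: abs_if split: if_splits)
qed

lemma active_queries_in_pool:
  assumes "active_queries X F C\<^sub>1 C\<^sub>2 \<Delta> \<delta> Z zs"
  shows "set zs \<subseteq> Z"
proof
  fix z assume "z \<in> set zs"
  then obtain k where "k < length zs" "z = zs ! k" by (auto simp: in_set_conv_nth)
  then show "z \<in> Z"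
    using assms unfolding active_queries_def Let_def by (auto simp: is_arg_max_def)
qed

text \<open>On the confidence event the regression is within \<Delta>/2 of the truth on the pool,
  and rounding to the cover adds at most \<Delta>/2. The total \<Delta> is strictly below the
  margin, so thresholding at 1/2 recovers the reward there.\<close>

lemma active_reward_learning_correct:
  assumes wf: "mdp_wf M" and hf: "human_feedback M F \<Delta> f"
    and reg: "complexity_regular c (sa_space M) F" and G: "sup_cover (sa_space M) F (\<Delta> / 2) G"
    and h: "h \<in> {1..horizon M}" and \<delta>: "0 < \<delta>"
    and act: "active_queries (sa_space M) F C\<^sub>1 C\<^sub>2 \<Delta> \<delta> Z (zs h)" and Z: "Z \<subseteq> sa_space M"
    and pool: "\<And>h. h \<in> {1..horizon M} \<Longrightarrow> set (zs h) \<subseteq> sa_space M"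
    and N2: "2 \<le> length (zs h)"
    and \<beta>: "\<beta> = conf_radius C\<^sub>2 (class_dim (sa_space M) F) \<delta> (length (zs h))" "0 \<le> \<beta>"
    and conf: "6 + 2 * (c * class_dim (sa_space M) F * ln (real (length (zs h)))) + 2 * ln (1 / \<delta>) \<le> \<beta>\<^sup>2"
    and long: "(\<beta>\<^sup>2 / (\<Delta> / 2)\<^sup>2 + 1) * (c * class_dim (sa_space M) F * ln (2 / \<Delta>)) < real (length (zs h))"
  shows "measure_pmf.prob (Pi_pmf (SIGMA h:{1..horizon M}. {..<length (zs h)}) False
          (\<lambda>(h, i). bernoulli_pmf (f h (zs h ! i))))
      {l. \<exists>r. learned_reward (sa_space M) F G \<Delta> (zs h) (\<lambda>i. l (h, i)) r \<and> (\<exists>z\<in>Z. r z \<noteq> rew M h z)} \<le> \<delta>"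
proof -
  define X where "X = sa_space M"
  define d where "d = class_dim X F"
  define I where "I = (SIGMA h:{1..horizon M}. {..<length (zs h)})"
  define q where "q = (\<lambda>(h, i). f h (zs h ! i))"
  define \<mu> where "\<mu> = Pi_pmf I False (\<lambda>i. bernoulli_pmf (q i))"
  define R where "R = 6 + 2 * ln (real (covering_number X F (1 / real (length (zs h))))) + 2 * ln (1 / \<delta>)"
  note \<Delta> = human_feedback_margin[OF wf hf]
  have X: "finite X" "X \<noteq> {}" using wf by (auto simp: X_def mdp_wf_def)
  have F: "F \<subseteq> X \<rightarrow> {0..1}" using hf by (simp add: human_feedback_def X_def)
  have fF: "f h \<in> F" if "h \<in> {1..horizon M}" for h using hf that by (simp add: human_feedback_def)
  have mar: "\<Delta> < \<bar>f h z - 1 / 2\<bar>" "rew M h z = of_bool (f h z > 1 / 2)" if "z \<in> X" for z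
    using hf h that unfolding human_feedback_def X_def by blast+
  have \<mu>: "Pi_pmf (SIGMA h:{1..horizon M}. {..<length (zs h)}) False
      (\<lambda>(h, i). bernoulli_pmf (f h (zs h ! i))) = \<mu>"
    by (simp add: \<mu>_def I_def q_def case_prod_unfold)
  have q01: "q i \<in> {0..1}" if "i \<in> I" for i
  proof -
    obtain h' k where i: "i = (h', k)" by (cases i)
    then have h': "h' \<in> {1..horizon M}" and k: "k < length (zs h')" using that by (auto simp: I_def)
    then have "zs h' ! k \<in> X" using pool[OF h'] unfolding X_def by (meson nth_mem subsetD)
    then have "f h' (zs h' ! k) \<in> {0..1}" using F fF[OF h'] by blast
    then show ?thesis by (simp add: q_def i)
  qed
  \<comment> \<open>Two queries are required so that the cover scale 1/N falls into the range of
    scales covered by regularity.\<close>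
  have inv: "0 < 1 / real (length (zs h))" "1 / real (length (zs h)) \<le> 1 / 2"
    using N2 by (auto simp: divide_simps)
  have "ln (real (covering_number X F (1 / real (length (zs h))))) \<le> c * d * ln (1 / (1 / real (length (zs h))))"
    using reg inv unfolding complexity_regular_def X_def d_def by blast
  then have R: "R \<le> \<beta>\<^sup>2" using conf by (simp add: R_def X_def d_def)
  have eluder: "ereal_of_enat (eluder_dim_at X F (\<Delta> / 2)) \<le> ereal (c * d * ln (2 / \<Delta>))"
  proof -
    have "0 < \<Delta> / 2" "\<Delta> / 2 \<le> 1 / 2" using \<Delta> by auto
    then have "ereal_of_enat (eluder_dim_at X F (\<Delta> / 2)) \<le> ereal (c * d * ln (1 / (\<Delta> / 2)))"
      using reg unfolding complexity_regular_def X_def d_def by blast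
    then show ?thesis by simp
  qed
  have greedy: "is_arg_max (width F \<beta> (take k (zs h))) (\<lambda>z. z \<in> Z) (zs h ! k)" if "k < length (zs h)" for k
    using act that unfolding active_queries_def Let_def \<beta>(1) by auto
  have "{l. \<exists>r. learned_reward X F G \<Delta> (zs h) (\<lambda>i. l (h, i)) r \<and> (\<exists>z\<in>Z. r z \<noteq> rew M h z)} \<subseteq>
    {l. \<exists>ft. is_arg_min (\<lambda>g. \<Sum>i<length (zs h). (g (zs h ! i) - of_bool (l (h, i)))\<^sup>2) (\<lambda>g. g \<in> F) ft \<and>
      R < (seq_norm (\<lambda>z. ft z - f h z) (zs h))\<^sup>2}"
  proof
    fix l assume "l \<in> {l. \<exists>r. learned_reward X F G \<Delta> (zs h) (\<lambda>i. l (h, i)) r \<and> (\<exists>z\<in>Z. r z \<noteq> rew M h z)}"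
    then obtain ft fh z where
      ft: "is_arg_min (\<lambda>g. \<Sum>i<length (zs h). (g (zs h ! i) - of_bool (l (h, i)))\<^sup>2) (\<lambda>g. g \<in> F) ft"
      and fh: "sup_norm X (\<lambda>z. fh z - ft z) \<le> \<Delta> / 2"
      and z: "z \<in> Z" "of_bool (fh z > 1 / 2) \<noteq> rew M h z"
      unfolding learned_reward_def by auto
    have ftF: "ft \<in> F" using ft by (auto simp: is_arg_min_linorder)
    have zX: "z \<in> X" using z(1) Z by (auto simp: X_def)
    have "R < (seq_norm (\<lambda>z. ft z - f h z) (zs h))\<^sup>2"
    proof (rule ccontr)
      assume "\<not> R < (seq_norm (\<lambda>z. ft z - f h z) (zs h))\<^sup>2"
      then have "(seq_norm (\<lambda>z. ft z - f h z) (zs h))\<^sup>2 \<le> \<beta>\<^sup>2" using R by simp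
      then have le: "seq_norm (\<lambda>z. ft z - f h z) (zs h) \<le> \<beta>" by (rule power2_le_imp_le[OF _ \<beta>(2)])
      have "\<bar>ft z - f h z\<bar> \<le> \<Delta> / 2"
        by (rule final_width_small[OF _ \<beta>(2) _ F greedy eluder _ z(1) ftF fF[OF h] le])
           (use \<Delta> Z long in \<open>auto simp: X_def d_def\<close>)
      moreover have "\<bar>fh z - ft z\<bar> \<le> \<Delta> / 2"
        using sup_norm_upper[OF X(1) zX, of "\<lambda>z. fh z - ft z"] fh by simp
      ultimately have "fh z > 1 / 2 \<longleftrightarrow> f h z > 1 / 2" using mar(1)[OF zX] by (auto simp: abs_if split: if_splits)
      then show False using z(2) mar(2)[OF zX] by simp
    qed
    with ft show "l \<in> {l. \<exists>ft. is_arg_min (\<lambda>g. \<Sum>i<length (zs h). (g (zs h ! i) - of_bool (l (h, i)))\<^sup>2) (\<lambda>g. g \<in> F) ft \<and>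
      R < (seq_norm (\<lambda>z. ft z - f h z) (zs h))\<^sup>2}" by blast
  qed
  then have "measure_pmf.prob \<mu> {l. \<exists>r. learned_reward X F G \<Delta> (zs h) (\<lambda>i. l (h, i)) r \<and> (\<exists>z\<in>Z. r z \<noteq> rew M h z)}
    \<le> measure_pmf.prob \<mu> {l. \<exists>ft. is_arg_min (\<lambda>g. \<Sum>i<length (zs h). (g (zs h ! i) - of_bool (l (h, i)))\<^sup>2) (\<lambda>g. g \<in> F) ft \<and>
      R < (seq_norm (\<lambda>z. ft z - f h z) (zs h))\<^sup>2}"
    by (intro measure_pmf.finite_measure_mono) auto
  also have "\<dots> \<le> \<delta>"
    unfolding \<mu>_def R_def
    by (rule least_squares_confidence[OF X F fF[OF h] _ _ \<delta> _ _ q01])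
       (use pool[OF h] N2 h in \<open>auto simp: X_def I_def q_def\<close>)
  finally show ?thesis unfolding \<mu> X_def .
qed

text \<open>Two-stage union bound: failures of the dataset are charged to \<open>b\<close>, and off
  \<open>B\<close> the labels fail with conditional probability at most \<open>c\<close>.\<close>

lemma prob_bind_pair_pmf_le:
  assumes bad: "measure_pmf.prob p B \<le> b" and c: "0 \<le> c"
    and E: "\<And>D. D \<in> set_pmf p \<Longrightarrow> D \<notin> B \<Longrightarrow> measure_pmf.prob (\<mu> D) {l. (D, l) \<in> E} \<le> c"
  shows "measure_pmf.prob (bind_pmf p (\<lambda>D. map_pmf (Pair D) (\<mu> D))) E \<le> b + c"
proof -
  have b: "0 \<le> b" using bad measure_nonneg[of "measure_pmf p" B] by linarith
  have "emeasure (bind_pmf p (\<lambda>D. map_pmf (Pair D) (\<mu> D))) E =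
    (\<integral>\<^sup>+D. emeasure (measure_pmf (\<mu> D)) {l. (D, l) \<in> E} \<partial>measure_pmf p)"
    by (simp add: emeasure_bind_pmf vimage_def)
  also have "\<dots> \<le> (\<integral>\<^sup>+D. indicator B D + ennreal c \<partial>measure_pmf p)"
  proof (rule nn_integral_mono_AE, unfold AE_measure_pmf_iff, intro ballI)
    fix D assume D: "D \<in> set_pmf p"
    show "emeasure (measure_pmf (\<mu> D)) {l. (D, l) \<in> E} \<le> indicator B D + ennreal c"
    proof (cases "D \<in> B")
      case True
      have "emeasure (measure_pmf (\<mu> D)) {l. (D, l) \<in> E} \<le> 1" by (rule measure_pmf.emeasure_le_1)
      then show ?thesis using True by (simp add: add_increasing2)
    next
      case False
      then show ?thesis using E[OF D False] c
        by (simp add: measure_pmf.emeasure_eq_measure ennreal_leI)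
    qed
  qed
  also have "\<dots> = ennreal (measure_pmf.prob p B) + ennreal c"
    by (subst nn_integral_add) (auto simp: measure_pmf.emeasure_eq_measure)
  also have "\<dots> \<le> ennreal (b + c)"
    using bad b c by (simp add: ennreal_plus[symmetric] ennreal_leI del: ennreal_plus)
  finally show ?thesis using b c by (simp add: measure_pmf.emeasure_eq_measure del: ennreal_plus)
qed

text \<open>Query points are functions of the dataset alone, so given \<open>D\<close> the labels
  are independent and their failure can be bounded dataset by dataset. Inaccurate transitions use up
  \<delta>/2 and the H stages of labels \<delta>/(2H) each.\<close>

lemma prob_lcbvi_suboptimality:
  assumes wf: "mdp_wf M" and K: "1 \<le> K" and \<delta>: "0 < \<delta>" "\<delta> < 1" and hf: "human_feedback M F \<Delta> f"
    and data: "\<forall>D\<in>set_pmf p. dataset_in M K D" and comp: "compliant M K p"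
    and opt: "optimal_policy M \<pi>opt"
    and learn: "\<And>D h. D \<in> set_pmf p \<Longrightarrow> h \<in> {1..horizon M} \<Longrightarrow>
      measure_pmf.prob (Pi_pmf (SIGMA h:{1..horizon M}. {..<length (zs D h)}) False
          (\<lambda>(h, i). bernoulli_pmf (f h (zs D h ! i))))
      {l. \<exists>r. learned_reward (sa_space M) F G \<Delta> (zs D h) (\<lambda>i. l (h, i)) r \<and>
        (\<exists>z\<in>sa D h ` {1..K}. r z \<noteq> rew M h z)} \<le> \<delta> / (2 * real (horizon M))"
  shows "measure_pmf.prob (feedback_law M f p zs)
         {(D, l). \<forall>\<pi>. lcbvi_output M F G (1 / 2) \<Delta> K \<delta> D (zs D) l \<pi> \<longrightarrow>
            opt_value M 1 (init_state M) - value_fn M (det_policy \<pi>) 1 (init_state M)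
            \<le> 2 * (horizon M * sqrt (card (states M) * log_factor M K \<delta>) *
                 expected_total M \<pi>opt (\<lambda>h z. 1 / sqrt (real (visits K D h z) + 1))
                   1 (init_state M))}
         \<ge> 1 - \<delta>"
    (is "measure_pmf.prob _ ?E \<ge> _")
proof -
  define \<mu> where "\<mu> = (\<lambda>D. Pi_pmf (SIGMA h:{1..horizon M}. {..<length (zs D h)}) False
          (\<lambda>(h, i). bernoulli_pmf (f h (zs D h ! i))))"
  define bad where "bad = (\<lambda>D h. {l. \<exists>r. learned_reward (sa_space M) F G \<Delta> (zs D h) (\<lambda>i. l (h, i)) r \<and>
        (\<exists>z\<in>sa D h ` {1..K}. r z \<noteq> rew M h z)})"
  have H: "1 \<le> horizon M" using wf by (simp add: mdp_wf_def)
  have bad_labels: "measure_pmf.prob (\<mu> D) {l. (D, l) \<in> - ?E} \<le> \<delta> / 2"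
    if D: "D \<in> set_pmf p" and acc: "D \<notin> {D. \<not> accurate_transitions M K \<delta> D}" for D
  proof -
    have "{l. (D, l) \<in> - ?E} \<subseteq> (\<Union>h\<in>{1..horizon M}. bad D h)"
    proof
      fix l assume "l \<in> {l. (D, l) \<in> - ?E}"
      then obtain \<pi> where out: "lcbvi_output M F G (1 / 2) \<Delta> K \<delta> D (zs D) l \<pi>"
        and gt: "\<not> opt_value M 1 (init_state M) - value_fn M (det_policy \<pi>) 1 (init_state M)
            \<le> 2 * (real (horizon M) * sqrt (real (card (states M)) * log_factor M K \<delta>) *
                 expected_total M \<pi>opt (\<lambda>h z. 1 / sqrt (real (visits K D h z) + 1)) 1 (init_state M))"
        by auto
      from out obtain r where
        r: "\<And>h. h \<in> {1..horizon M} \<Longrightarrow> learned_reward (sa_space M) F G \<Delta> (zs D h) (\<lambda>i. l (h, i)) (r h)"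
        and \<pi>: "\<And>h s. h \<in> {1..horizon M} \<Longrightarrow> s \<in> states M \<Longrightarrow>
          is_arg_max (\<lambda>a. q_hat M (1 / 2) K \<delta> D r h (s, a)) (\<lambda>a. a \<in> actions M) (\<pi> h s)"
        unfolding lcbvi_output_def by blast
      show "l \<in> (\<Union>h\<in>{1..horizon M}. bad D h)"
      proof (rule ccontr)
        assume good: "l \<notin> (\<Union>h\<in>{1..horizon M}. bad D h)"
        have "r h z = rew M h z" if "h \<in> {1..horizon M}" "1 \<le> visits K D h z" for h z
        proof -
          have "{k\<in>{1..K}. sa D h k = z} \<noteq> {}" using that(2) by (metis card.empty not_one_le_zero visits_def)
          then have "z \<in> sa D h ` {1..K}" by auto
          then show ?thesis using good r[OF that(1)] that(1) by (auto simp: bad_def)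
        qed
        moreover have "r h z \<le> 1" if "h \<in> {1..horizon M}" for h z
          using r[OF that] by (auto simp: learned_reward_def)
        ultimately show False
          using gt planning_suboptimality[OF wf bspec[OF data D] _ K \<delta> refl _ _ \<pi> opt] acc by blast
      qed
    qed
    then have "measure_pmf.prob (\<mu> D) {l. (D, l) \<in> - ?E} \<le> measure_pmf.prob (\<mu> D) (\<Union>h\<in>{1..horizon M}. bad D h)"
      by (intro measure_pmf.finite_measure_mono) auto
    also have "\<dots> \<le> (\<Sum>h\<in>{1..horizon M}. measure_pmf.prob (\<mu> D) (bad D h))"
      by (intro measure_pmf.finite_measure_subadditive_finite) auto
    also have "\<dots> \<le> (\<Sum>h\<in>{1..horizon M}. \<delta> / (2 * real (horizon M)))"
      unfolding \<mu>_def bad_def by (intro sum_mono learn D)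
    also have "\<dots> = \<delta> / 2" using H by simp
    finally show ?thesis .
  qed
  have "feedback_law M f p zs = bind_pmf p (\<lambda>D. map_pmf (Pair D) (\<mu> D))"
    by (simp add: feedback_law_def \<mu>_def)
  moreover have "measure_pmf.prob (bind_pmf p (\<lambda>D. map_pmf (Pair D) (\<mu> D))) (- ?E) \<le> \<delta> / 2 + \<delta> / 2"
    by (rule prob_bind_pair_pmf_le[OF prob_accurate_transitions[OF wf data comp K \<delta>] _ bad_labels])
       (use \<delta> in auto)
  ultimately have "measure_pmf.prob (feedback_law M f p zs) (- ?E) \<le> \<delta> / 2 + \<delta> / 2" by simp
  moreover have "measure_pmf.prob (feedback_law M f p zs) (- ?E) = 1 - measure_pmf.prob (feedback_law M f p zs) ?E"
    using measure_pmf.prob_compl[of ?E "feedback_law M f p zs"] by (simp add: Compl_eq_Diff_UNIV)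
  ultimately show ?thesis by linarith
qed

text \<open>\<open>C\<close> is fixed before the regularity constant \<open>c\<close>; the query
  constants and the constants of the query bound may depend on \<open>c\<close>, but not on the MDP,
  the class, \<Delta>, \<delta> or the data.\<close>

theorem theorem3:
  "\<exists>C::real>0. \<forall>c::real>0. \<exists>C\<^sub>1::real>0. \<exists>C\<^sub>2::real>0. \<exists>(B::real) (q::nat).
     \<forall>(M :: (nat, nat) mdp) F f (\<Delta> :: real) (\<delta> :: real) K p G zs \<pi>opt.
       mdp_wf M \<and> 1 \<le> K \<and> 0 < \<delta> \<and> \<delta> < 1 \<and>
       human_feedback M F \<Delta> f \<and>
       complexity_regular c (sa_space M) F \<and>
       (\<forall>D\<in>set_pmf p. dataset_in M K D) \<and> compliant M K p \<and>
       sup_cover (sa_space M) F (\<Delta> / 2) G \<and> card G \<le> covering_number (sa_space M) F (\<Delta> / 2) \<and>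
       (\<forall>D\<in>set_pmf p. \<forall>h\<in>{1..horizon M}.
          active_queries (sa_space M) F (C\<^sub>1 * (ln (1 / \<Delta>))\<^sup>2) C\<^sub>2 \<Delta> (\<delta> / (2 * horizon M))
            (sa D h ` {1..K}) (zs D h)) \<and>
       optimal_policy M \<pi>opt
       \<longrightarrow>
       measure_pmf.prob (feedback_law M f p zs)
         {(D, l). \<forall>\<pi>. lcbvi_output M F G C \<Delta> K \<delta> D (zs D) l \<pi> \<longrightarrow>
            opt_value M 1 (init_state M) - value_fn M (det_policy \<pi>) 1 (init_state M)
            \<le> 2 * (horizon M * sqrt (card (states M) * log_factor M K \<delta>) *
                 expected_total M \<pi>opt (\<lambda>h z. 1 / sqrt (real (visits K D h z) + 1))
                   1 (init_state M))}
         \<ge> 1 - \<delta>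
       \<and>
       (\<forall>D\<in>set_pmf p.
          real (\<Sum>h = 1..horizon M. length (zs D h))
          \<le> B * (horizon M * (class_dim (sa_space M) F)\<^sup>2 / \<Delta>\<^sup>2)
               * (ln (class_dim (sa_space M) F + horizon M + 1 / \<Delta> + 1 / \<delta>)) ^ q)"
    (is "\<exists>C>0. \<forall>c>0. ?P C c")
proof -
  have "?P (1 / 2) c" if c: "0 < c" for c
  proof -
    obtain C\<^sub>1 C\<^sub>2 where C: "0 < C\<^sub>1" "0 < C\<^sub>2" and budget: "\<And>d \<Delta> \<delta>. 1 / c \<le> d \<Longrightarrow> 1 / c \<le> \<bar>ln d\<bar> \<Longrightarrow>
        0 < \<Delta> \<Longrightarrow> \<Delta> < 1 / 2 \<Longrightarrow> 0 < \<delta> \<Longrightarrow> \<delta> \<le> 1 / 2 \<Longrightarrow>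
      (let N = num_queries (C\<^sub>1 * (ln (1 / \<Delta>))\<^sup>2) d \<Delta> \<delta>; \<beta> = conf_radius C\<^sub>2 d \<delta> N in
        2 \<le> N \<and>
        real N \<le> 2 * C\<^sub>1 * ((ln (1 / \<Delta>))\<^sup>2 * (ln d)\<^sup>2 * (d\<^sup>2 + d * ln (1 / \<delta>)) / \<Delta>\<^sup>2) \<and>
        6 + 2 * (c * d * ln (real N)) + 2 * ln (1 / \<delta>) \<le> \<beta>\<^sup>2 \<and> 0 \<le> \<beta> \<and>
        (\<beta>\<^sup>2 / (\<Delta> / 2)\<^sup>2 + 1) * (c * d * ln (2 / \<Delta>)) < real N)"
      using query_budget_sufficient[OF c] by blast
    \<comment> \<open>The factor 2 is the cost of rounding the number of queries up; the rest is the
      constant of the polylogarithmic estimate.\<close>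
    define B where "B = 2 * C\<^sub>1 * ((1 + 3 * c) * (1 + \<bar>ln c\<bar>)\<^sup>2)"
    show ?thesis
    proof (rule exI[of _ C\<^sub>1], rule conjI[OF C(1)], rule exI[of _ C\<^sub>2], rule conjI[OF C(2)],
        rule exI[of _ B], rule exI[of _ 5], intro allI impI, elim conjE)
      fix M :: "(nat, nat) mdp" and F f \<Delta> \<delta> K p G zs \<pi>opt
      assume wf: "mdp_wf M" and K: "1 \<le> K" and \<delta>: "0 < \<delta>" "\<delta> < 1" and hf: "human_feedback M F \<Delta> f"
        and reg: "complexity_regular c (sa_space M) F"
        and data: "\<forall>D\<in>set_pmf p. dataset_in M K D" and comp: "compliant M K p"
        and G: "sup_cover (sa_space M) F (\<Delta> / 2) G"
        and act: "\<forall>D\<in>set_pmf p. \<forall>h\<in>{1..horizon M}.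
          active_queries (sa_space M) F (C\<^sub>1 * (ln (1 / \<Delta>))\<^sup>2) C\<^sub>2 \<Delta> (\<delta> / (2 * horizon M))
            (sa D h ` {1..K}) (zs D h)"
        and opt: "optimal_policy M \<pi>opt"
      define d where "d = class_dim (sa_space M) F"
      \<comment> \<open>The confidence level of a single stage; it is at most 1/2, so
        ln(1/\<delta>') is bounded below as the budget requires.\<close>
      define \<delta>' where "\<delta>' = \<delta> / (2 * real (horizon M))"
      define N where "N = num_queries (C\<^sub>1 * (ln (1 / \<Delta>))\<^sup>2) d \<Delta> \<delta>'"
      define \<beta> where "\<beta> = conf_radius C\<^sub>2 d \<delta>' N"
      have H: "1 \<le> horizon M" using wf by (simp add: mdp_wf_def)
      note \<Delta> = human_feedback_margin[OF wf hf]
      have \<delta>': "0 < \<delta>'" "\<delta>' \<le> 1 / 2" using \<delta> H by (auto simp: \<delta>'_def divide_simps)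
      have d: "1 / c \<le> d" "1 / c \<le> \<bar>ln d\<bar>" using reg by (auto simp: complexity_regular_def d_def)
      have N: "2 \<le> N" "real N \<le> 2 * C\<^sub>1 * ((ln (1 / \<Delta>))\<^sup>2 * (ln d)\<^sup>2 * (d\<^sup>2 + d * ln (1 / \<delta>')) / \<Delta>\<^sup>2)"
        "6 + 2 * (c * d * ln (real N)) + 2 * ln (1 / \<delta>') \<le> \<beta>\<^sup>2" "0 \<le> \<beta>"
        "(\<beta>\<^sup>2 / (\<Delta> / 2)\<^sup>2 + 1) * (c * d * ln (2 / \<Delta>)) < real N"
        using budget[OF d \<Delta> \<delta>'] unfolding Let_def N_def[symmetric] \<beta>_def[symmetric] by auto
      have act': "active_queries (sa_space M) F (C\<^sub>1 * (ln (1 / \<Delta>))\<^sup>2) C\<^sub>2 \<Delta> \<delta>' (sa D h ` {1..K}) (zs D h)"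
        if "D \<in> set_pmf p" "h \<in> {1..horizon M}" for D h
        using act that by (simp add: \<delta>'_def)
      have len: "length (zs D h) = N" if "D \<in> set_pmf p" "h \<in> {1..horizon M}" for D h
        using act'[OF that] unfolding active_queries_def Let_def by (simp add: N_def d_def)
      have Z: "sa D h ` {1..K} \<subseteq> sa_space M" if "D \<in> set_pmf p" "h \<in> {1..horizon M}" for D h
        using data that by (auto simp: dataset_in_def sa_def)
      have pool: "set (zs D h) \<subseteq> sa_space M" if "D \<in> set_pmf p" "h \<in> {1..horizon M}" for D h
        using active_queries_in_pool[OF act'[OF that]] Z[OF that] by blast
      have learn: "measure_pmf.prob (Pi_pmf (SIGMA h:{1..horizon M}. {..<length (zs D h)}) False
          (\<lambda>(h, i). bernoulli_pmf (f h (zs D h ! i))))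
        {l. \<exists>r. learned_reward (sa_space M) F G \<Delta> (zs D h) (\<lambda>i. l (h, i)) r \<and>
          (\<exists>z\<in>sa D h ` {1..K}. r z \<noteq> rew M h z)} \<le> \<delta> / (2 * real (horizon M))"
        if "D \<in> set_pmf p" "h \<in> {1..horizon M}" for D h
        unfolding \<delta>'_def[symmetric]
        using N len[OF that]
        by (intro active_reward_learning_correct[where \<beta> = \<beta> and zs = "zs D" and h = h,
              OF wf hf reg G that(2) \<delta>'(1) act'[OF that] Z[OF that]] pool that(1))
           (auto simp: \<beta>_def d_def)
      have count: "real (\<Sum>h = 1..horizon M. length (zs D h))
          \<le> B * (horizon M * (class_dim (sa_space M) F)\<^sup>2 / \<Delta>\<^sup>2)
               * (ln (class_dim (sa_space M) F + horizon M + 1 / \<Delta> + 1 / \<delta>)) ^ 5"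
        if D: "D \<in> set_pmf p" for D
      proof -
        have "real (\<Sum>h = 1..horizon M. length (zs D h)) = real (horizon M) * real N"
          using len[OF D] by simp
        also have "\<dots> \<le> real (horizon M) * (2 * C\<^sub>1 * ((1 + 3 * c) * (1 + \<bar>ln c\<bar>)\<^sup>2 * (d\<^sup>2 / \<Delta>\<^sup>2) *
            ln (d + real (horizon M) + 1 / \<Delta> + 1 / \<delta>) ^ 5))"
          using C(1) query_count_polylog[OF c d(1) \<Delta> \<delta> H, folded \<delta>'_def]
          by (intro mult_left_mono order_trans[OF N(2)]) auto
        also have "\<dots> = B * (horizon M * d\<^sup>2 / \<Delta>\<^sup>2) * ln (d + horizon M + 1 / \<Delta> + 1 / \<delta>) ^ 5"
          by (simp add: B_def mult_ac)
        finally show ?thesis by (simp only: d_def)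
      qed
      show "measure_pmf.prob (feedback_law M f p zs)
         {(D, l). \<forall>\<pi>. lcbvi_output M F G (1 / 2) \<Delta> K \<delta> D (zs D) l \<pi> \<longrightarrow>
            opt_value M 1 (init_state M) - value_fn M (det_policy \<pi>) 1 (init_state M)
            \<le> 2 * (horizon M * sqrt (card (states M) * log_factor M K \<delta>) *
                 expected_total M \<pi>opt (\<lambda>h z. 1 / sqrt (real (visits K D h z) + 1))
                   1 (init_state M))}
         \<ge> 1 - \<delta>
       \<and>
       (\<forall>D\<in>set_pmf p.
          real (\<Sum>h = 1..horizon M. length (zs D h))
          \<le> B * (horizon M * (class_dim (sa_space M) F)\<^sup>2 / \<Delta>\<^sup>2)
               * (ln (class_dim (sa_space M) F + horizon M + 1 / \<Delta> + 1 / \<delta>)) ^ 5)"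
        using prob_lcbvi_suboptimality[OF wf K \<delta> hf data comp opt learn] count by blast
    qed
  qed
  then show ?thesis by (intro exI[of _ "1 / 2"]) simp
qed

end
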